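(* Let $\mathcal{H}$ be a compact metric space with a minimal dynamical system $\theta$, let $X$ be a real Banach space, $A$ a sectorial operator on $X$ with compact resolvent, $0\le r<\infty$, $\alpha\in[0,1)$, $\mathcal{C}_\alpha=C([-r,0],X^\alpha)$, and let $F:\mathcal{H}\times\mathcal{C}_\alpha\to X$ be continuous with $$\|F(p,\phi)-F(p,\phi')\|_0\le L\|\phi-\phi'\|_{\mathcal{C}_\alpha},\qquad\forall\,\phi,\phi'\in\mathcal{C}_\alpha,\ p\in\mathcal{H},$$ for some $L>0$. Consider the equation $$\frac{du}{dt}+Au=F(\theta_tp,u_t),\qquad t\ge0,\ p\in\mathcal{H}.\qquad(\ast)$$ Suppose that $A$ has a spectral decomposition $\sigma(A)=\sigma^-\cup\sigma^+$ with $\operatorname{Re}z\le-\beta<0$ for $z\in\sigma^-$ and $\operatorname{Re}z\ge\beta>0$ for $z\in\sigma^+$, for some $\beta>0$, and that $L<1/(\kappa_0M)$, where $M\ge1$ is the constant described in the context and $$\kappa_0=\sup_{t\ge0}\Big(\int_0^t(t-s)^{-\alpha}e^{-\beta(t-s)}\,ds+\int_t^\infty e^{\beta(t-s)}\,ds\Big).$$ Then: (1) Equation $(\ast)$ has a nonautonomous equilibrium solution $\Gamma\in C(\mathcal{H},X^\alpha)$. (2) For any $R,\varepsilon>0$ there exists $T>0$ such that for any bounded solution $u(t)=u(t;p,\phi)$ of $(\ast)$ with $\|\phi\|_{\mathcal{C}_\alpha}\le R$, $$\|u(t)-\Gamma(\theta_tp)\|_\alpha<\varepsilon,\qquad t>T.$$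 (3) There exists $c>0$ such that for any bounded solution $u(t)=u(t;p,\phi)$ of $(\ast)$, $$\|u(t)-\Gamma(\theta_tp)\|_\alpha\le c\max_{s\in[-r,0]}\|\phi(s)-\Gamma(\theta_sp)\|_\alpha,\qquad t\ge0.$$
   Context: Dynamical system on $\mathcal{H}$: a continuous map $\theta:\mathbb{R}\times\mathcal{H}\to\mathcal{H}$, written $\theta_tp=\theta(t,p)$, with $\theta_0p=p$ and $\theta_{s+t}p=\theta_s\theta_tp$. Minimal: $\theta$ has no proper nonempty compact invariant subset of $\mathcal{H}$. $\|\cdot\|_0$ is the norm of $X$. $X^s$ ($s\ge0$) is the fractional power space generated by $A$, with norm $\|u\|_s=\|\Lambda^su\|_0$, where $\Lambda=A+aI$ for a fixed $a$ such that $\operatorname{Re}\sigma(\Lambda)>0$. $\mathcal{C}_\alpha$ has the norm $\|\phi\|_{\mathcal{C}_\alpha}=\max_{s\in[-r,0]}\|\phi(s)\|_\alpha$. The lift of $u$ is $u_t(s)=u(t+s)$, $s\in[-r,0]$. Let $X=X_1\oplus X_2$ be the direct sum decomposition corresponding to $\sigma^-,\sigma^+$ ($X_i$ invariant under $A$), $P_i:X\to X_i$ the projections, $A_i=A|_{X_i}$. $M\ge1$ is a constant such that $$\|\Lambda^\alpha e^{-A_1t}P_1\|\le Me^{\beta t},\quad\|e^{-A_1t}P_1\|\le Me^{\beta t}\quad(t\le0),$$ $$\|\Lambda^\alpha e^{-A_2t}P_2\Lambda^{-\alpha}\|\le Me^{-\beta t},\quad\|\Lambda^\alpha e^{-A_2t}P_2\|\le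 Mt^{-\alpha}e^{-\beta t}\quad(t>0)$$ (operator norms on $X$). For $p\in\mathcal{H}$, $\phi\in\mathcal{C}_\alpha$, $u(t;p,\phi)$ denotes the unique global mild solution pertaining to $p$: the continuous $u:[-r,\infty)\to X^\alpha$ with $u=\phi$ on $[-r,0]$ and $u(t)=e^{-At}\phi(0)+\int_0^te^{-A(t-s)}F(\theta_sp,u_s)\,ds$, $t\ge0$. It is bounded if $\sup_{t\ge-r}\|u(t)\|_\alpha<\infty$. A complete solution pertaining to $p$ is a continuous $\gamma:\mathbb{R}\to X^\alpha$ with $\gamma(t)=e^{-A(t-\tau)}\gamma(\tau)+\int_\tau^te^{-A(t-s)}F(\theta_sp,\gamma_s)\,ds$ for all $t\ge\tau$; it is bounded if $\sup_{t\in\mathbb{R}}\|\gamma(t)\|_\alpha<\infty$. A nonautonomous equilibrium solution is a map $\Gamma\in C(\mathcal{H},X^\alpha)$ such that $\gamma_p(t):=\Gamma(\theta_tp)$ is a bounded complete solution pertaining to $p$, for each $p\in\mathcal{H}$. *)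

theory Defs
  imports "HOL-Analysis.Analysis"
begin

section \<open>Unbounded operators on a real Banach space\<close>

text \<open>
  An operator is given by a domain \<open>D\<close> and a total function \<open>A\<close> whose values outside \<open>D\<close> are
  irrelevant. Spectral notions are taken in a closed subspace \<open>Y\<close>, so that they also apply to the
  restrictions of \<open>A\<close> to invariant subspaces; for an operator on the whole space, \<open>Y = UNIV\<close>.
\<close>

definition linear_on_subspace :: "'x::real_vector set \<Rightarrow> ('x \<Rightarrow> 'x) \<Rightarrow> bool" where
  "linear_on_subspace D A \<longleftrightarrow> subspace D \<and>
     (\<forall>x\<in>D. \<forall>y\<in>D. A (x + y) = A x + A y) \<and> (\<forall>c. \<forall>x\<in>D. A (c *\<^sub>R x) = c *\<^sub>R A x)"

definition closed_densely_defined :: "'x::banach set \<Rightarrow> ('x \<Rightarrow> 'x) \<Rightarrow> bool" where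
  "closed_densely_defined D A \<longleftrightarrow>
     linear_on_subspace D A \<and> closure D = UNIV \<and> closed {(x, A x) | x. x \<in> D}"

text \<open>
  The spectrum of an operator on a real space is that of its complexification. The pair \<open>(x, y)\<close>
  stands for \<open>x + i y\<close>, and \<open>cshift A z\<close> is \<open>z I - A\<close>. The product norm is equivalent to every
  norm making the complexification a complex Banach space, which is all that matters below.
\<close>

definition cshift :: "('x::banach \<Rightarrow> 'x) \<Rightarrow> complex \<Rightarrow> 'x \<times> 'x \<Rightarrow> 'x \<times> 'x" where
  "cshift A z = (\<lambda>(x, y). (Re z *\<^sub>R x - Im z *\<^sub>R y - A x, Im z *\<^sub>R x + Re z *\<^sub>R y - A y))"

definition resolvent_set :: "'x::banach set \<Rightarrow> 'x set \<Rightarrow> ('x \<Rightarrow> 'x) \<Rightarrow> complex set" where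
  "resolvent_set Y D A = {z. bij_betw (cshift A z) (D \<times> D) (Y \<times> Y) \<and>
     (\<exists>K. \<forall>w\<in>D \<times> D. norm w \<le> K * norm (cshift A z w))}"

definition spectrum :: "'x::banach set \<Rightarrow> 'x set \<Rightarrow> ('x \<Rightarrow> 'x) \<Rightarrow> complex set" where
  "spectrum Y D A = - resolvent_set Y D A"

definition resolvent :: "'x::banach set \<Rightarrow> ('x \<Rightarrow> 'x) \<Rightarrow> complex \<Rightarrow> 'x \<times> 'x \<Rightarrow> 'x \<times> 'x" where
  "resolvent D A z = inv_into (D \<times> D) (cshift A z)"

definition sectorial :: "'x::banach set \<Rightarrow> ('x \<Rightarrow> 'x) \<Rightarrow> bool" where
  "sectorial D A \<longleftrightarrow> closed_densely_defined D A \<and>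
     (\<exists>(b::real) (\<phi>::real) (K::real). 0 < \<phi> \<and> \<phi> < pi / 2 \<and> K \<ge> 1 \<and>
       (\<forall>z. z \<noteq> of_real b \<and> \<phi> \<le> \<bar>Arg (z - of_real b)\<bar> \<longrightarrow>
          z \<in> resolvent_set UNIV D A \<and>
          (\<forall>w. norm (resolvent D A z w) \<le> K / cmod (z - of_real b) * norm w)))"

definition compact_resolvent :: "'x::banach set \<Rightarrow> ('x \<Rightarrow> 'x) \<Rightarrow> bool" where
  "compact_resolvent D A \<longleftrightarrow> (\<exists>z\<in>resolvent_set UNIV D A.
     \<forall>B. bounded B \<longrightarrow> compact (closure (resolvent D A z ` B)))"

section \<open>Semigroups and fractional powers\<close>

definition C0_semigroup_on :: "'x::banach set \<Rightarrow> (real \<Rightarrow> 'x \<Rightarrow> 'x) \<Rightarrow> bool" where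
  "C0_semigroup_on Y T \<longleftrightarrow>
     (\<forall>t\<ge>0. T t ` Y \<subseteq> Y \<and> linear_on_subspace Y (T t) \<and> (\<exists>K. \<forall>x\<in>Y. norm (T t x) \<le> K * norm x)) \<and>
     (\<forall>x\<in>Y. T 0 x = x) \<and>
     (\<forall>s\<ge>0. \<forall>t\<ge>0. \<forall>x\<in>Y. T (s + t) x = T s (T t x)) \<and>
     (\<forall>x\<in>Y. ((\<lambda>t. T t x) \<longlongrightarrow> x) (at_right 0))"

definition generated_by_uminus ::
  "'x::banach set \<Rightarrow> 'x set \<Rightarrow> ('x \<Rightarrow> 'x) \<Rightarrow> (real \<Rightarrow> 'x \<Rightarrow> 'x) \<Rightarrow> bool" where
  "generated_by_uminus Y D A T \<longleftrightarrow> (\<forall>x\<in>Y. \<forall>y\<in>Y.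
     ((\<lambda>h. (T h x - x) /\<^sub>R h) \<longlongrightarrow> y) (at_right 0) \<longleftrightarrow> x \<in> D \<and> y = - A x)"

text \<open>
  \<open>exp_semigroup Y D A t\<close> is \<open>e\<close> to the power \<open>-A t\<close>. A strongly continuous semigroup is determined by
  its generator, so the choice is unique for \<open>t \<ge> 0\<close> and arguments in \<open>Y\<close>; only these are used.
\<close>

definition exp_semigroup :: "'x::banach set \<Rightarrow> 'x set \<Rightarrow> ('x \<Rightarrow> 'x) \<Rightarrow> real \<Rightarrow> 'x \<Rightarrow> 'x" where
  "exp_semigroup Y D A = (SOME T. C0_semigroup_on Y T \<and> generated_by_uminus Y D A T)"

text \<open>The exponential \<open>e\<close> to the power \<open>-A t\<close> for a bounded operator \<open>A\<close> and any real \<open>t\<close>.\<close>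

definition exp_op :: "('x::banach \<Rightarrow> 'x) \<Rightarrow> real \<Rightarrow> 'x \<Rightarrow> 'x" where
  "exp_op A t x = (\<Sum>n. ((- t) ^ n / fact n) *\<^sub>R (A ^^ n) x)"

text \<open>
  For \<open>\<Lambda>\<close> sectorial with \<open>Re \<sigma>(\<Lambda>) > 0\<close>, \<open>frac_neg D \<Lambda> s\<close> is the negative power of exponent \<open>-s\<close>;
  it is injective, and the positive power \<open>frac_pow D \<Lambda> s\<close> is its inverse, with domain
  \<open>frac_space D \<Lambda> s\<close>.
\<close>

definition frac_neg :: "'x::banach set \<Rightarrow> ('x \<Rightarrow> 'x) \<Rightarrow> real \<Rightarrow> 'x \<Rightarrow> 'x" where
  "frac_neg D \<Lambda> s x = (if s = 0 then x else
     (1 / Gamma s) *\<^sub>R integral {0..} (\<lambda>t. (t powr (s - 1)) *\<^sub>R exp_semigroup UNIV D \<Lambda> t x))"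

definition frac_space :: "'x::banach set \<Rightarrow> ('x \<Rightarrow> 'x) \<Rightarrow> real \<Rightarrow> 'x set" where
  "frac_space D \<Lambda> s = range (frac_neg D \<Lambda> s)"

definition frac_pow :: "'x::banach set \<Rightarrow> ('x \<Rightarrow> 'x) \<Rightarrow> real \<Rightarrow> 'x \<Rightarrow> 'x" where
  "frac_pow D \<Lambda> s = inv (frac_neg D \<Lambda> s)"

definition frac_norm :: "'x::banach set \<Rightarrow> ('x \<Rightarrow> 'x) \<Rightarrow> real \<Rightarrow> 'x \<Rightarrow> real" where
  "frac_norm D \<Lambda> s u = norm (frac_pow D \<Lambda> s u)"

text \<open>Continuity of maps into the fractional power space, i.e. with respect to \<open>frac_norm\<close>.\<close>

definition frac_continuous_on ::
  "'x::banach set \<Rightarrow> ('x \<Rightarrow> 'x) \<Rightarrow> real \<Rightarrow> 't::topological_space set \<Rightarrow> ('t \<Rightarrow> 'x) \<Rightarrow> bool" where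
  "frac_continuous_on D \<Lambda> s S f \<longleftrightarrow>
     (\<forall>t\<in>S. f t \<in> frac_space D \<Lambda> s) \<and> continuous_on S (\<lambda>t. frac_pow D \<Lambda> s (f t))"

section \<open>Spectral decomposition\<close>

text \<open>\<open>direct_proj X1 X2\<close> is the projection onto \<open>X1\<close> along \<open>X2\<close>.\<close>

definition direct_proj :: "'x::banach set \<Rightarrow> 'x set \<Rightarrow> 'x \<Rightarrow> 'x" where
  "direct_proj X1 X2 x = (THE y. y \<in> X1 \<and> x - y \<in> X2)"

text \<open>
  The decomposition of the space corresponding to the spectral sets \<open>\<sigma>m\<close> (bounded) and \<open>\<sigma>p\<close>.
  Boundedness of the part in \<open>X1\<close> is what makes the decomposition unique: \<open>direct_proj X1 X2\<close> is
  then the Riesz projection of \<open>\<sigma>m\<close>.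
\<close>

definition spectral_splitting ::
  "'x::banach set \<Rightarrow> ('x \<Rightarrow> 'x) \<Rightarrow> complex set \<Rightarrow> complex set \<Rightarrow> 'x set \<Rightarrow> 'x set \<Rightarrow> bool" where
  "spectral_splitting D A \<sigma>m \<sigma>p X1 X2 \<longleftrightarrow>
     subspace X1 \<and> closed X1 \<and> subspace X2 \<and> closed X2 \<and>
     X1 \<inter> X2 = {0} \<and> {x + y | x y. x \<in> X1 \<and> y \<in> X2} = UNIV \<and>
     X1 \<subseteq> D \<and> A ` X1 \<subseteq> X1 \<and> A ` (D \<inter> X2) \<subseteq> X2 \<and>
     (\<exists>K. \<forall>x\<in>X1. norm (A x) \<le> K * norm x) \<and>
     spectrum X1 X1 A = \<sigma>m \<and> spectrum X2 (D \<inter> X2) A = \<sigma>p"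

definition kappa0 :: "real \<Rightarrow> real \<Rightarrow> real" where
  "kappa0 \<alpha> \<beta> = (SUP t\<in>{0..}.
     integral {0..t} (\<lambda>s. (t - s) powr (- \<alpha>) * exp (- \<beta> * (t - s))) +
     integral {t..} (\<lambda>s. exp (\<beta> * (t - s))))"

section \<open>Dynamical systems\<close>

definition dynamical_system :: "(real \<Rightarrow> 'h::metric_space \<Rightarrow> 'h) \<Rightarrow> bool" where
  "dynamical_system \<theta> \<longleftrightarrow> continuous_on UNIV (\<lambda>(t, p). \<theta> t p) \<and>
     (\<forall>p. \<theta> 0 p = p) \<and> (\<forall>s t p. \<theta> (s + t) p = \<theta> s (\<theta> t p))"

definition minimal_system :: "(real \<Rightarrow> 'h::metric_space \<Rightarrow> 'h) \<Rightarrow> bool" where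
  "minimal_system \<theta> \<longleftrightarrow>
     \<not> (\<exists>K. K \<noteq> {} \<and> K \<noteq> UNIV \<and> compact K \<and> (\<forall>t. \<theta> t ` K = K))"

section \<open>Retarded equations\<close>

text \<open>
  An element of the phase space is a function on the whole real line of which only the values on
  \<open>{-r..0}\<close> matter.
\<close>

definition C_space :: "'x::banach set \<Rightarrow> ('x \<Rightarrow> 'x) \<Rightarrow> real \<Rightarrow> real \<Rightarrow> (real \<Rightarrow> 'x) set" where
  "C_space D \<Lambda> \<alpha> r = {\<phi>. frac_continuous_on D \<Lambda> \<alpha> {-r..0} \<phi>}"

definition C_norm :: "'x::banach set \<Rightarrow> ('x \<Rightarrow> 'x) \<Rightarrow> real \<Rightarrow> real \<Rightarrow> (real \<Rightarrow> 'x) \<Rightarrow> real" where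
  "C_norm D \<Lambda> \<alpha> r \<phi> = (SUP s\<in>{-r..0}. frac_norm D \<Lambda> \<alpha> (\<phi> s))"

definition lift_at :: "(real \<Rightarrow> 'x) \<Rightarrow> real \<Rightarrow> real \<Rightarrow> 'x" where
  "lift_at u t = (\<lambda>s. u (t + s))"

definition continuous_nonlinearity ::
  "'x::banach set \<Rightarrow> ('x \<Rightarrow> 'x) \<Rightarrow> real \<Rightarrow> real \<Rightarrow> ('h::metric_space \<Rightarrow> (real \<Rightarrow> 'x) \<Rightarrow> 'x) \<Rightarrow> bool" where
  "continuous_nonlinearity D \<Lambda> \<alpha> r F \<longleftrightarrow>
     (\<forall>p. \<forall>\<phi>\<in>C_space D \<Lambda> \<alpha> r. \<forall>\<epsilon>>0. \<exists>\<delta>>0. \<forall>p'. \<forall>\<phi>'\<in>C_space D \<Lambda> \<alpha> r.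
        dist p' p < \<delta> \<and> C_norm D \<Lambda> \<alpha> r (\<lambda>s. \<phi>' s - \<phi> s) < \<delta> \<longrightarrow> norm (F p' \<phi>' - F p \<phi>) < \<epsilon>)"

definition mild_solution ::
  "'x::banach set \<Rightarrow> ('x \<Rightarrow> 'x) \<Rightarrow> ('x \<Rightarrow> 'x) \<Rightarrow> real \<Rightarrow> real \<Rightarrow> (real \<Rightarrow> 'h::metric_space \<Rightarrow> 'h) \<Rightarrow>
   ('h \<Rightarrow> (real \<Rightarrow> 'x) \<Rightarrow> 'x) \<Rightarrow> 'h \<Rightarrow> (real \<Rightarrow> 'x) \<Rightarrow> (real \<Rightarrow> 'x) \<Rightarrow> bool" where
  "mild_solution D A \<Lambda> \<alpha> r \<theta> F p \<phi> u \<longleftrightarrow>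
     frac_continuous_on D \<Lambda> \<alpha> {-r..} u \<and> (\<forall>s\<in>{-r..0}. u s = \<phi> s) \<and>
     (\<forall>t\<ge>0. u t = exp_semigroup UNIV D A t (\<phi> 0) +
        integral {0..t} (\<lambda>s. exp_semigroup UNIV D A (t - s) (F (\<theta> s p) (lift_at u s))))"

definition complete_solution ::
  "'x::banach set \<Rightarrow> ('x \<Rightarrow> 'x) \<Rightarrow> ('x \<Rightarrow> 'x) \<Rightarrow> real \<Rightarrow> (real \<Rightarrow> 'h::metric_space \<Rightarrow> 'h) \<Rightarrow>
   ('h \<Rightarrow> (real \<Rightarrow> 'x) \<Rightarrow> 'x) \<Rightarrow> 'h \<Rightarrow> (real \<Rightarrow> 'x) \<Rightarrow> bool" where
  "complete_solution D A \<Lambda> \<alpha> \<theta> F p \<gamma> \<longleftrightarrow>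
     frac_continuous_on D \<Lambda> \<alpha> UNIV \<gamma> \<and>
     (\<forall>\<tau>. \<forall>t\<ge>\<tau>. \<gamma> t = exp_semigroup UNIV D A (t - \<tau>) (\<gamma> \<tau>) +
        integral {\<tau>..t} (\<lambda>s. exp_semigroup UNIV D A (t - s) (F (\<theta> s p) (lift_at \<gamma> s))))"

definition frac_bounded_on ::
  "'x::banach set \<Rightarrow> ('x \<Rightarrow> 'x) \<Rightarrow> real \<Rightarrow> real set \<Rightarrow> (real \<Rightarrow> 'x) \<Rightarrow> bool" where
  "frac_bounded_on D \<Lambda> \<alpha> S u \<longleftrightarrow> bdd_above ((\<lambda>t. frac_norm D \<Lambda> \<alpha> (u t)) ` S)"

definition nonautonomous_equilibrium ::
  "'x::banach set \<Rightarrow> ('x \<Rightarrow> 'x) \<Rightarrow> ('x \<Rightarrow> 'x) \<Rightarrow> real \<Rightarrow> (real \<Rightarrow> 'h::metric_space \<Rightarrow> 'h) \<Rightarrow>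
   ('h \<Rightarrow> (real \<Rightarrow> 'x) \<Rightarrow> 'x) \<Rightarrow> ('h \<Rightarrow> 'x) \<Rightarrow> bool" where
  "nonautonomous_equilibrium D A \<Lambda> \<alpha> \<theta> F \<Gamma> \<longleftrightarrow>
     frac_continuous_on D \<Lambda> \<alpha> UNIV \<Gamma> \<and>
     (\<forall>p. complete_solution D A \<Lambda> \<alpha> \<theta> F p (\<lambda>t. \<Gamma> (\<theta> t p)) \<and>
          frac_bounded_on D \<Lambda> \<alpha> UNIV (\<lambda>t. \<Gamma> (\<theta> t p)))"

end

theory Submission
  imports Defs "HOL-Complex_Analysis.Complex_Analysis"
begin

subsection \<open>Separation by functionals and uniform boundedness\<close>

lemma exists_functional_nonzero:
  fixes x0 :: "'a::real_normed_vector"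
  assumes "x0 \<noteq> 0"
  shows "\<exists>f::'a \<Rightarrow> real. bounded_linear f \<and> f x0 \<noteq> 0"
proof -
  define G0 where "G0 = range (\<lambda>t. (t *\<^sub>R x0, t * norm x0))"
  define \<G> where "\<G> = {G :: ('a \<times> real) set. subspace G \<and> (\<forall>x v. (x, v) \<in> G \<longrightarrow> v \<le> norm x) \<and> G0 \<subseteq> G}"
  have "subspace G0"
    unfolding G0_def subspace_def
    apply (intro conjI ballI allI)
      apply (auto simp: image_iff zero_prod_def intro: exI[of _ 0])
    apply (metis distrib_right scaleR_left.add)
    done
  then have "G0 \<in> \<G>"
    by (auto simp: \<G>_def G0_def mult_right_mono)
  moreover have "\<Union>C \<in> \<G>" if "C \<noteq> {}" and C: "subset.chain \<G> C" for C
  proof -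
    have CG: "C \<subseteq> \<G>" and tot: "\<And>X Y. X \<in> C \<Longrightarrow> Y \<in> C \<Longrightarrow> X \<subseteq> Y \<or> Y \<subseteq> X"
      using C by (auto simp: subset_chain_def)
    have "subspace (\<Union>C)"
      unfolding subspace_def
    proof (intro conjI ballI allI)
      show "0 \<in> \<Union>C" using \<open>C \<noteq> {}\<close> CG subspace_0 unfolding \<G>_def by blast
    next
      fix x y assume "x \<in> \<Union>C" "y \<in> \<Union>C"
      then obtain X Y where "X \<in> C" "Y \<in> C" "x \<in> X" "y \<in> Y" by auto
      then obtain Z where "Z \<in> C" "x \<in> Z" "y \<in> Z" using tot by blast
      then show "x + y \<in> \<Union>C" using CG by (auto simp: \<G>_def intro: subspace_add)
    next
      fix c x assume "x \<in> \<Union>C"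
      then show "c *\<^sub>R x \<in> \<Union>C" using CG by (auto simp: \<G>_def intro: subspace_scale)
    qed
    then show ?thesis using CG \<open>C \<noteq> {}\<close> by (auto simp: \<G>_def) blast
  qed
  ultimately obtain M where M: "M \<in> \<G>" and max: "\<And>X. X \<in> \<G> \<Longrightarrow> M \<subseteq> X \<Longrightarrow> X = M"
    using subset_Zorn_nonempty[of \<G>] by blast
  have sub: "subspace M" and le: "\<And>x v. (x, v) \<in> M \<Longrightarrow> v \<le> norm x" and G0M: "G0 \<subseteq> M"
    using M by (auto simp: \<G>_def)
  have add: "(x + y, v + w) \<in> M" if "(x, v) \<in> M" "(y, w) \<in> M" for x y v w
    using subspace_add[OF sub that] by simp
  have scale: "(c *\<^sub>R x, c * v) \<in> M" if "(x, v) \<in> M" for c x v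
    using subspace_scale[OF sub that, of c] by simp
  have tot: "\<exists>v. (x1, v) \<in> M" for x1
  proof (rule ccontr)
    assume no: "\<nexists>v. (x1, v) \<in> M"
    have key: "snd q - norm (fst q - x1) \<le> norm (z + x1) - w" if "q \<in> M" "(z, w) \<in> M" for q z w
    proof -
      have "snd q + w \<le> norm (fst q + z)" using le[OF add] that by (metis prod.collapse)
      also have "\<dots> \<le> norm (fst q - x1) + norm (z + x1)"
        using norm_triangle_ineq[of "fst q - x1" "z + x1"] by simp
      finally show ?thesis by simp
    qed
    have M0: "(0, 0) \<in> M" using subspace_0[OF sub] by (simp add: zero_prod_def)
    define c where "c = (SUP q\<in>M. snd q - norm (fst q - x1))"
    have lo: "v - norm (y - x1) \<le> c" if "(y, v) \<in> M" for y v
      unfolding c_def using that key[OF _ M0]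
      by (intro cSUP_upper2[where x = "(y, v)"]) (auto intro!: bdd_aboveI2)
    have hi: "c \<le> norm (z + x1) - w" if "(z, w) \<in> M" for z w
      unfolding c_def using that key M0 by (intro cSUP_least) auto
    define M' where "M' = {(y + t *\<^sub>R x1, v + t * c) | y v t. (y, v) \<in> M}"
    have "subspace M'"
      unfolding subspace_def
    proof (intro conjI ballI allI)
      show "0 \<in> M'" unfolding M'_def zero_prod_def using M0 by (auto intro!: exI[of _ 0])
    next
      fix p q assume "p \<in> M'" "q \<in> M'"
      then obtain y v t y' v' t' where *: "p = (y + t *\<^sub>R x1, v + t * c)" "(y, v) \<in> M"
        "q = (y' + t' *\<^sub>R x1, v' + t' * c)" "(y', v') \<in> M" unfolding M'_def by blast
      have "p + q = ((y + y') + (t + t') *\<^sub>R x1, (v + v') + (t + t') * c)"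
        by (simp add: * algebra_simps)
      then show "p + q \<in> M'" unfolding M'_def using add[OF *(2,4)] by blast
    next
      fix d p assume "p \<in> M'"
      then obtain y v t where *: "p = (y + t *\<^sub>R x1, v + t * c)" "(y, v) \<in> M" unfolding M'_def by blast
      have "d *\<^sub>R p = (d *\<^sub>R y + (d * t) *\<^sub>R x1, d * v + (d * t) * c)"
        by (simp add: * algebra_simps)
      then show "d *\<^sub>R p \<in> M'" unfolding M'_def using scale[OF *(2)] by blast
    qed
    moreover have "v + t * c \<le> norm (y + t *\<^sub>R x1)" if "(y, v) \<in> M" for y v t
    proof -
      consider "t = 0" | "t > 0" | "t < 0" by linarith
      then show ?thesis
      proof cases
        case 1 then show ?thesis using le that by simp
      next
        case 2
        have "c \<le> norm ((1/t) *\<^sub>R y + x1) - (1/t) * v" using hi scale that by blast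
        then have "t * c \<le> t * (norm ((1/t) *\<^sub>R y + x1)) - v" using 2 by (simp add: field_simps)
        also have "t * (norm ((1/t) *\<^sub>R y + x1)) = norm (t *\<^sub>R ((1/t) *\<^sub>R y + x1))" using 2 by simp
        also have "t *\<^sub>R ((1/t) *\<^sub>R y + x1) = y + t *\<^sub>R x1" using 2 by (simp add: scaleR_add_right)
        finally show ?thesis by simp
      next
        case 3
        define s where "s = -t"
        have s: "s > 0" using 3 by (simp add: s_def)
        have "(1/s) * v - norm ((1/s) *\<^sub>R y - x1) \<le> c" using lo scale that by blast
        then have "v - s * norm ((1/s) *\<^sub>R y - x1) \<le> s * c" using s by (simp add: field_simps)
        moreover have "s * (norm ((1/s) *\<^sub>R y - x1)) = norm (s *\<^sub>R ((1/s) *\<^sub>R y - x1))" using s by simp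
        moreover have "s *\<^sub>R ((1/s) *\<^sub>R y - x1) = y + t *\<^sub>R x1"
          using s by (simp add: scaleR_diff_right s_def)
        ultimately have "v - s * c \<le> norm (y + t *\<^sub>R x1)" by simp
        then show ?thesis by (simp add: s_def)
      qed
    qed
    moreover have "M \<subseteq> M'"
    proof
      fix q assume "q \<in> M"
      then show "q \<in> M'" unfolding M'_def by (cases q) (force intro: exI[of _ 0])
    qed
    ultimately have "M' = M" using G0M by (intro max) (auto simp: \<G>_def M'_def)
    moreover have "(x1, c) \<in> M'" unfolding M'_def using M0 by (force intro: exI[of _ 1])
    ultimately show False using no by blast
  qed
  have uniq: "v = w" if "(x, v) \<in> M" "(x, w) \<in> M" for x v w
  proof -
    have "(0, v - w) \<in> M" "(0, w - v) \<in> M"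
      using add[OF that(1) scale[OF that(2), of "-1"]] add[OF that(2) scale[OF that(1), of "-1"]] by auto
    then show ?thesis using le[of 0 "v - w"] le[of 0 "w - v"] by simp
  qed
  obtain f where f: "\<And>x. (x, f x) \<in> M" using tot by metis
  have "f (x + y) = f x + f y" for x y using uniq[OF f add[OF f f]] .
  moreover have "f (c *\<^sub>R x) = c *\<^sub>R f x" for c x using uniq[OF f scale[OF f]] by simp
  moreover have "norm (f x) \<le> norm x * 1" for x
    using le[OF f[of x]] le[OF scale[OF f[of x], of "-1"]] by (simp add: abs_le_iff)
  ultimately have "bounded_linear f" by (intro bounded_linear_intro) 
  moreover have "(x0, norm x0) \<in> M" using G0M by (force simp: G0_def image_iff intro: exI[of _ 1])
  then have "f x0 = norm x0" using uniq f by blast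
  ultimately show ?thesis using assms by (intro exI[of _ f]) auto
qed

lemma eq_if_functionals_eq:
  fixes x y :: "'a::real_normed_vector"
  assumes "\<And>f::'a \<Rightarrow> real. bounded_linear f \<Longrightarrow> f x = f y"
  shows "x = y"
proof (rule ccontr)
  assume "x \<noteq> y"
  then obtain f :: "'a \<Rightarrow> real" where "bounded_linear f" "f (x - y) \<noteq> 0"
    using exists_functional_nonzero[of "x - y"] by auto
  then show False using assms[of f] by (simp add: bounded_linear.linear linear_diff)
qed

lemma uniform_boundedness_on:
  fixes T :: "nat \<Rightarrow> 'a::banach \<Rightarrow> 'b::real_normed_vector"
  assumes Y: "subspace Y" "closed Y"
    and add: "\<And>n x y. x \<in> Y \<Longrightarrow> y \<in> Y \<Longrightarrow> T n (x + y) = T n x + T n y"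
    and scale: "\<And>n c x. x \<in> Y \<Longrightarrow> T n (c *\<^sub>R x) = c *\<^sub>R T n x"
    and bdd: "\<And>n. \<exists>K. \<forall>x\<in>Y. norm (T n x) \<le> K * norm x"
    and pw: "\<And>x. x \<in> Y \<Longrightarrow> \<exists>B. \<forall>n. norm (T n x) \<le> B"
  shows "\<exists>K. \<forall>n. \<forall>x\<in>Y. norm (T n x) \<le> K * norm x"
proof (rule ccontr)
  assume neg: "\<not> ?thesis"
  have diff: "T n (x - y) = T n x - T n y" if "x \<in> Y" "y \<in> Y" for n x y
    using add[of x "(-1) *\<^sub>R y" n] scale[of y n "-1"] that Y(1) by (simp add: subspace_neg)
  have unb: "\<exists>n. \<exists>z\<in>Y. dist x z < \<rho> \<and> norm (T n z) > B" if "x \<in> Y" "\<rho> > 0" for x \<rho> B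
  proof (rule ccontr)
    assume "\<not> ?thesis"
    then have *: "norm (T n z) \<le> B" if "z \<in> Y" "dist x z < \<rho>" for n z using that by (meson not_le)
    have "norm (T n y) \<le> (4 * B / \<rho>) * norm y" if y: "y \<in> Y" for n y
    proof (cases "y = 0")
      case True then show ?thesis using scale[of 0 n 0] Y by (simp add: subspace_0)
    next
      case False
      define c where "c = \<rho> / (2 * norm y)"
      have c: "c > 0" using False \<open>\<rho> > 0\<close> by (simp add: c_def)
      have cy: "c *\<^sub>R y \<in> Y" using y Y by (simp add: subspace_scale)
      have "dist x (x + c *\<^sub>R y) < \<rho>" using False \<open>\<rho> > 0\<close> c by (simp add: dist_norm c_def)
      then have "norm (T n (x + c *\<^sub>R y)) \<le> B" using * cy \<open>x \<in> Y\<close> Y by (simp add: subspace_add)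
      moreover have "norm (T n x) \<le> B" using * \<open>x \<in> Y\<close> \<open>\<rho> > 0\<close> by simp
      ultimately have "norm (T n (c *\<^sub>R y)) \<le> 2 * B"
        using norm_triangle_ineq4[of "T n (x + c *\<^sub>R y)" "T n x"] add[OF \<open>x \<in> Y\<close> cy] by simp
      then have "c * norm (T n y) \<le> 2 * B" using scale[OF y] c by simp
      then have "norm (T n y) \<le> 2 * B / c" using c by (simp add: field_simps)
      also have "\<dots> = (4 * B / \<rho>) * norm y" using False by (simp add: c_def)
      finally show ?thesis .
    qed
    then show False using neg by blast
  qed
  define good where "good k q \<longleftrightarrow> fst q \<in> Y \<and> 0 < snd q \<and> snd q \<le> (1/2)^k \<and>
     (\<exists>n. \<forall>z\<in>Y \<inter> cball (fst q) (snd q). norm (T n z) > real k)" for k and q :: "'a \<times> real"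
  have small: "\<exists>q. good k q \<and> cball (fst q) (snd q) \<subseteq> cball x \<rho>"
    if xY: "x \<in> Y" and "\<rho> > 0" for x \<rho> k
  proof -
    obtain n z where z: "z \<in> Y" "dist x z < \<rho>" "norm (T n z) > real k + 1" using unb[OF xY \<open>\<rho> > 0\<close>] by blast
    obtain K where K: "\<And>y. y \<in> Y \<Longrightarrow> norm (T n y) \<le> K * norm y" using bdd by blast
    define \<rho>' where "\<rho>' = min ((1/2)^k) (min (\<rho> - dist x z) (1 / (\<bar>K\<bar> + 1)))"
    have "\<rho>' > 0" using z by (simp add: \<rho>'_def)
    have "norm (T n y) > real k" if y: "y \<in> Y" "dist z y \<le> \<rho>'" for y
    proof -
      have "norm (T n (z - y)) \<le> K * norm (z - y)" using K y z Y by (simp add: subspace_diff)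
      also have "\<dots> \<le> (\<bar>K\<bar> + 1) * norm (z - y)" by (intro mult_right_mono) auto
      also have "\<dots> \<le> (\<bar>K\<bar> + 1) * (1 / (\<bar>K\<bar> + 1))"
        using y(2) by (intro mult_left_mono) (auto simp: \<rho>'_def dist_norm)
      also have "\<dots> = 1" by (simp add: add_nonneg_eq_0_iff)
      finally have "norm (T n z - T n y) \<le> 1" using diff y z by simp
      then show ?thesis using z(3) norm_triangle_sub[of "T n z" "T n y"] by simp
    qed
    moreover have "cball z \<rho>' \<subseteq> cball x \<rho>"
    proof
      fix w assume "w \<in> cball z \<rho>'"
      then have "dist z w \<le> \<rho> - dist x z" by (simp add: \<rho>'_def)
      then show "w \<in> cball x \<rho>" using dist_triangle[of x w z] by simp
    qed
    moreover have "\<rho>' \<le> (1/2)^k" by (simp add: \<rho>'_def)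
    ultimately show ?thesis
      using z(1) \<open>\<rho>' > 0\<close> unfolding good_def
      by (intro exI[of _ "(z, \<rho>')"] conjI exI[of _ n]) (auto simp del: power_divide)
  qed
  obtain q where q: "\<And>k. good k (q k)"
      "\<And>k. cball (fst (q (Suc k))) (snd (q (Suc k))) \<subseteq> cball (fst (q k)) (snd (q k))"
  proof -
    have "\<exists>q. good 0 q" using small[of 0 1 0] Y by (auto simp: subspace_0)
    moreover have "\<exists>q'. good (Suc k) q' \<and> cball (fst q') (snd q') \<subseteq> cball (fst q) (snd q)" if "good k q" for k q
      using small[of "fst q" "snd q" "Suc k"] that by (auto simp: good_def)
    ultimately have "\<exists>f. \<forall>k. good k (f k) \<and> cball (fst (f (Suc k))) (snd (f (Suc k))) \<subseteq> cball (fst (f k)) (snd (f k))"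
      by (intro dependent_nat_choice) auto
    then show ?thesis using that by blast
  qed
  define S where "S k = Y \<inter> cball (fst (q k)) (snd (q k))" for k
  have "\<exists>a. \<forall>k. a \<in> S k"
  proof (rule decreasing_closed_nest)
    show "closed (S k)" for k using Y by (auto simp: S_def)
    show "S k \<noteq> {}" for k using q(1)[of k] by (auto simp: S_def good_def intro!: exI[of _ "fst (q k)"])
    have "decseq S" using q(2) by (intro decseq_SucI) (auto simp: S_def)
    then show "S k \<subseteq> S m" if "m \<le> k" for m k using that by (auto simp: decseq_def)
    fix e :: real assume "e > 0"
    then obtain k where k: "(1/2)^k < e / 2" using real_arch_pow_inv[of "e/2" "1/2"] by auto
    have "dist x y < e" if "x \<in> S k" "y \<in> S k" for x y
    proof -
      have "dist x y \<le> dist (fst (q k)) x + dist (fst (q k)) y" by (metis dist_triangle3 dist_commute)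
      also have "\<dots> \<le> 2 * snd (q k)" using that by (auto simp: S_def)
      also have "\<dots> < e" using q(1)[of k] k by (simp add: good_def)
      finally show ?thesis .
    qed
    then show "\<exists>n. \<forall>x\<in>S n. \<forall>y\<in>S n. dist x y < e" by blast
  qed auto
  then obtain a where a: "\<And>k. a \<in> S k" by blast
  then have "a \<in> Y" by (simp add: S_def)
  then obtain B where B: "\<And>n. norm (T n a) \<le> B" using pw by blast
  obtain k :: nat where "real k > B" using reals_Archimedean2 by blast
  moreover obtain n where "norm (T n a) > real k" using q(1)[of k] a[of k] unfolding good_def S_def by blast
  ultimately show False using B[of n] by simp
qed

subsection \<open>Dominated improper integrals in Banach spaces\<close>

text \<open>The Bochner integral of the library needs a separable range, so dominated integrability is
  obtained for the gauge integral, by approximation in mean.\<close>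

lemma integrable_CauchyD:
  fixes h :: "'n::euclidean_space \<Rightarrow> 'a::banach"
  assumes "h integrable_on cbox a b" and "e>0"
  obtains \<gamma> where "gauge \<gamma>" "\<And>\<D>1 \<D>2. \<D>1 tagged_division_of (cbox a b) \<Longrightarrow> \<gamma> fine \<D>1 \<Longrightarrow>
            \<D>2 tagged_division_of (cbox a b) \<Longrightarrow> \<gamma> fine \<D>2 \<Longrightarrow>
            norm ((\<Sum>(x,K)\<in>\<D>1. measure lborel K *\<^sub>R h x) - (\<Sum>(x,K)\<in>\<D>2. measure lborel K *\<^sub>R h x)) < e"
  by (rule exE[OF spec[OF iffD1[OF integrable_Cauchy assms(1)], THEN mp, OF assms(2)]]) 
   (erule conjE, rule that, assumption, (drule spec)+, erule mp, intro conjI)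
lemma integrable_integralD:
  fixes h :: "'n::euclidean_space \<Rightarrow> 'a::banach"
  assumes "h integrable_on cbox a b" and "e>0"
  obtains \<gamma> where "gauge \<gamma>" "\<And>\<D>1. \<D>1 tagged_division_of (cbox a b) \<Longrightarrow> \<gamma> fine \<D>1 \<Longrightarrow>
            norm ((\<Sum>(x,K)\<in>\<D>1. measure lborel K *\<^sub>R h x) - integral (cbox a b) h) < e"
  by (rule exE[OF spec[OF iffD1[OF has_integral integrable_integral[OF assms(1)]], THEN mp, OF assms(2)]]) 
   (erule conjE, rule that, assumption, drule spec, erule mp, intro conjI)

lemma norm_diff_triangle3:
  fixes a b c d :: "'a::real_normed_vector"
  shows "norm (a - d) \<le> norm (a - b) + norm (b - c) + norm (d - c)"
  using norm_triangle_ineq4[of "(a - b) + (b - c)" "d - c"] norm_triangle_ineq[of "a - b" "b - c"] by simp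

lemma integrable_by_approximation_in_mean:
  fixes f :: "'n::euclidean_space \<Rightarrow> 'a::banach"
  assumes "\<And>e. e > 0 \<Longrightarrow> \<exists>h k. h integrable_on cbox a b \<and> k integrable_on cbox a b \<and>
     integral (cbox a b) k < e \<and> (\<forall>x\<in>cbox a b. norm (f x - h x) \<le> k x)"
  shows "f integrable_on cbox a b"
  unfolding integrable_Cauchy
proof (intro allI impI)
  fix e :: real assume e: "e > 0"
  have e8: "e/8 > 0" using e by simp
  obtain h and k :: "'n \<Rightarrow> real" where h: "h integrable_on cbox a b" and k: "k integrable_on cbox a b"
    and ke: "integral (cbox a b) k < e/8" and le: "\<And>x. x\<in>cbox a b \<Longrightarrow> norm (f x - h x) \<le> k x"
    using assms[OF e8] by blast
  let ?S = "\<lambda>(\<D>::('n \<times> 'n set) set) g. \<Sum>(x,K)\<in>\<D>. measure lborel K *\<^sub>R g x"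
  obtain \<gamma>1 where \<gamma>1: "gauge \<gamma>1" and h1: "\<And>\<D>1 \<D>2. \<D>1 tagged_division_of (cbox a b) \<Longrightarrow> \<gamma>1 fine \<D>1 \<Longrightarrow>
      \<D>2 tagged_division_of (cbox a b) \<Longrightarrow> \<gamma>1 fine \<D>2 \<Longrightarrow> norm (?S \<D>1 h - ?S \<D>2 h) < e/2"
    by (rule integrable_CauchyD[OF h half_gt_zero[OF e]]) (rule that)
  obtain \<gamma>2 where \<gamma>2: "gauge \<gamma>2" and k2: "\<And>\<D>. \<D> tagged_division_of (cbox a b) \<Longrightarrow> \<gamma>2 fine \<D> \<Longrightarrow>
      norm (?S \<D> k - integral (cbox a b) k) < e/8"
    by (rule integrable_integralD[OF k e8]) (rule that)
  have fh: "norm (?S \<D> f - ?S \<D> h) < e/4" if D: "\<D> tagged_division_of (cbox a b)" "\<gamma>2 fine \<D>" for \<D> :: "('n \<times> 'n set) set"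
  proof -
    have "?S \<D> f - ?S \<D> h = (\<Sum>(x,K)\<in>\<D>. measure lborel K *\<^sub>R (f x - h x))"
      unfolding sum_subtractf[symmetric] by (rule sum.cong) (auto simp: scaleR_diff_right)
    also have "norm \<dots> \<le> (\<Sum>(x,K)\<in>\<D>. measure lborel K *\<^sub>R k x)"
    proof (rule sum_norm_le, clarify)
      fix x K assume "(x, K) \<in> \<D>"
      then have "x \<in> cbox a b" by (rule tag_in_interval[OF D(1)])
      then show "norm (measure lborel K *\<^sub>R (f x - h x)) \<le> measure lborel K *\<^sub>R k x"
        using le by (simp add: mult_left_mono)
    qed
    also have "\<dots> < e/4" using k2[OF D] ke unfolding real_norm_def abs_less_iff by linarith
    finally show ?thesis .
  qed
  have key: "norm (?S \<D>1 f - ?S \<D>2 f) < e"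
    if D1: "\<D>1 tagged_division_of (cbox a b)" "(\<lambda>x. \<gamma>1 x \<inter> \<gamma>2 x) fine \<D>1"
      and D2: "\<D>2 tagged_division_of (cbox a b)" "(\<lambda>x. \<gamma>1 x \<inter> \<gamma>2 x) fine \<D>2" for \<D>1 \<D>2
  proof -
    have f1: "\<gamma>1 fine \<D>1" "\<gamma>2 fine \<D>1" "\<gamma>1 fine \<D>2" "\<gamma>2 fine \<D>2"
      using D1(2) D2(2) unfolding fine_Int by simp_all
    have "norm (?S \<D>1 f - ?S \<D>2 f) \<le> norm (?S \<D>1 f - ?S \<D>1 h) + norm (?S \<D>1 h - ?S \<D>2 h) + norm (?S \<D>2 f - ?S \<D>2 h)"
      by (rule norm_diff_triangle3)
    then show ?thesis using fh[OF D1(1) f1(2)] fh[OF D2(1) f1(4)] h1[OF D1(1) f1(1) D2(1) f1(3)] by linarith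
  qed
  show "\<exists>\<gamma>. gauge \<gamma> \<and> (\<forall>\<D>1 \<D>2. \<D>1 tagged_division_of (cbox a b) \<and> \<gamma> fine \<D>1 \<and>
            \<D>2 tagged_division_of (cbox a b) \<and> \<gamma> fine \<D>2 \<longrightarrow> norm (?S \<D>1 f - ?S \<D>2 f) < e)"
  proof (rule exI, rule conjI, rule gauge_Int[OF \<gamma>1 \<gamma>2], rule allI, rule allI, rule impI)
    fix \<D>1 \<D>2
    assume A: "\<D>1 tagged_division_of (cbox a b) \<and> (\<lambda>x. \<gamma>1 x \<inter> \<gamma>2 x) fine \<D>1 \<and>
            \<D>2 tagged_division_of (cbox a b) \<and> (\<lambda>x. \<gamma>1 x \<inter> \<gamma>2 x) fine \<D>2"
    show "norm (?S \<D>1 f - ?S \<D>2 f) < e"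
      by (rule key[OF A[THEN conjunct1] A[THEN conjunct2, THEN conjunct1]
        A[THEN conjunct2, THEN conjunct2, THEN conjunct1] A[THEN conjunct2, THEN conjunct2, THEN conjunct2]])
  qed
qed

lemma integral_0_to_small:
  fixes k :: "real \<Rightarrow> real"
  assumes "k integrable_on UNIV" "e > 0"
  shows "\<exists>\<eta>>0. \<bar>integral {-\<eta>..\<eta>} k\<bar> < e"
proof -
  have ki: "k integrable_on {a..b}" for a b using integrable_on_subinterval[OF assms(1)] by simp
  have "continuous_on {-1..1} (\<lambda>x. integral {-1..x} k)" by (intro indefinite_integral_continuous_1 ki)
  then have "continuous (at 0) (\<lambda>x. integral {-1..x} k)"
    by (rule continuous_on_interior) auto
  then obtain d where d: "d > 0" "\<And>x. dist x 0 < d \<Longrightarrow> dist (integral {-1..x} k) (integral {-1..0} k) < e/2"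
    using assms(2) unfolding continuous_at_eps_delta by (metis half_gt_zero)
  define \<eta> where "\<eta> = min (d/2) (1/2)"
  have \<eta>: "0 < \<eta>" "\<eta> < d" "\<eta> < 1" using d by (auto simp: \<eta>_def)
  have "integral {-1..-\<eta>} k + integral {-\<eta>..\<eta>} k = integral {-1..\<eta>} k"
    by (rule Henstock_Kurzweil_Integration.integral_combine) (use \<eta>(1,3) ki in auto)
  moreover have "\<bar>integral {-1..\<eta>} k - integral {-1..0} k\<bar> < e/2"
    using d(2)[of \<eta>] \<eta> by (simp add: dist_real_def)
  moreover have "\<bar>integral {-1..-\<eta>} k - integral {-1..0} k\<bar> < e/2"
    using d(2)[of "-\<eta>"] \<eta> by (simp add: dist_real_def)
  ultimately have "\<bar>integral {-\<eta>..\<eta>} k\<bar> < e" by linarith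
  then show ?thesis using \<eta>(1) by blast
qed

lemma ball_subset_atLeastAtMost:
  fixes B :: real
  assumes "B > 0" "ball 0 B \<subseteq> {a..b}"
  shows "a \<le> -B \<and> B \<le> b"
proof -
  have "closure (ball 0 B) \<subseteq> {a..b}" by (rule closure_minimal[OF assms(2)]) simp
  then have "cball 0 B \<subseteq> {a..b}" using assms(1) by simp
  moreover have "-B \<in> cball 0 B" "B \<in> cball 0 B" using assms(1) by (auto simp: dist_real_def)
  ultimately have "-B \<in> {a..b}" "B \<in> {a..b}" by blast+
  then show ?thesis by simp
qed

lemma integral_UNIV_box:
  fixes f :: "'n::euclidean_space \<Rightarrow> 'a::banach"
  assumes "f integrable_on UNIV" "e > 0"
  obtains B where "B > 0" "\<And>a b. ball 0 B \<subseteq> cbox a b \<Longrightarrow> norm (integral (cbox a b) f - integral UNIV f) < e"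
proof -
  have "(f has_integral integral UNIV f) UNIV" using assms(1) by (rule integrable_integral)
  then have "\<exists>B>0. \<forall>a b. ball 0 B \<subseteq> cbox a b \<longrightarrow>
      norm (integral (cbox a b) (\<lambda>x. if x \<in> UNIV then f x else 0) - integral UNIV f) < e"
    using assms(2) unfolding has_integral_alt' by blast
  then show ?thesis using that unfolding if_P[OF UNIV_I] by blast
qed

lemma has_integral_UNIV_iff:
  fixes f :: "'n::euclidean_space \<Rightarrow> 'a::banach"
  shows "(f has_integral I) UNIV \<longleftrightarrow> (\<forall>e>0. \<exists>B>0. \<forall>a b. ball 0 B \<subseteq> cbox a b \<longrightarrow>
      (\<exists>z. (f has_integral z) (cbox a b) \<and> norm (z - I) < e))"
  by (subst has_integral') simp

lemma integral_combine3:
  fixes g :: "real \<Rightarrow> 'a::banach"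
  assumes "a \<le> b" "b \<le> c" "c \<le> d" "\<And>x y. g integrable_on {x..y}"
  shows "integral {a..d} g = integral {a..b} g + integral {b..c} g + integral {c..d} g"
  using Henstock_Kurzweil_Integration.integral_combine[of a b d g] Henstock_Kurzweil_Integration.integral_combine[of b c d g] assms by (simp add: add.assoc)

text \<open>The integrand may be singular, or have a jump, at \<open>0\<close>.\<close>

lemma dominated_integrable_UNIV:
  fixes f :: "real \<Rightarrow> 'a::banach" and k :: "real \<Rightarrow> real"
  assumes f: "\<And>a b. b < 0 \<or> 0 < a \<Longrightarrow> f integrable_on {a..b}"
    and k: "k integrable_on UNIV" and le: "\<And>s. norm (f s) \<le> k s"
  shows "f integrable_on UNIV"
proof -
  have ki: "k integrable_on {a..b}" for a b using integrable_on_subinterval[OF k] by simp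
  have k0: "0 \<le> k s" for s using le[of s] norm_ge_zero order_trans by blast
  have fi: "f integrable_on cbox a b" for a b
  proof (rule integrable_by_approximation_in_mean)
    fix e :: real assume "e > 0"
    then obtain \<eta> where \<eta>: "\<eta> > 0" "\<bar>integral {-\<eta>..\<eta>} k\<bar> < e" using integral_0_to_small[OF k] by blast
    define h where "h s = (if s \<in> {..-\<eta>} then f s else 0) + (if s \<in> {\<eta>..} then f s else 0)" for s
    define k' where "k' s = (if s \<in> {-\<eta>..\<eta>} then k s else 0)" for s
    have "h integrable_on cbox a b"
      unfolding h_def
    proof (rule integrable_add)
      show "(\<lambda>s. if s \<in> {..-\<eta>} then f s else 0) integrable_on cbox a b"
        unfolding integrable_restrict_Int using f[of "min b (-\<eta>)" a] \<eta>(1)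
        by (simp add: Int_atLeastAtMostL2 Int_commute min.commute min_less_iff_disj)
      have "{\<eta>..} \<inter> {a..b} = {max a \<eta>..b}" by auto
      then show "(\<lambda>s. if s \<in> {\<eta>..} then f s else 0) integrable_on cbox a b"
        unfolding integrable_restrict_Int using f[of b "max a \<eta>"] \<eta>(1) by (simp add: max.commute less_max_iff_disj)
    qed
    moreover have "k' integrable_on cbox a b"
    proof -
      have "{-\<eta>..\<eta>} \<inter> {a..b} = {max a (-\<eta>)..min b \<eta>}" by auto
      then show ?thesis unfolding k'_def integrable_restrict_Int using ki by simp
    qed
    moreover have "integral (cbox a b) k' < e"
    proof -
      have "integral (cbox a b) k' = integral ({-\<eta>..\<eta>} \<inter> cbox a b) k"
        unfolding k'_def by (rule integral_restrict_Int)
      also have "{-\<eta>..\<eta>} \<inter> cbox a b = {max a (-\<eta>)..min b \<eta>}" by auto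
      also have "integral \<dots> k \<le> integral {-\<eta>..\<eta>} k"
        using ki k0 by (intro integral_subset_le) auto
      finally show ?thesis using \<eta>(2) by simp
    qed
    moreover have "\<forall>x\<in>cbox a b. norm (f x - h x) \<le> k' x"
      using \<eta>(1) le k0 by (auto simp: h_def k'_def)
    ultimately show "\<exists>h k. h integrable_on cbox a b \<and> k integrable_on cbox a b \<and>
     integral (cbox a b) k < e \<and> (\<forall>x\<in>cbox a b. norm (f x - h x) \<le> k x)" by blast
  qed
  have fi': "f integrable_on {a..b}" for a b using fi[of a b] by simp
  have "\<exists>B>0. \<forall>a b c d::real. ball 0 B \<subseteq> cbox a b \<and> ball 0 B \<subseteq> cbox c d \<longrightarrow>
        norm (integral (cbox a b) f - integral (cbox c d) f) < e" if e: "e > 0" for e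
  proof -
    obtain B where B: "B > 0"
      "\<And>a b::real. ball 0 B \<subseteq> cbox a b \<Longrightarrow> \<bar>integral (cbox a b) k - integral UNIV k\<bar> < e/4"
      using integral_UNIV_box[OF k, of "e/4"] e by auto
    have *: "norm (integral {a..b} f - integral {-B..B} f) < e/2" if "ball 0 B \<subseteq> {a..b}" for a b
    proof -
      have ab: "a \<le> -B" "B \<le> b" using ball_subset_atLeastAtMost[OF B(1) that] by auto
      have "integral {a..b} f - integral {-B..B} f = integral {a..-B} f + integral {B..b} f"
        using integral_combine3[of a "-B" B b f] ab B(1) fi' by simp
      also have "norm \<dots> \<le> integral {a..-B} k + integral {B..b} k"
        using le by (intro norm_triangle_mono Henstock_Kurzweil_Integration.integral_norm_bound_integral fi' ki) auto
      also have "\<dots> = integral {a..b} k - integral {-B..B} k"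
        using integral_combine3[of a "-B" B b k] ab B(1) ki by simp
      also have "\<dots> < e/2"
      proof -
        have "ball 0 B \<subseteq> cbox (-B) B" by (auto simp: dist_real_def)
        then have "\<bar>integral {-B..B} k - integral UNIV k\<bar> < e/4" using B(2)[of "-B" B] by simp
        moreover have "\<bar>integral {a..b} k - integral UNIV k\<bar> < e/4" using B(2)[of a b] that by simp
        ultimately show ?thesis by linarith
      qed
      finally show ?thesis .
    qed
    show ?thesis
    proof (intro exI[of _ B] conjI allI impI B(1))
      fix a b c d :: real assume "ball 0 B \<subseteq> cbox a b \<and> ball 0 B \<subseteq> cbox c d"
      then show "norm (integral (cbox a b) f - integral (cbox c d) f) < e"
        using *[of a b] *[of c d] norm_triangle_ineq4[of "integral {a..b} f - integral {-B..B} f"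
            "integral {c..d} f - integral {-B..B} f"] by simp
    qed
  qed
  then show ?thesis by (subst integrable_alt) (use fi in simp)
qed

corollary dominated_integrable_UNIV_continuous:
  fixes f :: "real \<Rightarrow> 'a::banach"
  assumes "continuous_on UNIV f" "k integrable_on UNIV" "\<And>s. norm (f s) \<le> k s"
  shows "f integrable_on UNIV"
  using assms by (intro dominated_integrable_UNIV[of f k])
    (auto intro: integrable_continuous_real continuous_on_subset)

lemma has_integral_minus_restrict:
  fixes f :: "real \<Rightarrow> 'a::banach"
  assumes "f integrable_on UNIV" "f integrable_on S"
  shows "((\<lambda>s. f s - (if s \<in> S then f s else 0)) has_integral (integral UNIV f - integral S f)) UNIV"
proof (rule has_integral_diff)
  show "(f has_integral integral UNIV f) UNIV" by (rule integrable_integral[OF assms(1)])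
  show "((\<lambda>s. if s \<in> S then f s else 0) has_integral integral S f) UNIV"
    by (rule has_integral_restrict_UNIV[THEN iffD2]) (rule integrable_integral[OF assms(2)])
qed

lemma integral_UNIV_tail:
  fixes f :: "real \<Rightarrow> 'a::banach" and k :: "real \<Rightarrow> real"
  assumes f: "f integrable_on UNIV" and k: "k integrable_on UNIV" and le: "\<And>s. norm (f s) \<le> k s"
  shows "norm (integral UNIV f - integral {a..b} f) \<le> integral UNIV k - integral {a..b} k"
proof -
  have fi: "f integrable_on {a..b}" using integrable_on_subinterval[OF f] by simp
  have ki: "k integrable_on {a..b}" using integrable_on_subinterval[OF k] by simp
  have k0: "0 \<le> k s" for s using le[of s] norm_ge_zero order_trans by blast
  note F = has_integral_minus_restrict[OF f fi] and K = has_integral_minus_restrict[OF k ki]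
  have "norm (integral UNIV f - integral {a..b} f) =
      norm (integral UNIV (\<lambda>s. f s - (if s \<in> {a..b} then f s else 0)))"
    using integral_unique[OF F] by simp
  also have "\<dots> \<le> integral UNIV (\<lambda>s. k s - (if s \<in> {a..b} then k s else 0))"
    using le k0 F K by (intro Henstock_Kurzweil_Integration.integral_norm_bound_integral) (auto simp: integrable_on_def)
  also have "\<dots> = integral UNIV k - integral {a..b} k" using integral_unique[OF K] by simp
  finally show ?thesis .
qed

lemma tendsto_integral_UNIV:
  fixes f :: "real \<Rightarrow> 'a::banach"
  assumes "f integrable_on UNIV"
  shows "(\<lambda>n. integral {-real n..real n} f) \<longlonglongrightarrow> integral UNIV f"
proof (rule LIMSEQ_I)
  fix e :: real assume "e > 0"
  then obtain B where B: "B > 0"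
      "\<And>a b::real. ball 0 B \<subseteq> cbox a b \<Longrightarrow> norm (integral (cbox a b) f - integral UNIV f) < e"
    using integral_UNIV_box[OF assms] by blast
  obtain N :: nat where N: "real N > B" using reals_Archimedean2 by blast
  have "norm (integral {-real n..real n} f - integral UNIV f) < e" if "n \<ge> N" for n
  proof -
    have "ball 0 B \<subseteq> cbox (- real n) (real n)" using that N by (auto simp: dist_real_def)
    then show ?thesis using B(2)[of "-real n" "real n"] by simp
  qed
  then show "\<exists>N. \<forall>n\<ge>N. norm (integral {-real n..real n} f - integral UNIV f) < e" by blast
qed

lemma has_integral_shift_UNIV:
  fixes f :: "real \<Rightarrow> 'a::banach"
  assumes "(f has_integral I) UNIV"
  shows "((\<lambda>x. f (x + c)) has_integral I) UNIV"
  unfolding has_integral_UNIV_iff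
proof (intro allI impI)
  fix e :: real assume "e > 0"
  then obtain B where B: "B > 0" "\<And>a b::real. ball 0 B \<subseteq> cbox a b \<Longrightarrow>
      \<exists>z. (f has_integral z) (cbox a b) \<and> norm (z - I) < e"
    using assms unfolding has_integral_UNIV_iff by blast
  show "\<exists>B>0. \<forall>a b::real. ball 0 B \<subseteq> cbox a b \<longrightarrow>
        (\<exists>z. ((\<lambda>x. f (x + c)) has_integral z) (cbox a b) \<and> norm (z - I) < e)"
  proof (rule exI[of _ "B + \<bar>c\<bar>"], intro conjI allI impI)
    fix a b :: real assume ab: "ball 0 (B + \<bar>c\<bar>) \<subseteq> cbox a b"
    have "ball 0 B \<subseteq> cbox (a + c) (b + c)"
    proof
      fix x :: real assume "x \<in> ball 0 B"
      then have "x - c \<in> ball 0 (B + \<bar>c\<bar>)" by (auto simp: dist_real_def)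
      then have "x - c \<in> cbox a b" using ab by blast
      then show "x \<in> cbox (a + c) (b + c)" by auto
    qed
    then obtain z where z: "(f has_integral z) (cbox (a + c) (b + c))" "norm (z - I) < e" using B(2) by blast
    have "((\<lambda>x. f (x + c)) has_integral z) (cbox a b)"
      using has_integral_affinity'[OF z(1), of 1 c] by simp
    then show "\<exists>z. ((\<lambda>x. f (x + c)) has_integral z) (cbox a b) \<and> norm (z - I) < e"
      using z(2) by auto
  qed (use B in auto)
qed

lemma has_integral_uminus_UNIV:
  fixes f :: "real \<Rightarrow> 'a::banach"
  assumes "(f has_integral I) UNIV"
  shows "((\<lambda>x. f (- x)) has_integral I) UNIV"
  unfolding has_integral_UNIV_iff
proof (intro allI impI)
  fix e :: real assume "e > 0"
  then obtain B where B: "B > 0" "\<And>a b::real. ball 0 B \<subseteq> cbox a b \<Longrightarrow>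
      \<exists>z. (f has_integral z) (cbox a b) \<and> norm (z - I) < e"
    using assms unfolding has_integral_UNIV_iff by blast
  show "\<exists>B>0. \<forall>a b::real. ball 0 B \<subseteq> cbox a b \<longrightarrow>
        (\<exists>z. ((\<lambda>x. f (- x)) has_integral z) (cbox a b) \<and> norm (z - I) < e)"
  proof (rule exI[of _ B], intro conjI allI impI B(1))
    fix a b :: real assume ab: "ball 0 B \<subseteq> cbox a b"
    have "ball 0 B \<subseteq> cbox (- b) (- a)"
    proof
      fix x :: real assume "x \<in> ball 0 B"
      then have "- x \<in> ball 0 B" by (simp add: dist_real_def)
      then have "- x \<in> cbox a b" using ab by blast
      then show "x \<in> cbox (- b) (- a)" by auto
    qed
    then obtain z where z: "(f has_integral z) (cbox (- b) (- a))" "norm (z - I) < e" using B(2) by blast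
    have "((\<lambda>x. f (- x)) has_integral z) (cbox a b)"
      using has_integral_reflect_lemma[OF z(1)] by simp
    then show "\<exists>z. ((\<lambda>x. f (- x)) has_integral z) (cbox a b) \<and> norm (z - I) < e"
      using z(2) by auto
  qed
qed

lemma has_integral_inverse_square_UNIV:
  fixes c :: real
  assumes "c > 0"
  shows "((\<lambda>\<tau>. 1 / (c\<^sup>2 + \<tau>\<^sup>2)) has_integral pi / c) UNIV"
proof -
  let ?f = "\<lambda>\<tau>::real. 1 / (c\<^sup>2 + \<tau>\<^sup>2)"
  have D: "((\<lambda>\<tau>. arctan (\<tau> / c) / c) has_vector_derivative ?f \<tau>) (at \<tau> within S)" for \<tau> S
  proof -
    have "1 + (\<tau> / c)\<^sup>2 = (c\<^sup>2 + \<tau>\<^sup>2) / c\<^sup>2" using assms by (simp add: power_divide add_divide_distrib)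
    moreover have "inverse ((c\<^sup>2 + \<tau>\<^sup>2) / c\<^sup>2) * (1 / c) / c = ?f \<tau>"
      using assms by (simp add: power2_eq_square)
    moreover have "((\<lambda>\<tau>. arctan (\<tau> / c) / c) has_real_derivative inverse (1 + (\<tau> / c)\<^sup>2) * (1 / c) / c) (at \<tau> within S)"
      by (rule DERIV_cdivide, rule DERIV_chain2[OF DERIV_arctan], rule DERIV_cdivide[OF DERIV_ident])
    ultimately have "((\<lambda>\<tau>. arctan (\<tau> / c) / c) has_real_derivative ?f \<tau>) (at \<tau> within S)"
      by (simp only:)
    then show ?thesis by (rule has_real_derivative_iff_has_vector_derivative[THEN iffD1])
  qed
  have I: "(?f has_integral (arctan (b / c) / c - arctan (a / c) / c)) {a..b}" if "a \<le> b" for a b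
    by (rule fundamental_theorem_of_calculus[OF that D])
  have up: "((\<lambda>b. arctan (b / c) / c) \<longlongrightarrow> (pi/2) / c) at_top"
  proof (intro tendsto_divide tendsto_const)
    have "filterlim (\<lambda>b::real. (1/c) * b) at_top at_top"
      by (rule filterlim_tendsto_pos_mult_at_top[OF tendsto_const _ filterlim_ident]) (use assms in auto)
    then show "((\<lambda>b. arctan (b / c)) \<longlongrightarrow> pi/2) at_top"
      by (intro filterlim_compose[OF tendsto_arctan_at_top]) simp
  qed (use assms in auto)
  show ?thesis
    unfolding has_integral_UNIV_iff
  proof (intro allI impI)
    fix e :: real assume "e > 0"
    then have "\<forall>\<^sub>F b in at_top. dist (arctan (b / c) / c) ((pi/2) / c) < e/2"
      using up by (intro tendstoD) auto
    then obtain B where B: "\<And>b. b \<ge> B \<Longrightarrow> dist (arctan (b / c) / c) ((pi/2) / c) < e/2"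
      by (auto simp: eventually_at_top_linorder)
    show "\<exists>B>0. \<forall>a b::real. ball 0 B \<subseteq> cbox a b \<longrightarrow>
        (\<exists>z. (?f has_integral z) (cbox a b) \<and> norm (z - pi / c) < e)"
    proof (rule exI[of _ "max B 1"], intro conjI allI impI)
      fix a b :: real assume "ball 0 (max B 1) \<subseteq> cbox a b"
      then have ab: "a \<le> - max B 1" "max B 1 \<le> b" "a \<le> b"
        using ball_subset_atLeastAtMost[of "max B 1" a b] by force+
      have "\<bar>arctan (b / c) / c - (pi/2) / c\<bar> < e/2" "\<bar>arctan (- a / c) / c - (pi/2) / c\<bar> < e/2"
        using B[of b] B[of "-a"] ab by (auto simp: dist_real_def)
      moreover have "arctan (- a / c) / c = - (arctan (a / c) / c)"
        using arctan_minus[of "a / c"] by simp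
      moreover have "(pi/2) / c + (pi/2) / c = pi / c" by (simp add: field_simps)
      ultimately have "norm (arctan (b / c) / c - arctan (a / c) / c - pi / c) < e"
        unfolding real_norm_def by linarith
      then show "\<exists>z. (?f has_integral z) (cbox a b) \<and> norm (z - pi / c) < e"
        using I[of a b] ab by (intro exI[of _ "arctan (b / c) / c - arctan (a / c) / c"]) auto
    qed auto
  qed
qed

subsection \<open>The complexification\<close>

definition cscale :: "complex \<Rightarrow> 'a \<times> 'a \<Rightarrow> 'a \<times> 'a::real_vector" where
  "cscale z w = (Re z *\<^sub>R fst w - Im z *\<^sub>R snd w, Im z *\<^sub>R fst w + Re z *\<^sub>R snd w)"

lemma cscale_cscale: "cscale z (cscale z' w) = cscale (z * z') w"
  by (simp add: cscale_def algebra_simps)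

lemma cscale_1 [simp]: "cscale 1 w = w"
  by (simp add: cscale_def)

lemma cscale_of_real: "cscale (of_real r) w = r *\<^sub>R w"
  by (simp add: cscale_def prod_eq_iff)

lemma cscale_add_right: "cscale z (v + w) = cscale z v + cscale z w"
  and cscale_diff_right: "cscale z (v - w) = cscale z v - cscale z w"
  and cscale_add_left: "cscale (z + z') w = cscale z w + cscale z' w"
  and cscale_diff_left: "cscale (z - z') w = cscale z w - cscale z' w"
  by (simp_all add: cscale_def algebra_simps)

lemma norm_cscale_le:
  fixes w :: "'a::real_normed_vector \<times> 'a"
  shows "norm (cscale z w) \<le> norm z * norm w * 2"
proof -
  have eq: "cscale z w = Re z *\<^sub>R w + Im z *\<^sub>R (- snd w, fst w)"
    by (simp add: cscale_def prod_eq_iff)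
  have "norm (- snd w, fst w) = norm w"
    by (simp add: norm_prod_def add.commute)
  then have "norm (cscale z w) \<le> \<bar>Re z\<bar> * norm w + \<bar>Im z\<bar> * norm w"
    unfolding eq by (metis norm_scaleR norm_triangle_ineq)
  also have "\<dots> \<le> norm z * norm w + norm z * norm w"
    by (intro add_mono mult_right_mono abs_Re_le_cmod abs_Im_le_cmod) auto
  finally show ?thesis by simp
qed

lemma bounded_bilinear_cscale:
  "bounded_bilinear (cscale :: complex \<Rightarrow> 'a::real_normed_vector \<times> 'a \<Rightarrow> 'a \<times> 'a)"
proof
  show "\<exists>K. \<forall>z (w::'a \<times> 'a). norm (cscale z w) \<le> norm z * norm w * K"
    using norm_cscale_le by blast
qed (simp_all add: cscale_def prod_eq_iff algebra_simps)

definition cfun :: "('a \<Rightarrow> real) \<Rightarrow> 'a \<times> 'a \<Rightarrow> complex" where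
  "cfun f w = Complex (f (fst w)) (f (snd w))"

lemma bounded_linear_cfun:
  assumes "bounded_linear f"
  shows "bounded_linear (cfun f)"
proof -
  have eq: "cfun f = (\<lambda>w. f (fst w) *\<^sub>R 1 + f (snd w) *\<^sub>R \<i>)"
    by (auto simp: cfun_def complex_eq_iff)
  show ?thesis unfolding eq
    by (intro bounded_linear_add bounded_linear_scaleR_left[THEN bounded_linear_compose]
        bounded_linear_compose[OF assms] bounded_linear_fst bounded_linear_snd)
qed

lemma cfun_cscale:
  assumes "bounded_linear f"
  shows "cfun f (cscale z w) = z * cfun f w"
  using bounded_linear.linear[OF assms]
  by (simp add: cfun_def cscale_def complex_eq_iff linear_add linear_diff linear_scale)

lemma eq_if_cfun_eq:
  fixes v w :: "'a::real_normed_vector \<times> 'a"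
  assumes "\<And>f::'a \<Rightarrow> real. bounded_linear f \<Longrightarrow> cfun f v = cfun f w"
  shows "v = w"
proof -
  have "f (fst v) = f (fst w)" "f (snd v) = f (snd w)" if "bounded_linear f" for f :: "'a \<Rightarrow> real"
    using assms[OF that] by (simp_all add: cfun_def)
  then have "fst v = fst w" "snd v = snd w" by (blast intro: eq_if_functionals_eq)+
  then show ?thesis by (rule prod_eqI)
qed

subsection \<open>Laplace inversion along vertical lines\<close>

lemma has_vector_derivative_vertical_line:
  assumes "(g has_field_derivative d) (at (Complex c \<tau>))"
  shows "((\<lambda>\<tau>. g (Complex c \<tau>)) has_vector_derivative (\<i> * d)) (at \<tau> within S)"
proof -
  have eq: "Complex c = (\<lambda>\<tau>. of_real c + \<tau> *\<^sub>R \<i>)" by (auto simp: complex_eq_iff)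
  have "((\<lambda>\<tau>. of_real c + \<tau> *\<^sub>R \<i>) has_derivative (\<lambda>h. 0 + h *\<^sub>R \<i>)) (at \<tau>)"
    by (intro has_derivative_add has_derivative_const has_derivative_scaleR_left has_derivative_ident)
  then have "(Complex c has_vector_derivative \<i>) (at \<tau>)"
    unfolding eq has_vector_derivative_def by simp
  from field_vector_diff_chain_at[OF this assms]
  show ?thesis by (simp add: o_def has_vector_derivative_at_within)
qed

lemma continuous_on_vertical_line: "continuous_on S (Complex c)"
proof -
  have eq: "Complex c = (\<lambda>\<tau>. of_real c + \<tau> *\<^sub>R \<i>)" by (auto simp: complex_eq_iff)
  show ?thesis unfolding eq by (intro continuous_intros)
qed

abbreviation rhp :: "real \<Rightarrow> complex set" where "rhp \<omega> \<equiv> {z. \<omega> < Re z}"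

definition rhp_decay :: "real \<Rightarrow> real \<Rightarrow> (complex \<Rightarrow> 'a \<times> 'a::real_normed_vector) \<Rightarrow> bool" where
  "rhp_decay \<omega> C g \<longleftrightarrow> 0 \<le> \<omega> \<and> continuous_on (rhp \<omega>) g \<and> (\<forall>z\<in>rhp \<omega>. norm (g z) \<le> C / (cmod z)\<^sup>2) \<and>
     (\<forall>f. bounded_linear f \<longrightarrow> (\<lambda>z. cfun f (g z)) holomorphic_on rhp \<omega>)"

definition laplace_integrand :: "(complex \<Rightarrow> 'a \<times> 'a::real_vector) \<Rightarrow> real \<Rightarrow> real \<Rightarrow> real \<Rightarrow> 'a \<times> 'a" where
  "laplace_integrand g c t \<tau> = cscale (exp (Complex c \<tau> * of_real t)) (g (Complex c \<tau>))"

definition inv_laplace :: "(complex \<Rightarrow> 'a \<times> 'a::banach) \<Rightarrow> real \<Rightarrow> real \<Rightarrow> 'a \<times> 'a" where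
  "inv_laplace g c t = (1 / (2 * pi)) *\<^sub>R integral UNIV (laplace_integrand g c t)"

lemma cmod_Complex_square: "(cmod (Complex c \<tau>))\<^sup>2 = c\<^sup>2 + \<tau>\<^sup>2"
  by (simp add: cmod_def)

lemma rhp_decay_nonneg: "rhp_decay \<omega> C g \<Longrightarrow> 0 \<le> \<omega>"
  by (simp add: rhp_decay_def)

lemma rhp_decay_pos: "rhp_decay \<omega> C g \<Longrightarrow> c > \<omega> \<Longrightarrow> 0 < c"
  by (simp add: rhp_decay_def)

lemma rhp_decay_C_nonneg:
  assumes "rhp_decay \<omega> C g"
  shows "0 \<le> C"
proof -
  let ?z = "complex_of_real (\<omega> + 1)"
  have z: "?z \<in> rhp \<omega>" "cmod ?z > 0" using rhp_decay_nonneg[OF assms] unfolding norm_of_real by auto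
  then have "norm (g ?z) \<le> C / (cmod ?z)\<^sup>2" using assms unfolding rhp_decay_def by blast
  then have "0 \<le> C / (cmod ?z)\<^sup>2" using norm_ge_zero order_trans by blast
  then show ?thesis using z(2) by (simp add: zero_le_divide_iff)
qed

lemma norm_laplace_integrand_le:
  assumes "rhp_decay \<omega> C g" "c > \<omega>"
  shows "norm (laplace_integrand g c t \<tau>) \<le> (2 * C * exp (c * t)) * (1 / (c\<^sup>2 + \<tau>\<^sup>2))"
proof -
  have "norm (laplace_integrand g c t \<tau>) \<le> norm (exp (Complex c \<tau> * of_real t)) * norm (g (Complex c \<tau>)) * 2"
    unfolding laplace_integrand_def by (rule norm_cscale_le)
  also have "norm (exp (Complex c \<tau> * of_real t)) = exp (c * t)" by simp
  also have "norm (g (Complex c \<tau>)) \<le> C / (c\<^sup>2 + \<tau>\<^sup>2)"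
    using assms unfolding rhp_decay_def cmod_Complex_square[symmetric] by auto
  finally show ?thesis by (simp add: mult_left_mono mult_right_mono algebra_simps)
qed

lemma continuous_on_laplace_integrand:
  assumes "rhp_decay \<omega> C g" "c > \<omega>"
  shows "continuous_on UNIV (\<lambda>(t, \<tau>). laplace_integrand g c t \<tau>)"
proof -
  have "continuous_on UNIV (\<lambda>x::real \<times> real. g (Complex c (snd x)))"
  proof (rule continuous_on_compose2[of "rhp \<omega>" g])
    show "continuous_on (rhp \<omega>) g" using assms by (simp add: rhp_decay_def)
    show "continuous_on UNIV (\<lambda>x::real \<times> real. Complex c (snd x))"
      by (rule continuous_on_compose2[OF continuous_on_vertical_line[of UNIV]]) (auto intro: continuous_intros)
  qed (use assms in auto)
  moreover have "continuous_on UNIV (\<lambda>x::real \<times> real. exp (Complex c (snd x) * of_real (fst x)))"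
    by (intro continuous_intros continuous_on_compose2[OF continuous_on_vertical_line[of UNIV]]) auto
  ultimately show ?thesis
    unfolding laplace_integrand_def case_prod_unfold by (intro bounded_bilinear.continuous_on[OF bounded_bilinear_cscale])
qed

lemma continuous_on_laplace_integrand2:
  assumes "rhp_decay \<omega> C g" "c > \<omega>"
  shows "continuous_on S (laplace_integrand g c t)"
  using continuous_on_compose2[OF continuous_on_laplace_integrand[OF assms], of S "\<lambda>\<tau>. (t, \<tau>)"]
  by (simp add: continuous_intros)

lemma integrable_inverse_square:
  fixes c :: real
  assumes "c > 0"
  shows "(\<lambda>\<tau>. K * (1 / (c\<^sup>2 + \<tau>\<^sup>2))) integrable_on UNIV"
    "integral UNIV (\<lambda>\<tau>. K * (1 / (c\<^sup>2 + \<tau>\<^sup>2))) = K * (pi / c)"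
  using has_integral_mult_right[OF has_integral_inverse_square_UNIV[OF assms], of K]
  by (auto simp: integrable_on_def integral_unique)

lemma integrable_laplace_integrand:
  fixes g :: "complex \<Rightarrow> 'a \<times> 'a::banach"
  assumes "rhp_decay \<omega> C g" "c > \<omega>"
  shows "laplace_integrand g c t integrable_on UNIV"
  by (rule dominated_integrable_UNIV_continuous[OF continuous_on_laplace_integrand2[OF assms]
      integrable_inverse_square(1)[OF rhp_decay_pos[OF assms]] norm_laplace_integrand_le[OF assms]])

lemma norm_inv_laplace_le:
  fixes g :: "complex \<Rightarrow> 'a \<times> 'a::banach"
  assumes "rhp_decay \<omega> C g" "c > \<omega>"
  shows "norm (inv_laplace g c t) \<le> C * exp (c * t) / c"
proof -
  have "norm (integral UNIV (laplace_integrand g c t)) \<le> (2 * C * exp (c * t)) * (pi / c)"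
    unfolding integrable_inverse_square(2)[OF rhp_decay_pos[OF assms], symmetric] using assms
    by (intro Henstock_Kurzweil_Integration.integral_norm_bound_integral integrable_laplace_integrand
        integrable_inverse_square norm_laplace_integrand_le rhp_decay_pos)
  then show ?thesis unfolding inv_laplace_def using rhp_decay_pos[OF assms] by (simp add: field_simps)
qed

lemma cfun_inv_laplace:
  fixes g :: "complex \<Rightarrow> 'a \<times> 'a::banach"
  assumes g: "rhp_decay \<omega> C g" "c > \<omega>" and f: "bounded_linear f"
  shows "((\<lambda>\<tau>. exp (Complex c \<tau> * of_real t) * cfun f (g (Complex c \<tau>))) has_integral
    (2 * pi) *\<^sub>R cfun f (inv_laplace g c t)) UNIV"
proof -
  have "((cfun f \<circ> laplace_integrand g c t) has_integral cfun f (integral UNIV (laplace_integrand g c t))) UNIV"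
    using integrable_integral[OF integrable_laplace_integrand[OF g]] bounded_linear_cfun[OF f]
    by (rule has_integral_linear)
  moreover have "cfun f (integral UNIV (laplace_integrand g c t)) = (2 * pi) *\<^sub>R cfun f (inv_laplace g c t)"
    using bounded_linear.linear[OF bounded_linear_cfun[OF f]] by (simp add: inv_laplace_def linear_scale)
  ultimately show ?thesis by (simp add: o_def laplace_integrand_def cfun_cscale[OF f])
qed

lemma cfun_inv_laplace_tendsto:
  fixes g :: "complex \<Rightarrow> 'a \<times> 'a::banach"
  assumes g: "rhp_decay \<omega> C g" "c > \<omega>" and f: "bounded_linear f"
  shows "(\<lambda>n. integral {-real n..real n} (\<lambda>\<tau>. exp (Complex c \<tau> * of_real t) * cfun f (g (Complex c \<tau>))))
    \<longlonglongrightarrow> (2 * pi) *\<^sub>R cfun f (inv_laplace g c t)"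
  using tendsto_integral_UNIV[OF has_integral_integrable[OF cfun_inv_laplace[OF assms]]]
  unfolding integral_unique[OF cfun_inv_laplace[OF assms]] .

lemma integral_vertical_line:
  assumes "\<And>z. z \<in> rhp \<omega> \<Longrightarrow> (F has_field_derivative f z) (at z)" "c > \<omega>" "a \<le> b"
  shows "((\<lambda>\<tau>. f (Complex c \<tau>)) has_integral (F (Complex c b) - F (Complex c a)) / \<i>) {a..b}"
proof -
  have "((\<lambda>\<tau>. \<i> * f (Complex c \<tau>)) has_integral (F (Complex c b) - F (Complex c a))) {a..b}"
    using assms by (intro fundamental_theorem_of_calculus has_vector_derivative_vertical_line) auto
  from has_integral_mult_right[OF this, of "1 / \<i>"] show ?thesis
    by (simp add: mult.assoc[symmetric])
qed

lemma cfun_le: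
  assumes "bounded_linear f"
  obtains K where "K \<ge> 0" "\<And>w. cmod (cfun f w) \<le> K * norm w"
  using bounded_linear.nonneg_bounded[OF bounded_linear_cfun[OF assms]] by (metis mult.commute)

lemma convex_Im_eq: "convex {z. Im z = y}"
proof -
  have "convex ({z. Im z \<le> y} \<inter> {z. Im z \<ge> y})"
    by (intro convex_Int convex_halfspace_Im_le convex_halfspace_Im_ge)
  also have "{z. Im z \<le> y} \<inter> {z. Im z \<ge> y} = {z. Im z = y}" by auto
  finally show ?thesis .
qed

lemma convex_Re_eq: "convex {z. Re z = y}"
proof -
  have "convex ({z. Re z \<le> y} \<inter> {z. Re z \<ge> y})"
    by (intro convex_Int convex_halfspace_Re_le convex_halfspace_Re_ge)
  also have "{z. Re z \<le> y} \<inter> {z. Re z \<ge> y} = {z. Re z = y}" by auto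
  finally show ?thesis .
qed

lemma inv_laplace_line_independent:
  fixes g :: "complex \<Rightarrow> 'a \<times> 'a::banach"
  assumes g: "rhp_decay \<omega> C g" and c: "c > \<omega>" "c' > \<omega>"
  shows "inv_laplace g c t = inv_laplace g c' t"
proof (rule eq_if_cfun_eq)
  fix f :: "'a \<Rightarrow> real" assume f: "bounded_linear f"
  define \<phi> where "\<phi> z = exp (z * of_real t) * cfun f (g z)" for z
  have "(\<lambda>z. cfun f (g z)) holomorphic_on rhp \<omega>" using g f by (simp add: rhp_decay_def)
  then have hol: "\<phi> holomorphic_on rhp \<omega>" unfolding \<phi>_def by (intro holomorphic_intros)
  have op: "open (rhp \<omega>)" and cv: "convex (rhp \<omega>)"
    using convex_halfspace_Re_gt[of \<omega>] open_halfspace_Re_gt[of \<omega>] by auto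
  obtain F where "\<And>z. z \<in> rhp \<omega> \<Longrightarrow> (F has_field_derivative \<phi> z) (at z within rhp \<omega>)"
    using holomorphic_convex_primitive'[OF cv op hol] by blast
  then have F: "\<And>z. z \<in> rhp \<omega> \<Longrightarrow> (F has_field_derivative \<phi> z) (at z)"
    using at_within_open[OF _ op] by metis
  obtain K where K: "K \<ge> 0" "\<And>w. cmod (cfun f w) \<le> K * norm w" using cfun_le[OF f] by blast
  define E where "E = exp (max c c' * \<bar>t\<bar>) * (K * C)"
  have edge: "cmod (F (Complex c y) - F (Complex c' y)) \<le> (E / y\<^sup>2) * \<bar>c - c'\<bar>" if "y \<noteq> 0" for y
  proof -
    let ?S = "{z. min c c' \<le> Re z \<and> Re z \<le> max c c' \<and> Im z = y}"
    have sub: "?S \<subseteq> rhp \<omega>" using c by auto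
    have "cmod (F (Complex c y) - F (Complex c' y)) \<le> (E / y\<^sup>2) * cmod (Complex c y - Complex c' y)"
    proof (rule field_differentiable_bound[where S = ?S and f' = \<phi>])
      have "?S = {z. min c c' \<le> Re z} \<inter> {z. Re z \<le> max c c'} \<inter> {z. Im z = y}" by auto
      then show "convex ?S"
        by (simp add: convex_Int convex_halfspace_Re_ge convex_halfspace_Re_le convex_Im_eq)
      fix z assume z: "z \<in> ?S"
      then have zr: "z \<in> rhp \<omega>" using sub by blast
      then show "(F has_field_derivative \<phi> z) (at z within ?S)"
        using F has_field_derivative_at_within by blast
      have "Re z * t \<le> max c c' * \<bar>t\<bar>"
      proof -
        have "0 < Re z" using zr rhp_decay_nonneg[OF g] by auto
        then have "Re z * t \<le> Re z * \<bar>t\<bar>" by (intro mult_left_mono) auto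
        also have "\<dots> \<le> max c c' * \<bar>t\<bar>" using z by (intro mult_right_mono) auto
        finally show ?thesis .
      qed
      moreover have "cmod (cfun f (g z)) \<le> K * (C / y\<^sup>2)"
      proof -
        have "norm (g z) \<le> C / (cmod z)\<^sup>2" using g zr by (auto simp: rhp_decay_def)
        also have "\<dots> \<le> C / y\<^sup>2"
          using z that rhp_decay_C_nonneg[OF g] by (intro divide_left_mono) (auto simp: cmod_power2 intro!: mult_pos_pos add_nonneg_pos)
        finally show ?thesis using K by (meson mult_left_mono order_trans)
      qed
      ultimately show "cmod (\<phi> z) \<le> E / y\<^sup>2"
        unfolding \<phi>_def E_def norm_mult using mult_mono[of "exp (Re z * t)" "exp (max c c' * \<bar>t\<bar>)" "cmod (cfun f (g z))" "K * (C / y\<^sup>2)"]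
        by simp
    qed (auto)
    also have "Complex c y - Complex c' y = of_real (c - c')" by (simp add: complex_eq_iff)
    finally show ?thesis by (simp only: norm_of_real)
  qed
  have lim: "(\<lambda>n. (F (Complex b (real n)) - F (Complex b (- real n))) / \<i>) \<longlonglongrightarrow> (2 * pi) *\<^sub>R cfun f (inv_laplace g b t)"
    if "b > \<omega>" for b
    using cfun_inv_laplace_tendsto[OF g that f, of t] integral_unique[OF integral_vertical_line[OF F that]]
    unfolding \<phi>_def by simp
  have "(\<lambda>n. (F (Complex c (real n)) - F (Complex c (- real n))) / \<i> - (F (Complex c' (real n)) - F (Complex c' (- real n))) / \<i>) \<longlonglongrightarrow> 0"
  proof (rule Lim_null_comparison)
    show "\<forall>\<^sub>F n in sequentially. cmod ((F (Complex c (real n)) - F (Complex c (- real n))) / \<i> - (F (Complex c' (real n)) - F (Complex c' (- real n))) / \<i>)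
      \<le> 2 * (E * \<bar>c - c'\<bar>) / (real n)\<^sup>2"
    proof (rule eventually_sequentiallyI[of 1])
      fix n :: nat assume "1 \<le> n"
      have "(F (Complex c (real n)) - F (Complex c (- real n))) / \<i> - (F (Complex c' (real n)) - F (Complex c' (- real n))) / \<i>
        = ((F (Complex c (real n)) - F (Complex c' (real n))) - (F (Complex c (- real n)) - F (Complex c' (- real n)))) / \<i>"
        by (simp add: field_simps)
      also have "cmod \<dots> = cmod ((F (Complex c (real n)) - F (Complex c' (real n))) - (F (Complex c (- real n)) - F (Complex c' (- real n))))"
        by (simp add: norm_divide norm_mult)
      also have "\<dots> \<le> cmod (F (Complex c (real n)) - F (Complex c' (real n))) + cmod (F (Complex c (- real n)) - F (Complex c' (- real n)))"
        by (rule norm_triangle_ineq4)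
      also have "\<dots> \<le> 2 * (E * \<bar>c - c'\<bar>) / (real n)\<^sup>2"
        using edge[of "real n"] edge[of "- real n"] \<open>1 \<le> n\<close> by simp
      finally show "cmod ((F (Complex c (real n)) - F (Complex c (- real n))) / \<i> - (F (Complex c' (real n)) - F (Complex c' (- real n))) / \<i>)
      \<le> 2 * (E * \<bar>c - c'\<bar>) / (real n)\<^sup>2" .
    qed
    have "(\<lambda>n. (2 * (E * \<bar>c - c'\<bar>)) * (1 / real n) * (1 / real n)) \<longlonglongrightarrow> (2 * (E * \<bar>c - c'\<bar>)) * 0 * 0"
      by (intro tendsto_mult lim_const_over_n tendsto_const) 
    then show "(\<lambda>n. 2 * (E * \<bar>c - c'\<bar>) / (real n)\<^sup>2) \<longlonglongrightarrow> 0" by (simp add: power2_eq_square)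
  qed
  from tendsto_unique[OF _ tendsto_diff[OF lim[OF c(1)] lim[OF c(2)]] this]
  show "cfun f (inv_laplace g c t) = cfun f (inv_laplace g c' t)" by simp
qed

lemma inv_laplace_times:
  fixes g g' :: "complex \<Rightarrow> 'a \<times> 'a::banach"
  assumes g: "rhp_decay \<omega> C g" and g': "rhp_decay \<omega> C' g'" and c: "c > \<omega>"
    and d: "\<And>f z. bounded_linear f \<Longrightarrow> z \<in> rhp \<omega> \<Longrightarrow> ((\<lambda>z. cfun f (g z)) has_field_derivative cfun f (g' z)) (at z)"
  shows "t *\<^sub>R inv_laplace g c t = - inv_laplace g' c t"
proof (rule eq_if_cfun_eq)
  fix f :: "'a \<Rightarrow> real" assume f: "bounded_linear f"
  define \<phi> where "\<phi> z = exp (z * of_real t) * cfun f (g z)" for z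
  define \<psi> where "\<psi> z = of_real t * (exp (z * of_real t) * cfun f (g z)) + exp (z * of_real t) * cfun f (g' z)" for z
  have D: "(\<phi> has_field_derivative \<psi> z) (at z)" if "z \<in> rhp \<omega>" for z
    unfolding \<phi>_def \<psi>_def by (rule derivative_eq_intros d[OF f that] refl | simp add: algebra_simps)+
  have int: "integral {-real n..real n} (\<lambda>\<tau>. \<psi> (Complex c \<tau>)) = (\<phi> (Complex c (real n)) - \<phi> (Complex c (- real n))) / \<i>" for n
    using integral_unique[OF integral_vertical_line[where F = \<phi> and f = \<psi>, OF D c]] by simp
  note h1 = has_integral_mult_right[OF cfun_inv_laplace[OF g c f, of t], of "of_real t"]
  note h2 = cfun_inv_laplace[OF g' c f, of t]
  have lim: "(\<lambda>n. integral {-real n..real n} (\<lambda>\<tau>. \<psi> (Complex c \<tau>))) \<longlonglongrightarrow>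
     of_real t * ((2 * pi) *\<^sub>R cfun f (inv_laplace g c t)) + (2 * pi) *\<^sub>R cfun f (inv_laplace g' c t)"
    using tendsto_integral_UNIV[OF has_integral_integrable[OF has_integral_add[OF h1 h2]]]
    unfolding integral_unique[OF has_integral_add[OF h1 h2]] \<psi>_def .
  obtain K where K: "K \<ge> 0" "\<And>w. cmod (cfun f w) \<le> K * norm w" using cfun_le[OF f] by blast
  have bd: "cmod (\<phi> (Complex c y)) \<le> exp (c * t) * (K * C) / y\<^sup>2" if "y \<noteq> 0" for y
  proof -
    have "norm (g (Complex c y)) \<le> C / (c\<^sup>2 + y\<^sup>2)"
      using g c by (auto simp: rhp_decay_def cmod_Complex_square[symmetric])
    also have "\<dots> \<le> C / y\<^sup>2"
      using that rhp_decay_C_nonneg[OF g] by (intro divide_left_mono) (auto intro!: mult_pos_pos add_nonneg_pos)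
    finally have "cmod (cfun f (g (Complex c y))) \<le> K * (C / y\<^sup>2)" using K by (meson mult_left_mono order_trans)
    from mult_left_mono[OF this, of "exp (c * t)"] show ?thesis
      unfolding \<phi>_def norm_mult by (simp add: algebra_simps)
  qed
  have "(\<lambda>n. (\<phi> (Complex c (real n)) - \<phi> (Complex c (- real n))) / \<i>) \<longlonglongrightarrow> 0"
  proof (rule Lim_null_comparison)
    show "\<forall>\<^sub>F n in sequentially. cmod ((\<phi> (Complex c (real n)) - \<phi> (Complex c (- real n))) / \<i>)
       \<le> (2 * (exp (c * t) * (K * C))) / (real n)\<^sup>2"
    proof (rule eventually_sequentiallyI[of 1])
      fix n :: nat assume "1 \<le> n"
      have "cmod ((\<phi> (Complex c (real n)) - \<phi> (Complex c (- real n))) / \<i>) = cmod (\<phi> (Complex c (real n)) - \<phi> (Complex c (- real n)))"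
        by (simp add: norm_divide norm_mult)
      also have "\<dots> \<le> cmod (\<phi> (Complex c (real n))) + cmod (\<phi> (Complex c (- real n)))" by (rule norm_triangle_ineq4)
      also have "\<dots> \<le> exp (c * t) * (K * C) / (real n)\<^sup>2 + exp (c * t) * (K * C) / (- real n)\<^sup>2"
        by (intro add_mono bd) (use \<open>1 \<le> n\<close> in auto)
      also have "\<dots> = (2 * (exp (c * t) * (K * C))) / (real n)\<^sup>2" by simp
      finally show "cmod ((\<phi> (Complex c (real n)) - \<phi> (Complex c (- real n))) / \<i>)
       \<le> (2 * (exp (c * t) * (K * C))) / (real n)\<^sup>2" .
    qed
    have "(\<lambda>n. (2 * (exp (c * t) * (K * C))) * (1 / real n) * (1 / real n)) \<longlonglongrightarrow> (2 * (exp (c * t) * (K * C))) * 0 * 0"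
      by (intro tendsto_mult lim_const_over_n tendsto_const) 
    then show "(\<lambda>n. (2 * (exp (c * t) * (K * C))) / (real n)\<^sup>2) \<longlonglongrightarrow> 0" by (simp add: power2_eq_square)
  qed
  then have "of_real t * ((2 * pi) *\<^sub>R cfun f (inv_laplace g c t)) + (2 * pi) *\<^sub>R cfun f (inv_laplace g' c t) = 0"
    using LIMSEQ_unique[OF lim] unfolding int by blast
  then have "(2 * pi) *\<^sub>R (of_real t * cfun f (inv_laplace g c t) + cfun f (inv_laplace g' c t)) = 0"
    by (simp add: algebra_simps)
  then have "of_real t * cfun f (inv_laplace g c t) + cfun f (inv_laplace g' c t) = 0"
    by simp
  then show "cfun f (t *\<^sub>R inv_laplace g c t) = cfun f (- inv_laplace g' c t)"
    using bounded_linear.linear[OF bounded_linear_cfun[OF f]]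
    by (simp add: linear_scale linear_neg scaleR_conv_of_real eq_neg_iff_add_eq_0)
qed

lemma inv_laplace_uniform_limit:
  fixes g :: "complex \<Rightarrow> 'a \<times> 'a::banach"
  assumes g: "rhp_decay \<omega> C g" "c > \<omega>"
  shows "uniform_limit {t0..t1} (\<lambda>n s. (1 / (2 * pi)) *\<^sub>R integral {-real n..real n} (laplace_integrand g c s))
    (inv_laplace g c) sequentially"
proof (rule uniform_limitI)
  fix e :: real assume "e > 0"
  define k where "k \<tau> = (2 * C * exp (c * t1)) * (1 / (c\<^sup>2 + \<tau>\<^sup>2))" for \<tau>
  have k: "k integrable_on UNIV" unfolding k_def by (rule integrable_inverse_square(1)[OF rhp_decay_pos[OF g]])
  have "\<forall>\<^sub>F n in sequentially. dist (integral {-real n..real n} k) (integral UNIV k) < e"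
    using tendsto_integral_UNIV[OF k] \<open>e > 0\<close> by (rule tendstoD)
  then show "\<forall>\<^sub>F n in sequentially. \<forall>s\<in>{t0..t1}. dist ((1 / (2 * pi)) *\<^sub>R integral {-real n..real n} (laplace_integrand g c s))
     (inv_laplace g c s) < e"
  proof (rule eventually_mono, intro ballI)
    fix n s assume n: "dist (integral {-real n..real n} k) (integral UNIV k) < e" and s: "s \<in> {t0..t1}"
    have "norm (laplace_integrand g c s \<tau>) \<le> k \<tau>" for \<tau>
    proof -
      have "(2 * C * exp (c * s)) * (1 / (c\<^sup>2 + \<tau>\<^sup>2)) \<le> k \<tau>"
        unfolding k_def using s g rhp_decay_C_nonneg[OF g(1)] rhp_decay_pos[OF g]
          by (intro mult_right_mono mult_left_mono) (auto intro: mult_left_mono)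
      then show ?thesis using norm_laplace_integrand_le[OF g, of s \<tau>] by linarith
    qed
    then have "norm (integral UNIV (laplace_integrand g c s) - integral {-real n..real n} (laplace_integrand g c s))
       \<le> integral UNIV k - integral {-real n..real n} k"
      by (rule integral_UNIV_tail[OF integrable_laplace_integrand[OF g] k])
    also have "\<dots> < e" using n by (simp add: dist_real_def)
    finally have "norm (integral UNIV (laplace_integrand g c s) - integral {-real n..real n} (laplace_integrand g c s)) < e" .
    moreover have le: "norm ((1 / (2 * pi)) *\<^sub>R x) \<le> norm x" for x :: "'a \<times> 'a"
      using pi_gt3 mult_left_le_one_le[of "norm x" "1 / (2 * pi)"] by simp
    ultimately have "norm ((1 / (2 * pi)) *\<^sub>R (integral UNIV (laplace_integrand g c s) - integral {-real n..real n} (laplace_integrand g c s))) < e"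
      using le_less_trans by blast
    then show "dist ((1 / (2 * pi)) *\<^sub>R integral {-real n..real n} (laplace_integrand g c s)) (inv_laplace g c s) < e"
      by (subst dist_commute) (simp only: inv_laplace_def dist_norm scaleR_diff_right)
  qed
qed

lemma continuous_on_truncated_laplace:
  fixes g :: "complex \<Rightarrow> 'a \<times> 'a::banach"
  assumes g: "rhp_decay \<omega> C g" "c > \<omega>"
  shows "continuous_on S (\<lambda>s. (1 / (2 * pi)) *\<^sub>R integral {a..b} (laplace_integrand g c s))"
proof -
  have "continuous_on S (\<lambda>s. integral (cbox a b) (laplace_integrand g c s))"
    by (rule integral_continuous_on_param) (rule continuous_on_subset[OF continuous_on_laplace_integrand[OF g]], simp)
  then show ?thesis by (intro continuous_intros) simp
qed

lemma continuous_on_inv_laplace: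
  fixes g :: "complex \<Rightarrow> 'a \<times> 'a::banach"
  assumes g: "rhp_decay \<omega> C g" "c > \<omega>"
  shows "continuous_on {t0..t1} (inv_laplace g c)"
  using uniform_limit_theorem[OF _ inv_laplace_uniform_limit[OF g]] continuous_on_truncated_laplace[OF g] by simp

lemma has_integral_inv_laplace:
  fixes g :: "complex \<Rightarrow> 'a \<times> 'a::banach"
  assumes g: "rhp_decay \<omega> C g" "c > \<omega>" and G: "rhp_decay \<omega> C' (\<lambda>z. cscale (1 / z) (g z))"
    and t: "t0 \<le> t1"
  defines "G \<equiv> inv_laplace (\<lambda>z. cscale (1 / z) (g z)) c"
  shows "(inv_laplace g c has_integral (G t1 - G t0)) {t0..t1}"
proof -
  let ?g' = "\<lambda>z. cscale (1 / z) (g z)"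
  obtain I J where I: "\<And>n. ((\<lambda>s. (1 / (2 * pi)) *\<^sub>R integral {-real n..real n} (laplace_integrand g c s)) has_integral I n) {t0..t1}"
    and J: "(inv_laplace g c has_integral J) {t0..t1}" and IJ: "I \<longlonglongrightarrow> J"
    using uniform_limit_integral[OF inv_laplace_uniform_limit[OF g] continuous_on_truncated_laplace[OF g]] by (metis trivial_limit_sequentially)
  have inner: "((\<lambda>s. laplace_integrand g c s \<tau>) has_integral (laplace_integrand ?g' c t1 \<tau> - laplace_integrand ?g' c t0 \<tau>)) {t0..t1}" for \<tau>
  proof -
    let ?l = "Complex c \<tau>"
    have nz: "?l \<noteq> 0" using rhp_decay_pos[OF g] by (simp add: complex_eq_iff)
    have "((\<lambda>s. exp (?l * of_real s)) has_integral (exp (?l * of_real t1) / ?l - exp (?l * of_real t0) / ?l)) {t0..t1}"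
    proof (rule fundamental_theorem_of_calculus[OF t])
      fix s
      have "((\<lambda>z. exp (?l * z) / ?l) has_field_derivative exp (?l * of_real s)) (at (of_real s))"
        using nz by (auto intro!: derivative_eq_intros)
      then show "((\<lambda>s. exp (?l * of_real s) / ?l) has_vector_derivative exp (?l * of_real s)) (at s within {t0..t1})"
        by (rule has_vector_derivative_real_field[THEN has_vector_derivative_at_within])
    qed
    from has_integral_linear[OF this bounded_bilinear.bounded_linear_left[OF bounded_bilinear_cscale, of "g ?l"]]
    show ?thesis by (simp add: o_def laplace_integrand_def cscale_cscale cscale_diff_left)
  qed
  have "I n = (1 / (2 * pi)) *\<^sub>R (integral {-real n..real n} (laplace_integrand ?g' c t1) - integral {-real n..real n} (laplace_integrand ?g' c t0))" for n
  proof -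
    have "I n = (1 / (2 * pi)) *\<^sub>R integral {t0..t1} (\<lambda>s. integral {-real n..real n} (laplace_integrand g c s))"
      using integral_unique[OF I[of n]] by simp
    also have "integral {t0..t1} (\<lambda>s. integral {-real n..real n} (laplace_integrand g c s))
        = integral (cbox t0 t1) (\<lambda>s. integral (cbox (- real n) (real n)) (laplace_integrand g c s))" by simp
    also have "\<dots> = integral (cbox (- real n) (real n)) (\<lambda>\<tau>. integral (cbox t0 t1) (\<lambda>s. laplace_integrand g c s \<tau>))"
      by (rule integral_swap_continuous) (rule continuous_on_subset[OF continuous_on_laplace_integrand[OF g]], simp)
    also have "\<dots> = integral {-real n..real n} (\<lambda>\<tau>. laplace_integrand ?g' c t1 \<tau> - laplace_integrand ?g' c t0 \<tau>)"
      using integral_unique[OF inner] by simp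
    also have "\<dots> = integral {-real n..real n} (laplace_integrand ?g' c t1) - integral {-real n..real n} (laplace_integrand ?g' c t0)"
      by (intro Henstock_Kurzweil_Integration.integral_diff integrable_continuous_real continuous_on_laplace_integrand2[OF G g(2)])
    finally show ?thesis .
  qed
  moreover have "(\<lambda>n. (1 / (2 * pi)) *\<^sub>R (integral {-real n..real n} (laplace_integrand ?g' c t1) - integral {-real n..real n} (laplace_integrand ?g' c t0)))
    \<longlonglongrightarrow> (1 / (2 * pi)) *\<^sub>R (integral UNIV (laplace_integrand ?g' c t1) - integral UNIV (laplace_integrand ?g' c t0))"
    by (intro tendsto_intros tendsto_integral_UNIV integrable_laplace_integrand[OF G g(2)])
  ultimately have "J = (1 / (2 * pi)) *\<^sub>R (integral UNIV (laplace_integrand ?g' c t1) - integral UNIV (laplace_integrand ?g' c t0))"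
    using LIMSEQ_unique[OF IJ] by presburger
  then show ?thesis using J by (simp add: G_def inv_laplace_def scaleR_diff_right)
qed

text \<open>Closing the vertical line by the left part of a large rectangle; the residue of \<open>exp (z t) / z\<^sup>2\<close>
  at \<open>0\<close> is \<open>t\<close>, and it enters through the jump of the logarithm.\<close>

lemma inverse_laplace_inverse_square:
  fixes t :: real
  assumes "t \<ge> 0" and c: "c > 0"
  shows "(\<lambda>n. integral {-real n..real n} (\<lambda>\<tau>. exp (Complex c \<tau> * of_real t) / (Complex c \<tau>)\<^sup>2)) \<longlonglongrightarrow> 2 * pi * of_real t"
proof -
  define \<phi> where "\<phi> z = exp (z * of_real t) / z\<^sup>2" for z :: complex
  define f0 where "f0 z = exp (z * of_real t)" for z :: complex
  define f1 where "f1 = (\<lambda>z. if z = 0 then deriv f0 0 else (f0 z - f0 0) / (z - 0))"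
  define q where "q = (\<lambda>z. if z = 0 then deriv f1 0 else (f1 z - f1 0) / (z - 0))"
  have "f0 holomorphic_on UNIV" unfolding f0_def by (intro holomorphic_intros)
  then have "f1 holomorphic_on UNIV" unfolding f1_def by (rule pole_lemma_open) simp
  then have "q holomorphic_on UNIV" unfolding q_def by (rule pole_lemma_open) simp
  then obtain Q where Q: "\<And>z. (Q has_field_derivative q z) (at z)"
    using holomorphic_convex_primitive'[OF convex_UNIV open_UNIV] by (metis UNIV_I)
  have d0: "deriv f0 0 = of_real t"
    unfolding f0_def by (rule DERIV_imp_deriv) (auto intro!: derivative_eq_intros)
  have q: "q z + 1 / z\<^sup>2 + of_real t / z = \<phi> z" if "z \<noteq> 0" for z
    using that by (simp add: q_def f1_def d0 f0_def \<phi>_def power2_eq_square field_simps)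
  define P1 where "P1 z = Q z - 1 / z + of_real t * Ln z" for z
  define P2 where "P2 z = Q z - 1 / z + of_real t * Ln (- z)" for z
  have inv: "((\<lambda>z. 1 / z) has_field_derivative - (1 / z\<^sup>2)) (at z)" if "z \<noteq> 0" for z :: complex
    using that by (auto intro!: derivative_eq_intros simp: power2_eq_square)
  have P1: "(P1 has_field_derivative \<phi> z) (at z)" if "Im z \<noteq> 0 \<or> Re z > 0" for z
  proof -
    have nz: "z \<noteq> 0" "z \<notin> \<real>\<^sub>\<le>\<^sub>0" using that by (auto simp: complex_nonpos_Reals_iff)
    have "(P1 has_field_derivative q z - - (1 / z\<^sup>2) + of_real t * inverse z) (at z)"
      unfolding P1_def by (intro DERIV_add DERIV_diff Q inv nz DERIV_cmult has_field_derivative_Ln)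
    then show ?thesis using q[OF nz(1)] by (simp add: divide_inverse)
  qed
  have P2: "(P2 has_field_derivative \<phi> z) (at z)" if "Im z \<noteq> 0 \<or> Re z < 0" for z
  proof -
    have nz: "z \<noteq> 0" "- z \<notin> \<real>\<^sub>\<le>\<^sub>0" using that by (auto simp: complex_nonpos_Reals_iff)
    have "((\<lambda>z. Ln (- z)) has_field_derivative (inverse (- z) * - 1)) (at z)"
      by (rule DERIV_chain2[where f = Ln and g = "\<lambda>z. - z", OF has_field_derivative_Ln[OF nz(2)]]) (auto intro!: derivative_eq_intros)
    then have "((\<lambda>z. Ln (- z)) has_field_derivative (inverse z)) (at z)" by simp
    then have "(P2 has_field_derivative q z - - (1 / z\<^sup>2) + of_real t * inverse z) (at z)"
      unfolding P2_def by (intro DERIV_add DERIV_diff Q inv nz DERIV_cmult)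
    then show ?thesis using q[OF nz(1)] by (simp add: divide_inverse)
  qed
  have Pn: "P1 (Complex (- real n) (real n)) = P2 (Complex (- real n) (real n)) + of_real t * (\<i> * pi)"
           "P1 (Complex (- real n) (- real n)) = P2 (Complex (- real n) (- real n)) - of_real t * (\<i> * pi)" if "n \<ge> 1" for n :: nat
  proof -
    have "Complex (- real n) (real n) \<noteq> 0" "Complex (- real n) (- real n) \<noteq> 0" using that by (auto simp: complex_eq_iff)
    then show "P1 (Complex (- real n) (real n)) = P2 (Complex (- real n) (real n)) + of_real t * (\<i> * pi)"
           "P1 (Complex (- real n) (- real n)) = P2 (Complex (- real n) (- real n)) - of_real t * (\<i> * pi)"
      using that unfolding P1_def P2_def by (simp_all add: Ln_minus algebra_simps)
  qed
  have \<phi>_le: "cmod (\<phi> z) \<le> exp (c * t) / (real n)\<^sup>2" if "real n \<le> cmod z" "Re z \<le> c" "n \<ge> 1" for z and n :: nat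
  proof -
    have "cmod (\<phi> z) = exp (Re z * t) / (cmod z)\<^sup>2" by (simp add: \<phi>_def norm_divide norm_power)
    also have "\<dots> \<le> exp (c * t) / (real n)\<^sup>2"
      using that assms(1) by (intro frac_le power_mono) (auto intro: mult_right_mono)
    finally show ?thesis .
  qed
  have edge: "cmod (P1 (Complex c y) - P1 (Complex (- real n) y)) \<le> exp (c * t) / (real n)\<^sup>2 * (c + real n)"
    if "\<bar>y\<bar> = real n" "n \<ge> 1" for y and n :: nat
  proof -
    have "cmod (P1 (Complex c y) - P1 (Complex (- real n) y)) \<le> exp (c * t) / (real n)\<^sup>2 * cmod (Complex c y - Complex (- real n) y)"
    proof (rule field_differentiable_bound[where S = "{z. Im z = y} \<inter> {z. Re z \<le> c}" and f' = \<phi>])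
      show "convex ({z. Im z = y} \<inter> {z. Re z \<le> c})"
        by (intro convex_Int convex_halfspace_Re_le convex_Im_eq)
      fix z assume z: "z \<in> {z. Im z = y} \<inter> {z. Re z \<le> c}"
      then have "Im z \<noteq> 0" using that by auto
      then show "(P1 has_field_derivative \<phi> z) (at z within {z. Im z = y} \<inter> {z. Re z \<le> c})"
        using P1 has_field_derivative_at_within by blast
      have "real n \<le> cmod z" using z that abs_Im_le_cmod[of z] by auto
      then show "cmod (\<phi> z) \<le> exp (c * t) / (real n)\<^sup>2" using z that by (intro \<phi>_le) auto
    qed (use c in auto)
    also have "Complex c y - Complex (- real n) y = of_real (c + real n)" by (simp add: complex_eq_iff)
    also have "cmod (of_real (c + real n)) = c + real n" unfolding norm_of_real using c by simp
    finally show ?thesis .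
  qed
  have left: "cmod (P2 (Complex (- real n) (real n)) - P2 (Complex (- real n) (- real n))) \<le> exp (c * t) / (real n)\<^sup>2 * (2 * real n)"
    if "n \<ge> 1" for n :: nat
  proof -
    have "cmod (P2 (Complex (- real n) (real n)) - P2 (Complex (- real n) (- real n)))
      \<le> exp (c * t) / (real n)\<^sup>2 * cmod (Complex (- real n) (real n) - Complex (- real n) (- real n))"
    proof (rule field_differentiable_bound[where S = "{z. Re z = - real n}" and f' = \<phi>])
      show "convex {z. Re z = - real n}" by (rule convex_Re_eq)
      fix z assume z: "z \<in> {z. Re z = - real n}"
      then have "Re z < 0" using that by auto
      then show "(P2 has_field_derivative \<phi> z) (at z within {z. Re z = - real n})"
        using P2 has_field_derivative_at_within by blast
      have "real n \<le> cmod z" using z that abs_Re_le_cmod[of z] by auto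
      then show "cmod (\<phi> z) \<le> exp (c * t) / (real n)\<^sup>2" using z c that by (intro \<phi>_le) auto
    qed auto
    also have "Complex (- real n) (real n) - Complex (- real n) (- real n) = of_real (2 * real n) * \<i>" by (simp add: complex_eq_iff)
    also have "cmod (of_real (2 * real n) * \<i>) = 2 * real n" unfolding norm_mult norm_of_real by simp
    finally show ?thesis .
  qed
  have int: "integral {-real n..real n} (\<lambda>\<tau>. \<phi> (Complex c \<tau>)) = (P1 (Complex c (real n)) - P1 (Complex c (- real n))) / \<i>" for n
    by (intro integral_unique integral_vertical_line[where \<omega> = 0] P1) (use c in auto)
  have "(\<lambda>n. integral {-real n..real n} (\<lambda>\<tau>. \<phi> (Complex c \<tau>)) - 2 * pi * of_real t) \<longlonglongrightarrow> 0"
  proof (rule Lim_null_comparison)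
    show "\<forall>\<^sub>F n in sequentially. cmod (integral {-real n..real n} (\<lambda>\<tau>. \<phi> (Complex c \<tau>)) - 2 * pi * of_real t)
       \<le> exp (c * t) / (real n)\<^sup>2 * (2 * c + 4 * real n)"
    proof (rule eventually_sequentiallyI[of 1])
      fix n :: nat assume n: "1 \<le> n"
      have arith: "x * (c + y) + x * (c + y) + x * (2 * y) = x * (2 * c + 4 * y)" for x y :: real
        by (simp add: algebra_simps)
      let ?a = "P1 (Complex c (real n))" and ?b = "P1 (Complex c (- real n))"
      let ?a' = "P1 (Complex (- real n) (real n))" and ?b' = "P1 (Complex (- real n) (- real n))"
      have "(?a - ?b) / \<i> - 2 * pi * of_real t = ((?a - ?a') - (?b - ?b') + (P2 (Complex (- real n) (real n)) - P2 (Complex (- real n) (- real n)))) / \<i>"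
        unfolding Pn[OF n] by (simp add: field_simps)
      then have "cmod (integral {-real n..real n} (\<lambda>\<tau>. \<phi> (Complex c \<tau>)) - 2 * pi * of_real t)
         = cmod ((?a - ?a') - (?b - ?b') + (P2 (Complex (- real n) (real n)) - P2 (Complex (- real n) (- real n))))"
        unfolding int by (simp add: norm_divide norm_mult)
      also have "\<dots> \<le> cmod (?a - ?a') + cmod (?b - ?b') + cmod (P2 (Complex (- real n) (real n)) - P2 (Complex (- real n) (- real n)))"
        by (intro norm_triangle_mono norm_triangle_ineq4 order_refl)
      also have "\<dots> \<le> exp (c * t) / (real n)\<^sup>2 * (c + real n) + exp (c * t) / (real n)\<^sup>2 * (c + real n) + exp (c * t) / (real n)\<^sup>2 * (2 * real n)"
        by (intro add_mono edge left) (use n in auto)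
      also have "\<dots> = exp (c * t) / (real n)\<^sup>2 * (2 * c + 4 * real n)" by (rule arith)
      finally show "cmod (integral {-real n..real n} (\<lambda>\<tau>. \<phi> (Complex c \<tau>)) - 2 * pi * of_real t)
       \<le> exp (c * t) / (real n)\<^sup>2 * (2 * c + 4 * real n)" .
    qed
    have "(\<lambda>n. exp (c * t) * (2 * c * (1 / real n) * (1 / real n) + 4 * (1 / real n))) \<longlonglongrightarrow> exp (c * t) * (2 * c * 0 * 0 + 4 * 0)"
      by (intro tendsto_mult tendsto_add lim_const_over_n tendsto_const)
    moreover have "\<forall>\<^sub>F n in sequentially. exp (c * t) * (2 * c * (1 / real n) * (1 / real n) + 4 * (1 / real n)) = exp (c * t) / (real n)\<^sup>2 * (2 * c + 4 * real n)"
      by (rule eventually_sequentiallyI[of 1]) (simp add: power2_eq_square field_simps)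
    ultimately show "(\<lambda>n. exp (c * t) / (real n)\<^sup>2 * (2 * c + 4 * real n)) \<longlonglongrightarrow> 0"
      using tendsto_cong by fastforce
  qed
  then show ?thesis unfolding \<phi>_def using Lim_null by blast
qed

lemma rhp_decay_inverse_square:
  fixes w :: "'a::banach \<times> 'a"
  shows "rhp_decay 0 (2 * norm w) (\<lambda>z. cscale (1 / z\<^sup>2) w)"
  unfolding rhp_decay_def
proof (intro conjI allI impI ballI order_refl)
  show "continuous_on (rhp 0) (\<lambda>z. cscale (1 / z\<^sup>2) w)"
    by (intro bounded_bilinear.continuous_on[OF bounded_bilinear_cscale] continuous_intros) auto
  show "norm (cscale (1 / z\<^sup>2) w) \<le> 2 * norm w / (cmod z)\<^sup>2" for z
    using norm_cscale_le[of "1 / z\<^sup>2" w] by (simp add: norm_divide norm_power mult.commute)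
  fix f :: "'a \<Rightarrow> real" assume "bounded_linear f"
  then have "(\<lambda>z. cfun f (cscale (1 / z\<^sup>2) w)) = (\<lambda>z. (1 / z\<^sup>2) * cfun f w)" by (simp add: cfun_cscale)
  then show "(\<lambda>z. cfun f (cscale (1 / z\<^sup>2) w)) holomorphic_on rhp 0"
    by (auto intro!: holomorphic_intros)
qed

lemma inv_laplace_inverse_square:
  fixes w :: "'a::banach \<times> 'a"
  assumes "t \<ge> 0" "c > 0"
  shows "inv_laplace (\<lambda>z. cscale (1 / z\<^sup>2) w) c t = t *\<^sub>R w"
proof (rule eq_if_cfun_eq)
  fix f :: "'a \<Rightarrow> real" assume f: "bounded_linear f"
  have eq: "integral S (\<lambda>\<tau>. exp (Complex c \<tau> * of_real t) * cfun f (cscale (1 / (Complex c \<tau>)\<^sup>2) w))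
      = integral S (\<lambda>\<tau>. exp (Complex c \<tau> * of_real t) / (Complex c \<tau>)\<^sup>2) * cfun f w" for S
    unfolding integral_mult_left[symmetric] by (simp add: cfun_cscale[OF f])
  have "(\<lambda>n. integral {-real n..real n} (\<lambda>\<tau>. exp (Complex c \<tau> * of_real t) * cfun f (cscale (1 / (Complex c \<tau>)\<^sup>2) w)))
      \<longlonglongrightarrow> 2 * pi * of_real t * cfun f w"
    unfolding eq by (intro tendsto_mult_right inverse_laplace_inverse_square[OF assms])
  from LIMSEQ_unique[OF cfun_inv_laplace_tendsto[OF rhp_decay_inverse_square[of w] assms(2) f, of t] this]
  have "(2 * pi) *\<^sub>R cfun f (inv_laplace (\<lambda>z. cscale (1 / z\<^sup>2) w) c t) = 2 * pi * of_real t * cfun f w" .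
  then have "(2 * pi) *\<^sub>R cfun f (inv_laplace (\<lambda>z. cscale (1 / z\<^sup>2) w) c t) = (2 * pi) *\<^sub>R (of_real t * cfun f w)"
    by (simp add: scaleR_conv_of_real)
  then show "cfun f (inv_laplace (\<lambda>z. cscale (1 / z\<^sup>2) w) c t) = cfun f (t *\<^sub>R w)"
    using bounded_linear.linear[OF bounded_linear_cfun[OF f]] by (simp add: linear_scale scaleR_conv_of_real)
qed

lemma inv_laplace_map:
  fixes g :: "complex \<Rightarrow> 'a \<times> 'a::banach" and f :: "'a \<times> 'a \<Rightarrow> 'b \<times> 'b::banach"
  assumes g: "rhp_decay \<omega> C g" "c > \<omega>" and f: "bounded_linear f" "\<And>z w. f (cscale z w) = cscale z (f w)"
  shows "inv_laplace (\<lambda>z. f (g z)) c t = f (inv_laplace g c t)"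
proof -
  have "integral UNIV (f \<circ> laplace_integrand g c t) = f (integral UNIV (laplace_integrand g c t))"
    by (rule integral_linear[OF integrable_laplace_integrand[OF g] f(1)])
  moreover have "f \<circ> laplace_integrand g c t = laplace_integrand (\<lambda>z. f (g z)) c t"
    by (auto simp: laplace_integrand_def f(2))
  ultimately show ?thesis using bounded_linear.linear[OF f(1)] by (simp add: inv_laplace_def linear_scale)
qed

lemma inv_laplace_add:
  fixes g h :: "complex \<Rightarrow> 'a \<times> 'a::banach"
  assumes "rhp_decay \<omega> C g" "rhp_decay \<omega> C' h" "c > \<omega>"
  shows "inv_laplace (\<lambda>z. g z + h z) c t = inv_laplace g c t + inv_laplace h c t"
proof -
  have "laplace_integrand (\<lambda>z. g z + h z) c t = (\<lambda>\<tau>. laplace_integrand g c t \<tau> + laplace_integrand h c t \<tau>)"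
    by (auto simp: laplace_integrand_def cscale_add_right)
  then show ?thesis
    by (simp add: inv_laplace_def Henstock_Kurzweil_Integration.integral_add scaleR_add_right
        integrable_laplace_integrand[OF assms(1,3)] integrable_laplace_integrand[OF assms(2,3)])
qed

lemma rhp_decay_mono:
  assumes "rhp_decay \<omega> C g" "\<omega> \<le> \<omega>'"
  shows "rhp_decay \<omega>' C g"
proof -
  have "rhp \<omega>' \<subseteq> rhp \<omega>" using assms(2) by auto
  then show ?thesis using assms unfolding rhp_decay_def
    by (auto intro: continuous_on_subset holomorphic_on_subset)
qed

lemma rhp_decay_add:
  assumes g: "rhp_decay \<omega> C g" and h: "rhp_decay \<omega> C' h"
  shows "rhp_decay \<omega> (C + C') (\<lambda>z. g z + h z)"
  unfolding rhp_decay_def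
proof (intro conjI allI impI ballI)
  show "0 \<le> \<omega>" using rhp_decay_nonneg[OF g] .
  have "continuous_on (rhp \<omega>) g" "continuous_on (rhp \<omega>) h" using g h by (simp_all add: rhp_decay_def)
  then show "continuous_on (rhp \<omega>) (\<lambda>z. g z + h z)" by (rule continuous_on_add)
  fix z assume "z \<in> rhp \<omega>"
  then have "norm (g z) \<le> C / (cmod z)\<^sup>2" "norm (h z) \<le> C' / (cmod z)\<^sup>2" using g h by (simp_all add: rhp_decay_def)
  then show "norm (g z + h z) \<le> (C + C') / (cmod z)\<^sup>2" unfolding add_divide_distrib by (rule norm_triangle_mono)
next
  fix f :: "'a \<Rightarrow> real" assume f: "bounded_linear f"
  have "(\<lambda>z. cfun f (g z) + cfun f (h z)) holomorphic_on rhp \<omega>"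
    using g h f by (intro holomorphic_on_add) (simp_all add: rhp_decay_def)
  moreover have "(\<lambda>z. cfun f (g z + h z)) = (\<lambda>z. cfun f (g z) + cfun f (h z))"
    by (rule ext) (rule linear_add[OF bounded_linear.linear[OF bounded_linear_cfun[OF f]]])
  ultimately show "(\<lambda>z. cfun f (g z + h z)) holomorphic_on rhp \<omega>" by (simp only:)
qed

lemma rhp_decay_divide:
  assumes g: "rhp_decay 0 C g"
  shows "rhp_decay (1/2) (4 * C) (\<lambda>z. cscale (1 / z) (g z))"
  unfolding rhp_decay_def
proof (intro conjI allI impI ballI)
  have g': "rhp_decay (1/2) C g" using rhp_decay_mono[OF g] by simp
  show "continuous_on (rhp (1/2)) (\<lambda>z. cscale (1 / z) (g z))"
    using g' unfolding rhp_decay_def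
    by (intro bounded_bilinear.continuous_on[OF bounded_bilinear_cscale] continuous_intros) auto
  fix z assume z: "z \<in> rhp (1/2)"
  then have gz: "norm (g z) \<le> C / (cmod z)\<^sup>2" using g' unfolding rhp_decay_def by blast
  have "1/2 \<le> cmod z" using z complex_Re_le_cmod[of z] by auto
  then have "inverse (cmod z) \<le> inverse (1/2)" by (intro le_imp_inverse_le) auto
  then have "cmod (1 / z) \<le> 2" by (simp add: norm_divide inverse_eq_divide)
  then have "cmod (1 / z) * norm (g z) * 2 \<le> 2 * (C / (cmod z)\<^sup>2) * 2"
    by (intro mult_right_mono mult_mono gz) auto
  then show "norm (cscale (1 / z) (g z)) \<le> 4 * C / (cmod z)\<^sup>2"
    using norm_cscale_le[of "1 / z" "g z"] by simp
next
  fix f :: "'a \<Rightarrow> real" assume f: "bounded_linear f"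
  have "(\<lambda>z. cfun f (g z)) holomorphic_on rhp (1/2)"
    using rhp_decay_mono[OF g, of "1/2"] f unfolding rhp_decay_def by simp
  then have "(\<lambda>z. (1 / z) * cfun f (g z)) holomorphic_on rhp (1/2)"
    by (intro holomorphic_intros) auto
  then show "(\<lambda>z. cfun f (cscale (1 / z) (g z))) holomorphic_on rhp (1/2)"
    by (simp add: cfun_cscale[OF f])
qed simp

subsection \<open>Generation of semigroups\<close>

lemma norm_fst_le_norm: "norm (fst w) \<le> norm w"
  by (cases w) (simp add: norm_fst_le)

locale closed_dense_operator =
  fixes D :: "'x::banach set" and B :: "'x \<Rightarrow> 'x"
  assumes closed_dense: "closed_densely_defined D B"
begin

lemma subspace_D: "subspace D"
  and B_add: "x \<in> D \<Longrightarrow> y \<in> D \<Longrightarrow> B (x + y) = B x + B y"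
  and B_scale: "x \<in> D \<Longrightarrow> B (c *\<^sub>R x) = c *\<^sub>R B x"
  and dense: "closure D = UNIV"
  and closed_graph: "closed {(x, B x) | x. x \<in> D}"
  using closed_dense by (auto simp: closed_densely_defined_def linear_on_subspace_def)

lemma D_0: "0 \<in> D" and D_add: "x \<in> D \<Longrightarrow> y \<in> D \<Longrightarrow> x + y \<in> D" and D_scale: "x \<in> D \<Longrightarrow> c *\<^sub>R x \<in> D"
  and D_diff: "x \<in> D \<Longrightarrow> y \<in> D \<Longrightarrow> x - y \<in> D"
  using subspace_D by (auto simp: subspace_0 subspace_add subspace_scale subspace_diff)

lemma B_0: "B 0 = 0"
  using B_scale[OF D_0, of 0] by simp

lemma B_diff: "x \<in> D \<Longrightarrow> y \<in> D \<Longrightarrow> B (x - y) = B x - B y"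
  using B_add[of "x - y" y] by (simp add: D_diff)

lemma closed_graph_tendsto:
  assumes "F \<noteq> bot" "(f \<longlongrightarrow> x) F" "((\<lambda>t. B (f t)) \<longlongrightarrow> y) F" "\<forall>\<^sub>F t in F. f t \<in> D"
  shows "x \<in> D \<and> B x = y"
proof -
  have "((\<lambda>t. (f t, B (f t))) \<longlongrightarrow> (x, y)) F" using assms(2,3) by (rule tendsto_Pair)
  moreover have "\<forall>\<^sub>F t in F. (f t, B (f t)) \<in> {(x, B x) | x. x \<in> D}" using assms(4) by (auto elim: eventually_mono)
  ultimately have "(x, y) \<in> {(x, B x) | x. x \<in> D}" by (intro Lim_in_closed_set[OF closed_graph _ assms(1)])
  then show ?thesis by auto
qed

end

locale vertical_resolvent = closed_dense_operator D B for D :: "'x::banach set" and B :: "'x \<Rightarrow> 'x" +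
  fixes K :: real
  assumes K_nonneg: "0 \<le> K" and res: "0 < Re z \<Longrightarrow> - z \<in> resolvent_set UNIV D B"
    and res_bound: "0 < Re z \<Longrightarrow> w \<in> D \<times> D \<Longrightarrow> norm w * cmod z \<le> K * norm (cshift B (- z) w)"
begin

definition BB :: "'x \<times> 'x \<Rightarrow> 'x \<times> 'x" where "BB w = (B (fst w), B (snd w))"

definition zB :: "complex \<Rightarrow> 'x \<times> 'x \<Rightarrow> 'x \<times> 'x" where "zB z w = cscale z w + BB w"

definition R :: "complex \<Rightarrow> 'x \<times> 'x \<Rightarrow> 'x \<times> 'x" where "R z = inv_into (D \<times> D) (zB z)"

lemma zB_eq: "zB z w = - cshift B (- z) w"
  by (cases w) (simp add: zB_def BB_def cshift_def cscale_def)

lemma bij_zB: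
  assumes "0 < Re z"
  shows "bij_betw (zB z) (D \<times> D) UNIV"
proof -
  have "bij_betw (cshift B (- z)) (D \<times> D) UNIV"
    using res[OF assms] by (simp add: resolvent_set_def)
  moreover have "bij_betw uminus UNIV (UNIV :: ('x \<times> 'x) set)" by (rule bij_uminus)
  ultimately have "bij_betw (uminus \<circ> cshift B (- z)) (D \<times> D) UNIV" by (rule bij_betw_trans)
  moreover have "uminus \<circ> cshift B (- z) = zB z" by (auto simp: zB_eq)
  ultimately show ?thesis by (simp only:)
qed

lemma R_in: "0 < Re z \<Longrightarrow> R z v \<in> D \<times> D"
  and zB_R: "0 < Re z \<Longrightarrow> zB z (R z v) = v"
  and R_zB: "0 < Re z \<Longrightarrow> w \<in> D \<times> D \<Longrightarrow> R z (zB z w) = w"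
  using bij_zB[of z] unfolding R_def
  by (auto simp: bij_betw_def f_inv_into_f inv_into_f_f intro: inv_into_into)

lemma R_eqI: "0 < Re z \<Longrightarrow> w \<in> D \<times> D \<Longrightarrow> zB z w = v \<Longrightarrow> R z v = w"
  using R_zB by blast

lemma DD_add: "v \<in> D \<times> D \<Longrightarrow> w \<in> D \<times> D \<Longrightarrow> v + w \<in> D \<times> D"
  and DD_cscale: "v \<in> D \<times> D \<Longrightarrow> cscale z v \<in> D \<times> D"
  by (auto simp: cscale_def D_add D_diff D_scale)

lemma zB_add: "v \<in> D \<times> D \<Longrightarrow> w \<in> D \<times> D \<Longrightarrow> zB z (v + w) = zB z v + zB z w"
  by (auto simp: zB_def BB_def cscale_add_right B_add)

lemma zB_cscale: "v \<in> D \<times> D \<Longrightarrow> zB z (cscale c v) = cscale c (zB z v)"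
  by (auto simp: zB_def BB_def cscale_add_right cscale_cscale mult.commute[of z])
    (auto simp: cscale_def B_add B_diff B_scale D_scale D_add D_diff)

lemma R_add: "0 < Re z \<Longrightarrow> R z (v + w) = R z v + R z w"
  by (rule R_eqI) (auto simp: zB_R zB_add DD_add R_in)

lemma R_cscale: "0 < Re z \<Longrightarrow> R z (cscale c v) = cscale c (R z v)"
  by (rule R_eqI) (simp_all add: zB_R zB_cscale[OF R_in] DD_cscale[OF R_in] del: mem_Times_iff)

lemma R_scaleR: "0 < Re z \<Longrightarrow> R z (r *\<^sub>R v) = r *\<^sub>R R z v"
  using R_cscale[of z "of_real r" v] by (simp add: cscale_of_real)

lemma R_diff: "0 < Re z \<Longrightarrow> R z (v - w) = R z v - R z w"
  using R_add[of z v "- w"] R_scaleR[of z "-1" w] by simp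

lemma norm_R_le: "0 < Re z \<Longrightarrow> norm (R z v) \<le> K / cmod z * norm v"
proof -
  assume z: "0 < Re z"
  have "norm (cshift B (- z) (R z v)) = norm v" using zB_R[OF z, of v] zB_eq[of z "R z v"] by (metis norm_minus_cancel)
  then have "norm (R z v) * cmod z \<le> K * norm v" using res_bound[OF z R_in[OF z], of v] by simp
  moreover have "cmod z > 0" using z by auto
  ultimately show ?thesis by (simp add: field_simps)
qed

lemma R_resolvent_identity:
  assumes "0 < Re z" "0 < Re y"
  shows "R y v - R z v = cscale (z - y) (R z (R y v))"
proof -
  have "zB z (R y v) = v + cscale (z - y) (R y v)"
    using zB_R[OF assms(2), of v] by (simp add: zB_def cscale_diff_left eq_diff_eq add.commute)
  from arg_cong[OF this, of "R z"] have "R y v = R z v + cscale (z - y) (R z (R y v))"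
    by (simp only: R_zB[OF assms(1) R_in[OF assms(2)]] R_add[OF assms(1)] R_cscale[OF assms(1)])
  then show ?thesis by (metis add_diff_cancel_left')
qed

lemma R_commute:
  assumes "0 < Re z" "0 < Re y"
  shows "R z (R y v) = R y (R z v)"
proof (cases "z = y")
  case False
  have "cscale (z - y) (R z (R y v)) = - cscale (y - z) (R y (R z v))"
    using R_resolvent_identity[OF assms, of v] R_resolvent_identity[OF assms(2,1), of v] by (metis minus_diff_eq)
  also have "\<dots> = cscale (z - y) (R y (R z v))" by (simp add: cscale_diff_left)
  finally have "cscale (1 / (z - y)) (cscale (z - y) (R z (R y v))) = cscale (1 / (z - y)) (cscale (z - y) (R y (R z v)))" by simp
  then show ?thesis using False by (simp add: cscale_cscale)
qed simp

lemma bounded_linear_R: "0 < Re z \<Longrightarrow> bounded_linear (R z)"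
  using norm_R_le[of z] by (intro bounded_linear_intro[where K = "K / cmod z"]) (auto simp: R_add R_scaleR mult.commute)

lemma R_tendsto:
  assumes z: "0 < Re z"
  shows "((\<lambda>y. R y v) \<longlongrightarrow> R z v) (at z)"
proof -
  have "((\<lambda>y. R y v - R z v) \<longlongrightarrow> 0) (at z)"
  proof (rule Lim_null_comparison)
    have ev: "\<forall>\<^sub>F y in at z. 0 < Re y"
      by (rule order_tendstoD(1)[OF tendsto_Re[OF tendsto_ident_at] z])
    then show "\<forall>\<^sub>F y in at z. norm (R y v - R z v) \<le> cmod (y - z) * (K / cmod y * norm (R z v)) * 2"
    proof (rule eventually_mono)
      fix y assume y: "0 < Re y"
      have "R z v - R y v = cscale (y - z) (R y (R z v))" by (rule R_resolvent_identity[OF y z])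
      then have "norm (R y v - R z v) = norm (cscale (y - z) (R y (R z v)))" by (metis norm_minus_commute)
      also have "\<dots> \<le> cmod (y - z) * norm (R y (R z v)) * 2" by (rule norm_cscale_le)
      also have "\<dots> \<le> cmod (y - z) * (K / cmod y * norm (R z v)) * 2"
        using norm_R_le[OF y] by (intro mult_right_mono mult_left_mono) auto
      finally show "norm (R y v - R z v) \<le> cmod (y - z) * (K / cmod y * norm (R z v)) * 2" .
    qed
    have "((\<lambda>y. cmod (y - z) * (K / cmod y * norm (R z v)) * 2) \<longlongrightarrow> cmod (z - z) * (K / cmod z * norm (R z v)) * 2) (at z)"
      using z by (intro tendsto_intros) auto
    then show "((\<lambda>y. cmod (y - z) * (K / cmod y * norm (R z v)) * 2) \<longlongrightarrow> 0) (at z)" by simp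
  qed
  then show ?thesis using Lim_null by blast
qed

lemma continuous_on_R: "continuous_on (rhp 0) (\<lambda>z. R z v)"
  using R_tendsto by (intro continuous_at_imp_continuous_on) (auto simp: isCont_def)

lemma R2_tendsto:
  assumes z: "0 < Re z"
  shows "((\<lambda>y. R y (R y v)) \<longlongrightarrow> R z (R z v)) (at z)"
proof -
  have "((\<lambda>y. R y (R y v - R z v)) \<longlongrightarrow> 0) (at z)"
  proof (rule Lim_null_comparison)
    have ev: "\<forall>\<^sub>F y in at z. 0 < Re y"
      by (rule order_tendstoD(1)[OF tendsto_Re[OF tendsto_ident_at] z])
    then show "\<forall>\<^sub>F y in at z. norm (R y (R y v - R z v)) \<le> K / cmod y * norm (R y v - R z v)"
      by (rule eventually_mono) (rule norm_R_le)
    have "((\<lambda>y. K / cmod y * norm (R y v - R z v)) \<longlongrightarrow> K / cmod z * norm (R z v - R z v)) (at z)"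
      using z by (intro tendsto_intros R_tendsto) auto
    then show "((\<lambda>y. K / cmod y * norm (R y v - R z v)) \<longlongrightarrow> 0) (at z)" by simp
  qed
  from tendsto_add[OF this R_tendsto[OF z, of "R z v"]]
  have "((\<lambda>y. R y (R y v - R z v) + R y (R z v)) \<longlongrightarrow> R z (R z v)) (at z)" by simp
  moreover have "\<forall>\<^sub>F y in at z. R y (R y v - R z v) + R y (R z v) = R y (R y v)"
    using order_tendstoD(1)[OF tendsto_Re[OF tendsto_ident_at] z] by (rule eventually_mono) (simp add: R_diff)
  ultimately show ?thesis by (rule Lim_transform_eventually)
qed

lemma cfun_R_derivative:
  assumes f: "bounded_linear f" and z: "0 < Re z"
  shows "((\<lambda>y. cfun f (R y v)) has_field_derivative - cfun f (R z (R z v))) (at z)"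
proof -
  have "((\<lambda>y. - cfun f (R y (R z v))) \<longlongrightarrow> - cfun f (R z (R z v))) (at z)"
    by (intro tendsto_minus bounded_linear.tendsto[OF bounded_linear_cfun[OF f]] R_tendsto z)
  moreover have "\<forall>\<^sub>F y in at z. - cfun f (R y (R z v)) = (cfun f (R y v) - cfun f (R z v)) / (y - z)"
  proof -
    have "\<forall>\<^sub>F y in at z. y \<noteq> z" by (simp add: eventually_at_filter)
    with order_tendstoD(1)[OF tendsto_Re[OF tendsto_ident_at] z] show ?thesis
    proof eventually_elim
      case (elim y)
      have "cfun f (R z v) - cfun f (R y v) = cfun f (R z v - R y v)"
        by (rule linear_diff[OF bounded_linear.linear[OF bounded_linear_cfun[OF f]], symmetric])
      also have "\<dots> = (y - z) * cfun f (R y (R z v))"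
        unfolding R_resolvent_identity[OF elim(1) z] by (rule cfun_cscale[OF f])
      finally show ?case using elim(2) by (simp add: field_simps)
    qed
  qed
  ultimately have "((\<lambda>y. (cfun f (R y v) - cfun f (R z v)) / (y - z)) \<longlongrightarrow> - cfun f (R z (R z v))) (at z)"
    by (rule Lim_transform_eventually)
  then show ?thesis by (simp add: has_field_derivative_iff)
qed

lemma open_rhp: "open (rhp \<omega>)"
  using open_halfspace_Re_gt[of \<omega>] by simp

lemma holomorphic_cfun_R: "bounded_linear f \<Longrightarrow> (\<lambda>z. cfun f (R z v)) holomorphic_on rhp 0"
  unfolding holomorphic_on_open[OF open_rhp] using cfun_R_derivative by blast

definition g1 :: "'x \<times> 'x \<Rightarrow> complex \<Rightarrow> 'x \<times> 'x" where "g1 v z = R z (R z v)"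

definition g2 :: "'x \<times> 'x \<Rightarrow> complex \<Rightarrow> 'x \<times> 'x" where "g2 v z = cscale (1 / z) (R z v)"

definition G :: "'x \<times> 'x \<Rightarrow> complex \<Rightarrow> 'x \<times> 'x" where "G v z = cscale (1 / z) (g1 v z + g2 v z)"

lemma decay_g1: "rhp_decay 0 (K\<^sup>2 * norm v) (g1 v)"
  unfolding rhp_decay_def
proof (intro conjI allI impI ballI order_refl)
  show "continuous_on (rhp 0) (g1 v)"
    unfolding g1_def using R2_tendsto by (intro continuous_at_imp_continuous_on) (auto simp: isCont_def)
  fix z assume "z \<in> rhp 0"
  then have z: "0 < Re z" by simp
  have "norm (g1 v z) \<le> K / cmod z * norm (R z v)" unfolding g1_def by (rule norm_R_le[OF z])
  also have "\<dots> \<le> K / cmod z * (K / cmod z * norm v)" using norm_R_le[OF z] K_nonneg by (intro mult_left_mono) auto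
  finally show "norm (g1 v z) \<le> K\<^sup>2 * norm v / (cmod z)\<^sup>2" by (simp add: power2_eq_square)
next
  fix f :: "'x \<Rightarrow> real" assume f: "bounded_linear f"
  have "(\<lambda>z. - deriv (\<lambda>z. cfun f (R z v)) z) holomorphic_on rhp 0"
    by (intro holomorphic_intros holomorphic_cfun_R f open_rhp)
  moreover have "- deriv (\<lambda>z. cfun f (R z v)) z = cfun f (g1 v z)" if "z \<in> rhp 0" for z
    using DERIV_imp_deriv[OF cfun_R_derivative[OF f, of z v]] that by (simp add: g1_def)
  ultimately show "(\<lambda>z. cfun f (g1 v z)) holomorphic_on rhp 0" by (rule holomorphic_transform)
qed

lemma decay_g2: "rhp_decay 0 (2 * K * norm v) (g2 v)"
  unfolding rhp_decay_def
proof (intro conjI allI impI ballI order_refl)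
  show "continuous_on (rhp 0) (g2 v)"
    unfolding g2_def by (intro bounded_bilinear.continuous_on[OF bounded_bilinear_cscale] continuous_intros continuous_on_R) auto
  fix z assume "z \<in> rhp 0"
  then have z: "0 < Re z" by simp
  have "norm (g2 v z) \<le> cmod (1 / z) * norm (R z v) * 2" unfolding g2_def by (rule norm_cscale_le)
  also have "\<dots> \<le> cmod (1 / z) * (K / cmod z * norm v) * 2" using norm_R_le[OF z] by (intro mult_right_mono mult_left_mono) auto
  finally show "norm (g2 v z) \<le> 2 * K * norm v / (cmod z)\<^sup>2" by (simp add: power2_eq_square norm_divide mult_ac)
next
  fix f :: "'x \<Rightarrow> real" assume f: "bounded_linear f"
  have "(\<lambda>z. (1 / z) * cfun f (R z v)) holomorphic_on rhp 0"
    by (intro holomorphic_intros holomorphic_cfun_R f) auto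
  then show "(\<lambda>z. cfun f (g2 v z)) holomorphic_on rhp 0" by (simp add: g2_def cfun_cscale[OF f])
qed

lemma decay_g12: "rhp_decay 0 (K\<^sup>2 * norm v + 2 * K * norm v) (\<lambda>z. g1 v z + g2 v z)"
  by (rule rhp_decay_add[OF decay_g1 decay_g2])

lemma decay_G: "rhp_decay (1/2) (4 * (K\<^sup>2 * norm v + 2 * K * norm v)) (G v)"
  unfolding G_def by (rule rhp_decay_divide[OF decay_g12])

lemma inv_laplace_g2: "t *\<^sub>R inv_laplace (g2 v) 1 t = inv_laplace (G v) 1 t"
proof -
  have neg: "rhp_decay (1/2) (4 * (K\<^sup>2 * norm v + 2 * K * norm v)) (\<lambda>z. - G v z)"
  proof -
    have "cfun f (- w) = - cfun f w" if "bounded_linear f" for f :: "'x \<Rightarrow> real" and w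
      by (rule linear_neg[OF bounded_linear.linear[OF bounded_linear_cfun[OF that]]])
    then show ?thesis using decay_G[of v] unfolding rhp_decay_def
      by (auto intro!: continuous_on_minus holomorphic_on_minus)
  qed
  have "t *\<^sub>R inv_laplace (g2 v) 1 t = - inv_laplace (\<lambda>z. - G v z) 1 t"
  proof (rule inv_laplace_times[OF _ neg])
    show "rhp_decay (1/2) (2 * K * norm v) (g2 v)" by (rule rhp_decay_mono[OF decay_g2]) simp
    fix f :: "'x \<Rightarrow> real" and z assume f: "bounded_linear f" and "z \<in> rhp (1/2)"
    then have z: "0 < Re z" by simp
    then have nz: "z \<noteq> 0" by auto
    have "((\<lambda>z. (1 / z) * cfun f (R z v)) has_field_derivative (- (1 / z\<^sup>2) * cfun f (R z v) + - cfun f (R z (R z v)) * (1 / z))) (at z)"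
    proof (rule DERIV_mult)
      show "((\<lambda>z. 1 / z) has_field_derivative - (1 / z\<^sup>2)) (at z)"
        using nz by (auto intro!: derivative_eq_intros simp: power2_eq_square)
    qed (rule cfun_R_derivative[OF f z])
    moreover have "cfun f (- G v z) = - (1 / z\<^sup>2) * cfun f (R z v) + - cfun f (R z (R z v)) * (1 / z)"
    proof -
      note L = bounded_linear.linear[OF bounded_linear_cfun[OF f]]
      have "cfun f (- G v z) = - ((1 / z) * (cfun f (g1 v z) + cfun f (g2 v z)))"
        unfolding G_def linear_neg[OF L] cfun_cscale[OF f] linear_add[OF L] ..
      then show ?thesis by (simp add: g1_def g2_def cfun_cscale[OF f] power2_eq_square algebra_simps)
    qed
    ultimately show "((\<lambda>z. cfun f (g2 v z)) has_field_derivative cfun f (- G v z)) (at z)"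
      by (simp add: g2_def cfun_cscale[OF f])
  qed simp
  also have "inv_laplace (\<lambda>z. - G v z) 1 t = - inv_laplace (G v) 1 t"
    using inv_laplace_map[OF decay_G, where f = uminus and c = 1] by (simp add: cscale_def bounded_linear_minus[OF bounded_linear_ident])
  finally show ?thesis by simp
qed

definition V :: "real \<Rightarrow> 'x \<times> 'x \<Rightarrow> 'x \<times> 'x" where "V t v = inv_laplace (g1 v) 1 t"

definition U :: "real \<Rightarrow> 'x \<times> 'x \<Rightarrow> 'x \<times> 'x" where "U t v = inv_laplace (g2 v) 1 t"

lemma U_derivative:
  assumes "t > 0"
  shows "((\<lambda>t. U t v) has_vector_derivative (1 / t) *\<^sub>R V t v) (at t)"
proof -
  let ?Y = "\<lambda>t. inv_laplace (G v) 1 t" and ?g = "\<lambda>z. g1 v z + g2 v z"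
  have g: "rhp_decay (1/2) (K\<^sup>2 * norm v + 2 * K * norm v) ?g" by (rule rhp_decay_mono[OF decay_g12]) simp
  have Y: "integral {t/2..s} (inv_laplace ?g 1) = ?Y s - ?Y (t/2)" if "t/2 \<le> s" for s
    using integral_unique[OF has_integral_inv_laplace[OF g _ decay_G[unfolded G_def] that]] by (simp add: G_def[abs_def])
  have VU: "inv_laplace ?g 1 s = V s v + U s v" for s
    unfolding V_def U_def by (rule inv_laplace_add[OF decay_g1 decay_g2]) simp
  have "((\<lambda>s. integral {t/2..s} (inv_laplace ?g 1)) has_vector_derivative inv_laplace ?g 1 t) (at t within {t/2..2*t})"
    by (rule integral_has_vector_derivative) (use assms continuous_on_inv_laplace[OF g] in auto)
  moreover have "at t within {t/2..2*t} = at t" by (rule at_within_interior) (use assms in \<open>simp add: interior_atLeastAtMost_real\<close>)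
  ultimately have I: "((\<lambda>s. integral {t/2..s} (inv_laplace ?g 1)) has_vector_derivative V t v + U t v) (at t)" by (simp add: VU)
  have "((\<lambda>s. integral {t/2..s} (inv_laplace ?g 1) + ?Y (t/2)) has_vector_derivative (V t v + U t v) + 0) (at t)"
    by (intro has_vector_derivative_add I has_vector_derivative_const)
  then have YD: "(?Y has_vector_derivative (V t v + U t v)) (at t)"
    unfolding add_0_right
    by (rule has_vector_derivative_transform_within_open[of _ _ _ "{t/2<..}"]) (use assms Y in auto)
  have "((\<lambda>s. (1 / s) *\<^sub>R ?Y s) has_vector_derivative ((1 / t) *\<^sub>R (V t v + U t v) + (- (1 / t\<^sup>2)) *\<^sub>R ?Y t)) (at t)"
    using assms by (intro has_vector_derivative_scaleR YD) (auto intro!: derivative_eq_intros simp: power2_eq_square)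
  moreover have "(1 / t) *\<^sub>R (V t v + U t v) + (- (1 / t\<^sup>2)) *\<^sub>R ?Y t = (1 / t) *\<^sub>R V t v"
    unfolding inv_laplace_g2[symmetric] using assms by (simp add: U_def power2_eq_square scaleR_add_right)
  ultimately have "((\<lambda>s. (1 / s) *\<^sub>R ?Y s) has_vector_derivative (1 / t) *\<^sub>R V t v) (at t)" by simp
  then show ?thesis
    by (rule has_vector_derivative_transform_within_open[of _ _ _ "{0<..}"])
      (use assms in \<open>auto simp: inv_laplace_g2[symmetric] U_def\<close>)
qed

lemma V_eq:
  assumes "v \<in> D \<times> D" "t \<ge> 0"
  shows "V t v = t *\<^sub>R v - t *\<^sub>R U t (BB v)"
proof -
  have eq: "g1 v z = cscale (1 / z\<^sup>2) v + (- G (BB v) z)" if z: "0 < Re z" for z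
  proof -
    have nz: "z \<noteq> 0" using z by auto
    have "cscale z v + BB v = zB z v" by (simp add: zB_def)
    then have "R z (cscale z v) = v - R z (BB v)"
      using R_zB[OF z assms(1)] R_add[OF z] by (metis add_diff_cancel_right')
    then have "cscale (1 / z) (cscale z (R z v)) = cscale (1 / z) (v - R z (BB v))" by (simp add: R_cscale[OF z])
    then have 1: "R z v = cscale (1 / z) v - cscale (1 / z) (R z (BB v))"
      using nz by (simp add: cscale_cscale cscale_diff_right)
    then have "g1 v z = cscale (1 / z) (R z v) - cscale (1 / z) (R z (R z (BB v)))"
      unfolding g1_def by (metis R_cscale[OF z] R_diff[OF z])
    then show ?thesis unfolding 1
      by (simp add: G_def g1_def g2_def cscale_diff_right cscale_add_right cscale_cscale power2_eq_square)
  qed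
  let ?w = "\<lambda>z. cscale (1 / z\<^sup>2) v"
  have w: "rhp_decay (1/2) (2 * norm v) ?w" by (rule rhp_decay_mono[OF rhp_decay_inverse_square]) simp
  have G: "rhp_decay (1/2) (K\<^sup>2 * norm v + 2 * norm v) (\<lambda>z. g1 v z + (- ?w z))"
  proof (rule rhp_decay_add)
    show "rhp_decay (1/2) (K\<^sup>2 * norm v) (g1 v)" by (rule rhp_decay_mono[OF decay_g1]) simp
    have "rhp_decay (1/2) (2 * norm (- v)) (\<lambda>z. cscale (1 / z\<^sup>2) (- v))" by (rule rhp_decay_mono[OF rhp_decay_inverse_square]) simp
    then show "rhp_decay (1/2) (2 * norm v) (\<lambda>z. - ?w z)" by (simp add: cscale_def)
  qed
  have "inv_laplace (\<lambda>z. g1 v z + G (BB v) z) 1 t = inv_laplace ?w 1 t"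
    unfolding inv_laplace_def by (rule arg_cong[where f = "\<lambda>x. _ *\<^sub>R integral UNIV x"]) (auto simp: laplace_integrand_def eq)
  moreover have "inv_laplace (\<lambda>z. g1 v z + G (BB v) z) 1 t = V t v + inv_laplace (G (BB v)) 1 t"
    unfolding V_def by (rule inv_laplace_add[OF rhp_decay_mono[OF decay_g1] decay_G]) auto
  moreover have "inv_laplace ?w 1 t = t *\<^sub>R v" by (rule inv_laplace_inverse_square[OF assms(2)]) simp
  ultimately show ?thesis by (simp add: inv_laplace_g2 U_def eq_diff_eq)
qed

lemma norm_V_le:
  assumes "t > 0"
  shows "norm (V t v) \<le> t * (K\<^sup>2 * exp 1) * norm v"
proof -
  have "V t v = inv_laplace (g1 v) (1 / t) t"
    unfolding V_def using assms by (intro inv_laplace_line_independent[OF decay_g1]) auto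
  also have "norm \<dots> \<le> (K\<^sup>2 * norm v) * exp ((1 / t) * t) / (1 / t)"
    by (rule norm_inv_laplace_le[OF decay_g1]) (use assms in simp)
  finally show ?thesis using assms by (simp add: mult_ac)
qed

lemma norm_U_le:
  assumes "t > 0"
  shows "norm (U t v) \<le> t * (2 * K * exp 1) * norm v"
proof -
  have "U t v = inv_laplace (g2 v) (1 / t) t"
    unfolding U_def using assms by (intro inv_laplace_line_independent[OF decay_g2]) auto
  also have "norm \<dots> \<le> (2 * K * norm v) * exp ((1 / t) * t) / (1 / t)"
    by (rule norm_inv_laplace_le[OF decay_g2]) (use assms in simp)
  finally show ?thesis using assms by (simp add: mult_ac)
qed

lemma V_add: "V t (v + w) = V t v + V t w"
proof -
  have "V t (v + w) = inv_laplace (\<lambda>z. g1 v z + g1 w z) 1 t"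
    unfolding V_def inv_laplace_def
    by (rule arg_cong[where f = "\<lambda>x. _ *\<^sub>R integral UNIV x"]) (auto simp: laplace_integrand_def g1_def R_add)
  also have "\<dots> = V t v + V t w" unfolding V_def by (rule inv_laplace_add[OF decay_g1 decay_g1]) simp
  finally show ?thesis .
qed

lemma V_scaleR: "V t (r *\<^sub>R v) = r *\<^sub>R V t v"
proof -
  have "V t (r *\<^sub>R v) = inv_laplace (\<lambda>z. r *\<^sub>R g1 v z) 1 t"
    unfolding V_def inv_laplace_def
    by (rule arg_cong[where f = "\<lambda>x. _ *\<^sub>R integral UNIV x"]) (auto simp: laplace_integrand_def g1_def R_scaleR)
  also have "\<dots> = r *\<^sub>R V t v" unfolding V_def
    by (rule inv_laplace_map[OF decay_g1]) (auto simp: bounded_linear_scaleR_right cscale_def algebra_simps)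
  finally show ?thesis .
qed

lemma V_R: "V t (R 1 v) = R 1 (V t v)"
proof -
  have "V t (R 1 v) = inv_laplace (\<lambda>z. R 1 (g1 v z)) 1 t"
    unfolding V_def inv_laplace_def
    by (rule arg_cong[where f = "\<lambda>x. _ *\<^sub>R integral UNIV x"]) (auto simp: laplace_integrand_def g1_def R_commute[of _ 1])
  also have "\<dots> = R 1 (V t v)" unfolding V_def
    by (rule inv_laplace_map[OF decay_g1]) (auto simp: bounded_linear_R R_cscale)
  finally show ?thesis .
qed

lemma R_fst: "R 1 (fst w, 0) = (fst (R 1 w), 0)"
proof (rule R_eqI)
  have "fst (zB 1 (R 1 w)) = fst w" using zB_R[of 1 w] by simp
  then show "zB 1 (fst (R 1 w), 0) = (fst w, 0)" by (simp add: zB_def BB_def B_0)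
  show "(fst (R 1 w), 0) \<in> D \<times> D" using R_in[of 1 w] by (auto simp: D_0 mem_Times_iff)
qed simp

definition S :: "real \<Rightarrow> 'x \<Rightarrow> 'x" where "S t x = (if t = 0 then x else (1 / t) *\<^sub>R fst (V t (x, 0)))"

lemma S_add: "S t (x + y) = S t x + S t y"
  using V_add[of t "(x, 0)" "(y, 0)"] by (simp add: S_def scaleR_add_right)

lemma S_scaleR: "S t (r *\<^sub>R x) = r *\<^sub>R S t x"
  using V_scaleR[of t r "(x, 0)"] by (simp add: S_def)

lemma norm_S_le: "t \<ge> 0 \<Longrightarrow> norm (S t x) \<le> max 1 (K\<^sup>2 * exp 1) * norm x"
proof (cases "t = 0")
  case True
  then show ?thesis using mult_right_mono[of 1 "max 1 (K\<^sup>2 * exp 1)" "norm x"] by (simp add: S_def)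
next
  case False
  assume "t \<ge> 0"
  then have t: "t > 0" using False by simp
  have "norm (S t x) = (1 / t) * norm (fst (V t (x, 0)))" using t by (simp add: S_def)
  also have "\<dots> \<le> (1 / t) * norm (V t (x, 0))" using t by (intro mult_left_mono norm_fst_le_norm) auto
  also have "\<dots> \<le> (1 / t) * (t * (K\<^sup>2 * exp 1) * norm (x, 0::'x))" using t norm_V_le[OF t, of "(x, 0)"] by (intro mult_left_mono) auto
  also have "\<dots> = (K\<^sup>2 * exp 1) * norm x" using t by (simp add: norm_prod_def)
  also have "\<dots> \<le> max 1 (K\<^sup>2 * exp 1) * norm x" by (intro mult_right_mono) auto
  finally show ?thesis .
qed

definition r :: "'x \<Rightarrow> 'x" where "r x = fst (R 1 (x, 0))"

lemma R_1: "R 1 (x, 0) = (r x, 0)"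
  using R_fst[of "(x, 0)"] by (simp add: r_def)

lemma r_in: "r x \<in> D"
  using R_in[of 1 "(x, 0)"] by (auto simp: r_def mem_Times_iff)

lemma r_eq: "1 *\<^sub>R r x + B (r x) = x"
  using zB_R[of 1 "(x, 0)"] by (simp add: r_def zB_def BB_def prod_eq_iff)

lemma bounded_linear_r: "bounded_linear r"
proof -
  have "bounded_linear (\<lambda>x. fst (R 1 (x, 0)))"
    by (intro bounded_linear_compose[OF bounded_linear_fst] bounded_linear_compose[OF bounded_linear_R]
        bounded_linear_Pair bounded_linear_ident bounded_linear_zero) simp
  then show ?thesis by (simp add: r_def[abs_def])
qed

lemma S_r: "S t (r x) = r (S t x)"
proof (cases "t = 0")
  case False
  have "r (S t x) = (1 / t) *\<^sub>R r (fst (V t (x, 0)))"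
    using False linear_scale[OF bounded_linear.linear[OF bounded_linear_r]] by (simp add: S_def)
  also have "r (fst (V t (x, 0))) = fst (R 1 (V t (x, 0)))" by (simp add: r_def R_fst)
  also have "\<dots> = fst (V t (r x, 0))" by (simp add: V_R[symmetric] R_1)
  finally show ?thesis using False by (simp add: S_def)
qed (simp add: S_def)

lemma S_invariant:
  assumes "x \<in> D"
  shows "S t x \<in> D" "B (S t x) = S t (B x)"
proof -
  have x: "x = r (x + B x)"
    using R_1[of "x + B x"] R_eqI[of 1 "(x, 0)" "(x + B x, 0)"] assms by (simp add: zB_def BB_def B_0 D_0)
  have "S t x = r (S t (x + B x))" by (subst x) (rule S_r)
  then show "S t x \<in> D" "B (S t x) = S t (B x)"
    using r_in[of "S t (x + B x)"] r_eq[of "S t (x + B x)"] by (auto simp: S_add)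
qed

lemma S_eq: "x \<in> D \<Longrightarrow> t > 0 \<Longrightarrow> S t x = x - fst (U t (B x, 0))"
  using V_eq[of "(x, 0)" t] by (simp add: S_def BB_def B_0 D_0 scaleR_diff_right)

lemma S_derivative:
  assumes "x \<in> D" "t > 0"
  shows "((\<lambda>t. S t x) has_vector_derivative - S t (B x)) (at t)"
proof -
  have "((\<lambda>t. fst (U t (B x, 0))) has_vector_derivative fst ((1 / t) *\<^sub>R V t (B x, 0))) (at t)"
    by (rule bounded_linear.has_vector_derivative[OF bounded_linear_fst U_derivative[OF assms(2)]])
  from has_vector_derivative_diff[OF has_vector_derivative_const this, of x]
  have "((\<lambda>t. x - fst (U t (B x, 0))) has_vector_derivative - S t (B x)) (at t)"
    using assms(2) by (simp add: S_def)
  then show ?thesis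
    by (rule has_vector_derivative_transform_within_open[of _ _ _ "{0<..}"]) (use assms in \<open>auto simp: S_eq\<close>)
qed

lemma S_tendsto_0:
  assumes "x \<in> D"
  shows "((\<lambda>t. S t x) \<longlongrightarrow> x) (at_right 0)"
proof -
  have "((\<lambda>t. fst (U t (B x, 0))) \<longlongrightarrow> 0) (at_right 0)"
  proof (rule Lim_null_comparison)
    show "\<forall>\<^sub>F t in at_right 0. norm (fst (U t (B x, 0))) \<le> t * (2 * K * exp 1) * norm (B x, 0::'x)"
      using eventually_at_right_less[of 0]
      by (rule eventually_mono) (rule order_trans[OF norm_fst_le_norm norm_U_le])
    have "((\<lambda>t. t * (2 * K * exp 1) * norm (B x, 0::'x)) \<longlongrightarrow> 0 * (2 * K * exp 1) * norm (B x, 0::'x)) (at_right 0)"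
      by (intro tendsto_intros)
    then show "((\<lambda>t. t * (2 * K * exp 1) * norm (B x, 0::'x)) \<longlongrightarrow> 0) (at_right 0)" by simp
  qed
  then have "((\<lambda>t. x - fst (U t (B x, 0))) \<longlongrightarrow> x - 0) (at_right 0)" by (intro tendsto_intros)
  moreover have "\<forall>\<^sub>F t in at_right 0. x - fst (U t (B x, 0)) = S t x"
    using eventually_at_right_less[of 0] by (rule eventually_mono) (simp add: S_eq[OF assms])
  ultimately show ?thesis using Lim_transform_eventually by fastforce
qed

end

locale solution_family = closed_dense_operator D A for D :: "'x::banach set" and A :: "'x \<Rightarrow> 'x" +
  fixes S :: "real \<Rightarrow> 'x \<Rightarrow> 'x" and C \<omega> :: real and r :: "'x \<Rightarrow> 'x" and \<mu> :: real
  assumes add: "0 \<le> t \<Longrightarrow> S t (x + y) = S t x + S t y"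
    and scale: "0 \<le> t \<Longrightarrow> S t (c *\<^sub>R x) = c *\<^sub>R S t x"
    and norm_le: "0 \<le> t \<Longrightarrow> norm (S t x) \<le> C * exp (\<omega> * t) * norm x"
    and S_0: "S 0 x = x"
    and S_in: "0 \<le> t \<Longrightarrow> x \<in> D \<Longrightarrow> S t x \<in> D"
    and A_S: "0 \<le> t \<Longrightarrow> x \<in> D \<Longrightarrow> A (S t x) = S t (A x)"
    and S_derivative: "0 < t \<Longrightarrow> x \<in> D \<Longrightarrow> ((\<lambda>t. S t x) has_vector_derivative - S t (A x)) (at t)"
    and S_at_0: "x \<in> D \<Longrightarrow> ((\<lambda>t. S t x) \<longlongrightarrow> x) (at_right 0)"
    and bounded_linear_r: "bounded_linear r" and r_in: "r x \<in> D" and r_eq: "\<mu> *\<^sub>R r x + A (r x) = x"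
    and S_r: "0 \<le> t \<Longrightarrow> S t (r x) = r (S t x)"
begin

lemma S_zero: "0 \<le> t \<Longrightarrow> S t 0 = 0"
  using scale[of t 0 0] by simp

lemma S_diff: "0 \<le> t \<Longrightarrow> S t (x - y) = S t x - S t y"
  using add[of t x "(-1) *\<^sub>R y"] scale[of t "-1" y] by simp

lemma S_minus: "0 \<le> t \<Longrightarrow> S t (- x) = - S t x"
  using scale[of t "-1" x] by simp

lemma bounded_linear_S: "0 \<le> t \<Longrightarrow> bounded_linear (S t)"
  using norm_le[of t] by (intro bounded_linear_intro[where K = "C * exp (\<omega> * t)"]) (auto simp: add scale mult.commute)

lemma locally_bounded:
  obtains M where "M \<ge> 0" "\<And>t x. 0 \<le> t \<Longrightarrow> t \<le> b \<Longrightarrow> norm (S t x) \<le> M * norm x"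
proof
  show "0 \<le> \<bar>C\<bar> * exp (\<bar>\<omega>\<bar> * \<bar>b\<bar>)" by simp
  fix t x assume t: "0 \<le> t" "t \<le> b"
  have "norm (S t x) \<le> C * exp (\<omega> * t) * norm x" using norm_le t by blast
  also have "\<dots> \<le> (\<bar>C\<bar> * exp (\<bar>\<omega>\<bar> * \<bar>b\<bar>)) * norm x"
  proof (intro mult_right_mono mult_mono)
    have "\<omega> * t \<le> \<bar>\<omega>\<bar> * \<bar>b\<bar>" using t by (intro mult_mono) auto
    then show "exp (\<omega> * t) \<le> exp (\<bar>\<omega>\<bar> * \<bar>b\<bar>)" by simp
  qed auto
  finally show "norm (S t x) \<le> (\<bar>C\<bar> * exp (\<bar>\<omega>\<bar> * \<bar>b\<bar>)) * norm x" .
qed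

lemma obtain_D:
  assumes "e > 0"
  obtains d where "d \<in> D" "norm (d - x) < e"
  using assms dense closure_approachable[of x D] by (auto simp: dist_norm)

lemma continuous_on_S_D:
  assumes "x \<in> D"
  shows "continuous_on {0..} (\<lambda>t. S t x)"
  unfolding continuous_on
proof
  fix t :: real assume "t \<in> {0..}"
  then consider "t = 0" | "t > 0" by force
  then show "((\<lambda>t. S t x) \<longlongrightarrow> S t x) (at t within {0..})"
  proof cases
    case 1
    then show ?thesis using S_at_0[OF assms] by (simp add: at_within_Ici_at_right S_0)
  next
    case 2
    then have "isCont (\<lambda>t. S t x) t" using S_derivative[OF 2 assms] has_vector_derivative_continuous by blast
    then show ?thesis using continuous_within tendsto_within_subset isCont_def by blast
  qed
qed

lemma continuous_on_S: "continuous_on {0..b} (\<lambda>t. S t x)"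
proof -
  obtain M where M: "M \<ge> 0" "\<And>t x. 0 \<le> t \<Longrightarrow> t \<le> b \<Longrightarrow> norm (S t x) \<le> M * norm x"
    using locally_bounded[of b] by blast
  have "\<exists>d\<in>D. norm (d - x) < 1 / real (Suc n)" for n using obtain_D[of "1 / real (Suc n)" x] by auto
  then obtain d where d: "\<And>n. d n \<in> D" "\<And>n. norm (d n - x) < 1 / real (Suc n)" by metis
  have "uniform_limit {0..b} (\<lambda>n t. S t (d n)) (\<lambda>t. S t x) sequentially"
  proof (rule uniform_limitI)
    fix e :: real assume "e > 0"
    have "(\<lambda>n. M * (1 / real (Suc n))) \<longlonglongrightarrow> M * 0" using LIMSEQ_inverse_real_of_nat
      by (intro tendsto_mult tendsto_const) (simp add: inverse_eq_divide)
    then have "\<forall>\<^sub>F n in sequentially. M * (1 / real (Suc n)) < e" using \<open>e > 0\<close> by (intro order_tendstoD) auto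
    then show "\<forall>\<^sub>F n in sequentially. \<forall>t\<in>{0..b}. dist (S t (d n)) (S t x) < e"
    proof (rule eventually_mono, intro ballI)
      fix n t assume n: "M * (1 / real (Suc n)) < e" and t: "t \<in> {0..b}"
      have "dist (S t (d n)) (S t x) = norm (S t (d n - x))" using t by (simp add: dist_norm S_diff)
      also have "\<dots> \<le> M * norm (d n - x)" using t by (intro M) auto
      also have "\<dots> \<le> M * (1 / real (Suc n))" using M(1) d(2)[of n] by (intro mult_left_mono) auto
      finally show "dist (S t (d n)) (S t x) < e" using n by linarith
    qed
  qed
  moreover have "continuous_on {0..b} (\<lambda>t. S t (d n))" for n
    by (rule continuous_on_subset[OF continuous_on_S_D[OF d(1)]]) auto
  then have "\<forall>\<^sub>F n in sequentially. continuous_on {0..b} (\<lambda>t. S t (d n))" by simp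
  ultimately show ?thesis using uniform_limit_theorem[of _ _ sequentially] by simp
qed

lemma S_tendsto_right: "((\<lambda>t. S t x) \<longlongrightarrow> x) (at_right 0)"
proof -
  have "((\<lambda>t. S t x) \<longlongrightarrow> S 0 x) (at 0 within {0..1})"
    using continuous_on_S[of 1 x] by (auto simp: continuous_on)
  then show ?thesis by (simp add: at_within_Icc_at_right S_0)
qed

lemma continuous_on_S_compose:
  assumes \<tau>: "continuous_on I \<tau>" and f: "continuous_on I f" and b: "\<And>s. s \<in> I \<Longrightarrow> 0 \<le> \<tau> s \<and> \<tau> s \<le> b"
  shows "continuous_on I (\<lambda>s. S (\<tau> s) (f s))"
  unfolding continuous_on
proof
  fix s assume s: "s \<in> I"
  obtain M where M: "M \<ge> 0" "\<And>t x. 0 \<le> t \<Longrightarrow> t \<le> b \<Longrightarrow> norm (S t x) \<le> M * norm x"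
    using locally_bounded[of b] by blast
  have ev: "\<forall>\<^sub>F s' in at s within I. s' \<in> I" by (simp add: eventually_at_filter)
  have 1: "((\<lambda>s'. S (\<tau> s') (f s' - f s)) \<longlongrightarrow> 0) (at s within I)"
  proof (rule Lim_null_comparison)
    show "\<forall>\<^sub>F s' in at s within I. norm (S (\<tau> s') (f s' - f s)) \<le> M * norm (f s' - f s)"
      using ev by (rule eventually_mono) (use b M in blast)
    have "((\<lambda>s'. M * norm (f s' - f s)) \<longlongrightarrow> M * norm (f s - f s)) (at s within I)"
      using f s by (intro tendsto_intros) (auto simp: continuous_on)
    then show "((\<lambda>s'. M * norm (f s' - f s)) \<longlongrightarrow> 0) (at s within I)" by simp
  qed
  have "continuous_on I (\<lambda>s'. S (\<tau> s') (f s))"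
    by (rule continuous_on_compose2[OF continuous_on_S[of b "f s"] \<tau>]) (use b in auto)
  then have 2: "((\<lambda>s'. S (\<tau> s') (f s)) \<longlongrightarrow> S (\<tau> s) (f s)) (at s within I)" using s by (auto simp: continuous_on)
  have "((\<lambda>s'. S (\<tau> s') (f s' - f s) + S (\<tau> s') (f s)) \<longlongrightarrow> 0 + S (\<tau> s) (f s)) (at s within I)"
    by (rule tendsto_add[OF 1 2])
  moreover have "\<forall>\<^sub>F s' in at s within I. S (\<tau> s') (f s' - f s) + S (\<tau> s') (f s) = S (\<tau> s') (f s')"
    using ev by (rule eventually_mono) (use b in \<open>simp add: S_diff\<close>)
  ultimately show "((\<lambda>s'. S (\<tau> s') (f s')) \<longlongrightarrow> S (\<tau> s) (f s)) (at s within I)"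
    using Lim_transform_eventually by fastforce
qed

lemma has_vector_derivative_iff_quotient:
  fixes f :: "real \<Rightarrow> 'z::real_normed_vector"
  shows "(f has_vector_derivative L) (at x) \<longleftrightarrow> ((\<lambda>h. (f (x + h) - f x) /\<^sub>R h) \<longlongrightarrow> L) (at 0)"
proof -
  have "(f has_vector_derivative L) (at x) \<longleftrightarrow> ((\<lambda>h. norm (f (x + h) - f x - h *\<^sub>R L) / norm h) \<longlongrightarrow> 0) (at 0)"
    by (simp add: has_vector_derivative_def has_derivative_at bounded_linear_scaleR_left)
  also have "\<dots> \<longleftrightarrow> ((\<lambda>h. norm ((f (x + h) - f x) /\<^sub>R h - L)) \<longlongrightarrow> 0) (at 0)"
  proof (rule filterlim_cong[OF refl refl])
    have "\<forall>\<^sub>F h :: real in at 0. h \<noteq> 0" by (simp add: eventually_at_filter)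
    then show "\<forall>\<^sub>F h in at 0. norm (f (x + h) - f x - h *\<^sub>R L) / norm h = norm ((f (x + h) - f x) /\<^sub>R h - L)"
    proof eventually_elim
      case (elim h)
      have "f (x + h) - f x - h *\<^sub>R L = h *\<^sub>R ((f (x + h) - f x) /\<^sub>R h - L)"
        using elim by (simp add: scaleR_diff_right)
      then show ?case using elim by simp
    qed
  qed
  also have "\<dots> \<longleftrightarrow> ((\<lambda>h. (f (x + h) - f x) /\<^sub>R h) \<longlongrightarrow> L) (at 0)"
    using tendsto_norm_zero_iff[of "\<lambda>h. (f (x + h) - f x) /\<^sub>R h - L" "at 0"] Lim_null[of "\<lambda>h. (f (x + h) - f x) /\<^sub>R h" L "at 0"] by simp
  finally show ?thesis .
qed

lemma has_vector_derivative_within_quotient: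
  fixes f :: "real \<Rightarrow> 'z::real_normed_vector"
  assumes "(f has_vector_derivative L) (at x within X)"
  shows "((\<lambda>y. (f y - f x) /\<^sub>R (y - x)) \<longlongrightarrow> L) (at x within X)"
proof -
  have "((\<lambda>y. norm ((1 / norm (y - x)) *\<^sub>R (f y - (f x + (y - x) *\<^sub>R L)))) \<longlongrightarrow> 0) (at x within X)"
    using assms tendsto_norm_zero unfolding has_vector_derivative_def has_derivative_within by blast
  moreover have "\<forall>\<^sub>F y in at x within X. norm ((1 / norm (y - x)) *\<^sub>R (f y - (f x + (y - x) *\<^sub>R L))) = norm ((f y - f x) /\<^sub>R (y - x) - L)"
  proof -
    have "\<forall>\<^sub>F y in at x within X. y \<noteq> x" by (simp add: eventually_at_filter)
    then show ?thesis
    proof eventually_elim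
      case (elim y)
      have "f y - (f x + (y - x) *\<^sub>R L) = (y - x) *\<^sub>R ((f y - f x) /\<^sub>R (y - x) - L)"
        using elim by (simp add: scaleR_diff_right)
      then show ?case using elim by simp
    qed
  qed
  ultimately have "((\<lambda>y. norm ((f y - f x) /\<^sub>R (y - x) - L)) \<longlongrightarrow> 0) (at x within X)" by (rule Lim_transform_eventually)
  then have "((\<lambda>y. (f y - f x) /\<^sub>R (y - x) - L) \<longlongrightarrow> 0) (at x within X)" by (rule tendsto_norm_zero_cancel)
  then show ?thesis by (rule LIM_zero_cancel)
qed

text \<open>The derivative of \<open>s \<mapsto> S (t - s) (u s)\<close> vanishes.\<close>

lemma cauchy_unique:
  assumes "t \<ge> 0" and u: "continuous_on {0..t} u"
    and uD: "\<And>s. 0 < s \<Longrightarrow> s < t \<Longrightarrow> u s \<in> D"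
    and u': "\<And>s. 0 < s \<Longrightarrow> s < t \<Longrightarrow> (u has_vector_derivative - A (u s)) (at s)"
  shows "u t = S t (u 0)"
proof -
  define \<phi> where "\<phi> s = S (t - s) (u s)" for s
  have "((\<lambda>s. 0) has_integral (\<phi> t - \<phi> 0)) {0..t}"
  proof (rule fundamental_theorem_of_calculus_interior[OF assms(1)])
    show "continuous_on {0..t} \<phi>"
      unfolding \<phi>_def by (rule continuous_on_S_compose[OF _ u, of _ t]) (auto intro: continuous_intros)
    fix s assume "s \<in> {0<..<t}"
    then have s: "0 < s" "s < t" by auto
    define y where "y = u s"
    have y: "y \<in> D" unfolding y_def using uD s by blast
    obtain M where M: "M \<ge> 0" "\<And>\<tau> x. 0 \<le> \<tau> \<Longrightarrow> \<tau> \<le> t \<Longrightarrow> norm (S \<tau> x) \<le> M * norm x"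
      using locally_bounded[of t] by blast
    define \<epsilon> where "\<epsilon> h = (u (s + h) - u s) /\<^sub>R h - (- A y)" for h
    have \<epsilon>0: "(\<epsilon> \<longlongrightarrow> 0) (at 0)"
      using u'[OF s] unfolding has_vector_derivative_iff_quotient \<epsilon>_def y_def by (rule LIM_zero)
    have near: "\<forall>\<^sub>F h in at 0. h \<noteq> 0 \<and> 0 \<le> t - (s + h) \<and> t - (s + h) \<le> t"
    proof -
      have "\<forall>\<^sub>F h in at (0::real). dist h 0 < min s (t - s)" unfolding eventually_at using s by (intro exI[of _ "min s (t - s)"]) auto
      moreover have "\<forall>\<^sub>F h :: real in at 0. h \<noteq> 0" by (simp add: eventually_at_filter)
      ultimately show ?thesis by eventually_elim (auto simp: dist_real_def)
    qed
    have A1: "((\<lambda>h. S (t - (s + h)) (\<epsilon> h)) \<longlongrightarrow> 0) (at 0)"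
    proof (rule Lim_null_comparison)
      show "\<forall>\<^sub>F h in at 0. norm (S (t - (s + h)) (\<epsilon> h)) \<le> M * norm (\<epsilon> h)"
        using near by (rule eventually_mono) (use M in blast)
      show "((\<lambda>h. M * norm (\<epsilon> h)) \<longlongrightarrow> 0) (at 0)"
        using tendsto_mult_right_zero[OF tendsto_norm_zero[OF \<epsilon>0]] .
    qed
    have A2: "((\<lambda>h. S (t - (s + h)) (- A y)) \<longlongrightarrow> - S (t - s) (A y)) (at 0)"
    proof -
      have "isCont (\<lambda>\<tau>. S \<tau> (- A y)) (t - s)"
        by (rule continuous_on_interior[OF continuous_on_S[of t]]) (use s in \<open>auto simp: interior_atLeastAtMost_real\<close>)
      moreover have "((\<lambda>h. t - (s + h)) \<longlongrightarrow> t - (s + 0)) (at 0)" by (intro tendsto_intros)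
      ultimately have "((\<lambda>h. S (t - (s + h)) (- A y)) \<longlongrightarrow> S (t - s) (- A y)) (at 0)"
        using isCont_tendsto_compose by fastforce
      then show ?thesis using s by (simp add: S_minus)
    qed
    have A3: "((\<lambda>h. (S (t - (s + h)) y - S (t - s) y) /\<^sub>R h) \<longlongrightarrow> S (t - s) (A y)) (at 0)"
    proof -
      have "((\<lambda>\<sigma>. t - \<sigma>) has_vector_derivative - 1) (at s)"
        by (auto intro!: derivative_eq_intros)
      moreover have "((\<lambda>\<tau>. S \<tau> y) has_vector_derivative - S (t - s) (A y)) (at (t - s))"
        by (rule S_derivative) (use s y in auto)
      ultimately have "((\<lambda>\<sigma>. S (t - \<sigma>) y) has_vector_derivative (- 1) *\<^sub>R (- S (t - s) (A y))) (at s)"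
        using vector_diff_chain_at[of "\<lambda>\<sigma>. t - \<sigma>" "-1" s "\<lambda>\<tau>. S \<tau> y" "- S (t - s) (A y)"] by (simp only: o_def)
      then show ?thesis by (simp add: has_vector_derivative_iff_quotient)
    qed
    have "((\<lambda>h. S (t - (s + h)) (\<epsilon> h) + S (t - (s + h)) (- A y) + (S (t - (s + h)) y - S (t - s) y) /\<^sub>R h) \<longlongrightarrow> 0 + - S (t - s) (A y) + S (t - s) (A y)) (at 0)"
      by (intro tendsto_add A1 A2 A3)
    moreover have "\<forall>\<^sub>F h in at 0. S (t - (s + h)) (\<epsilon> h) + S (t - (s + h)) (- A y) + (S (t - (s + h)) y - S (t - s) y) /\<^sub>R h
        = (\<phi> (s + h) - \<phi> s) /\<^sub>R h"
      using near
    proof eventually_elim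
      case (elim h)
      have nn: "0 \<le> t - (s + h)" using elim by simp
      have "S (t - (s + h)) (\<epsilon> h) + S (t - (s + h)) (- A y) = S (t - (s + h)) ((u (s + h) - u s) /\<^sub>R h)"
        unfolding add[OF nn, symmetric] by (simp add: \<epsilon>_def)
      also have "\<dots> = (S (t - (s + h)) (u (s + h)) - S (t - (s + h)) y) /\<^sub>R h"
        using nn by (simp add: scale S_diff y_def)
      finally show ?case
        by (simp add: \<phi>_def y_def scaleR_diff_right)
    qed
    ultimately have "((\<lambda>h. (\<phi> (s + h) - \<phi> s) /\<^sub>R h) \<longlongrightarrow> 0) (at 0)"
      using Lim_transform_eventually by fastforce
    then show "(\<phi> has_vector_derivative 0) (at s)" by (simp add: has_vector_derivative_iff_quotient)
  qed
  then have "\<phi> t - \<phi> 0 = 0" using has_integral_unique[OF _ has_integral_0] by blast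
  then show ?thesis by (simp add: \<phi>_def S_0)
qed

lemma semigroup:
  assumes "s \<ge> 0" "t \<ge> 0"
  shows "S (s + t) x = S s (S t x)"
proof -
  have *: "S (s + t) x = S s (S t x)" if x: "x \<in> D" for x
  proof -
    have "(\<lambda>\<sigma>. S (\<sigma> + t) x) s = S s ((\<lambda>\<sigma>. S (\<sigma> + t) x) 0)"
    proof (rule cauchy_unique[OF assms(1)])
      show "continuous_on {0..s} (\<lambda>\<sigma>. S (\<sigma> + t) x)"
        by (rule continuous_on_S_compose[of _ _ _ "s + t"]) (use assms in \<open>auto intro!: continuous_intros\<close>)
      fix \<sigma> :: real assume \<sigma>: "0 < \<sigma>"
      then show "S (\<sigma> + t) x \<in> D" using S_in x assms by simp
      have "((\<lambda>\<tau>. S \<tau> x) has_vector_derivative - S (\<sigma> + t) (A x)) (at (\<sigma> + t))"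
        using S_derivative \<sigma> assms x by simp
      from vector_diff_chain_at[of "\<lambda>\<sigma>. \<sigma> + t" 1 \<sigma> "\<lambda>\<tau>. S \<tau> x", OF _ this]
      show "((\<lambda>\<sigma>. S (\<sigma> + t) x) has_vector_derivative - A (S (\<sigma> + t) x)) (at \<sigma>)"
        using A_S[of "\<sigma> + t" x] \<sigma> assms x by (simp add: o_def has_vector_derivative_add_const)
    qed
    then show ?thesis by simp
  qed
  have "closed {x. S (s + t) x = S s (S t x)}"
  proof (rule closed_Collect_eq)
    show "continuous_on UNIV (S (s + t))" using bounded_linear_S assms by (simp add: linear_continuous_on)
    have "bounded_linear (\<lambda>x. S s (S t x))" using bounded_linear_compose[OF bounded_linear_S bounded_linear_S] assms by blast
    then show "continuous_on UNIV (\<lambda>x. S s (S t x))" by (rule linear_continuous_on)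
  qed
  then have "closure D \<subseteq> {x. S (s + t) x = S s (S t x)}" using * by (intro closure_minimal) auto
  then show ?thesis using dense by auto
qed

lemma quotient_tendsto:
  assumes "x \<in> D"
  shows "((\<lambda>h. (S h x - x) /\<^sub>R h) \<longlongrightarrow> - A x) (at_right 0)"
proof -
  have FTC: "((\<lambda>s. - S s (A x)) has_integral (S h x - S 0 x)) {0..h}" if "h \<ge> 0" for h
    by (rule fundamental_theorem_of_calculus_interior[OF that])
      (use S_derivative[OF _ assms] continuous_on_subset[OF continuous_on_S_D[OF assms], of "{0..h}"] in auto)
  have c: "continuous_on {0..1} (\<lambda>s. - S s (A x))" by (intro continuous_intros continuous_on_S)
  have "((\<lambda>u. integral {0..u} (\<lambda>s. - S s (A x))) has_vector_derivative - S 0 (A x)) (at 0 within {0..1})"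
    using integral_has_vector_derivative[OF c, of 0] by simp
  then have "((\<lambda>h. (integral {0..h} (\<lambda>s. - S s (A x)) - integral {0..0} (\<lambda>s. - S s (A x))) /\<^sub>R (h - 0)) \<longlongrightarrow> - S 0 (A x)) (at 0 within {0..1})"
    by (rule has_vector_derivative_within_quotient)
  then have "((\<lambda>h. integral {0..h} (\<lambda>s. - S s (A x)) /\<^sub>R h) \<longlongrightarrow> - A x) (at_right 0)"
    by (simp add: at_within_Icc_at_right S_0)
  moreover have "\<forall>\<^sub>F h in at_right 0. integral {0..h} (\<lambda>s. - S s (A x)) /\<^sub>R h = (S h x - x) /\<^sub>R h"
    using eventually_at_right_less[of 0]
  proof eventually_elim
    case (elim h)
    then show ?case using integral_unique[OF FTC[of h]] by (simp only: S_0 less_imp_le)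
  qed
  ultimately show ?thesis by (rule Lim_transform_eventually)
qed

lemma generated: "generated_by_uminus UNIV D A S"
  unfolding generated_by_uminus_def
proof (intro ballI iffI)
  fix x y assume lim: "((\<lambda>h. (S h x - x) /\<^sub>R h) \<longlongrightarrow> y) (at_right 0)"
  have "((\<lambda>h. (S h (r x) - r x) /\<^sub>R h) \<longlongrightarrow> r y) (at_right 0)"
  proof (rule Lim_transform_eventually)
    show "((\<lambda>h. r ((S h x - x) /\<^sub>R h)) \<longlongrightarrow> r y) (at_right 0)"
      by (rule bounded_linear.tendsto[OF bounded_linear_r lim])
    show "\<forall>\<^sub>F h in at_right 0. r ((S h x - x) /\<^sub>R h) = (S h (r x) - r x) /\<^sub>R h"
      using eventually_at_right_less[of 0]
      by (rule eventually_mono)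
        (simp add: linear_scale[OF bounded_linear.linear[OF bounded_linear_r]] linear_diff[OF bounded_linear.linear[OF bounded_linear_r]] S_r)
  qed
  then have "r y = - A (r x)"
    using tendsto_unique[OF _ quotient_tendsto[OF r_in]] by (metis trivial_limit_at_right_real)
  then have "x = \<mu> *\<^sub>R r x - r y" using r_eq[of x] by simp
  then have "x \<in> D" using D_diff[OF D_scale[OF r_in] r_in] by metis
  then show "x \<in> D \<and> y = - A x"
    using tendsto_unique[OF _ quotient_tendsto lim] by (metis trivial_limit_at_right_real)
next
  fix x y assume "x \<in> D \<and> y = - A x"
  then show "((\<lambda>h. (S h x - x) /\<^sub>R h) \<longlongrightarrow> y) (at_right 0)" using quotient_tendsto by blast
qed

lemma C0_semigroup:
  assumes "subspace Y" "\<And>t x. 0 \<le> t \<Longrightarrow> x \<in> Y \<Longrightarrow> S t x \<in> Y"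
  shows "C0_semigroup_on Y S"
  unfolding C0_semigroup_on_def
proof (intro conjI allI impI ballI)
  fix t :: real assume t: "0 \<le> t"
  show "S t ` Y \<subseteq> Y" using assms(2) t by blast
  show "linear_on_subspace Y (S t)" using assms(1) t by (simp add: linear_on_subspace_def add scale)
  show "\<exists>K. \<forall>x\<in>Y. norm (S t x) \<le> K * norm x" using norm_le[OF t] by blast
qed (simp_all add: S_0 semigroup S_tendsto_right)

end

lemma C0_semigroup_locally_bounded:
  fixes T :: "real \<Rightarrow> 'x::banach \<Rightarrow> 'x"
  assumes T: "C0_semigroup_on Y T" and Y: "closed Y" "subspace Y"
  shows "\<exists>K\<ge>0. \<forall>t. 0 \<le> t \<and> t \<le> b \<longrightarrow> (\<forall>x\<in>Y. norm (T t x) \<le> K * norm x)"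
proof -
  have lin: "\<And>t x y. 0 \<le> t \<Longrightarrow> x \<in> Y \<Longrightarrow> y \<in> Y \<Longrightarrow> T t (x + y) = T t x + T t y"
    "\<And>t c x. 0 \<le> t \<Longrightarrow> x \<in> Y \<Longrightarrow> T t (c *\<^sub>R x) = c *\<^sub>R T t x"
    and bd: "\<And>t. 0 \<le> t \<Longrightarrow> \<exists>K. \<forall>x\<in>Y. norm (T t x) \<le> K * norm x"
    and T0: "\<And>x. x \<in> Y \<Longrightarrow> T 0 x = x" and TY: "\<And>t x. 0 \<le> t \<Longrightarrow> x \<in> Y \<Longrightarrow> T t x \<in> Y"
    and sg: "\<And>s t x. 0 \<le> s \<Longrightarrow> 0 \<le> t \<Longrightarrow> x \<in> Y \<Longrightarrow> T (s + t) x = T s (T t x)"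
    and lim: "\<And>x. x \<in> Y \<Longrightarrow> ((\<lambda>t. T t x) \<longlongrightarrow> x) (at_right 0)"
    using T unfolding C0_semigroup_on_def linear_on_subspace_def by blast+
  have "\<exists>\<delta>>0. \<exists>K. \<forall>t. 0 \<le> t \<and> t \<le> \<delta> \<longrightarrow> (\<forall>x\<in>Y. norm (T t x) \<le> K * norm x)"
  proof (rule ccontr)
    assume neg: "\<not> ?thesis"
    have "\<exists>t. 0 \<le> t \<and> t \<le> 1 / real (Suc n) \<and> (\<exists>x\<in>Y. norm (T t x) > real n * norm x)" for n
    proof (rule ccontr)
      assume "\<not> ?thesis"
      then have "\<forall>t. 0 \<le> t \<and> t \<le> 1 / real (Suc n) \<longrightarrow> (\<forall>x\<in>Y. norm (T t x) \<le> real n * norm x)" by (meson not_le)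
      moreover have "1 / real (Suc n) > 0" by simp
      ultimately show False using neg by blast
    qed
    then obtain \<tau> x where \<tau>: "\<And>n. 0 \<le> \<tau> n" "\<And>n. \<tau> n \<le> 1 / real (Suc n)"
      and x: "\<And>n. x n \<in> Y" "\<And>n. norm (T (\<tau> n) (x n)) > real n * norm (x n)" by metis
    have "(\<lambda>n. 1 / real (Suc n)) \<longlonglongrightarrow> 0" using LIMSEQ_inverse_real_of_nat by (simp add: inverse_eq_divide)
    then have \<tau>0: "\<tau> \<longlonglongrightarrow> 0"
      by (rule tendsto_sandwich[OF always_eventually[OF allI[OF \<tau>(1)]] always_eventually[OF allI[OF \<tau>(2)]] tendsto_const])
    have pw: "\<exists>B. \<forall>n. norm (T (\<tau> n) y) \<le> B" if y: "y \<in> Y" for y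
    proof -
      have "((\<lambda>t. T t y) \<longlongrightarrow> T 0 y) (at 0 within {0..})" using lim[OF y] T0[OF y] by (simp add: at_within_Ici_at_right)
      then have "continuous (at 0 within {0..}) (\<lambda>t. T t y)" by (simp only: continuous_within)
      then have "(\<lambda>n. T (\<tau> n) y) \<longlonglongrightarrow> T 0 y"
        by (rule continuous_within_tendsto_compose'[OF _ _ \<tau>0]) (simp add: \<tau>(1))
      then have "Bseq (\<lambda>n. T (\<tau> n) y)" by (rule convergent_imp_Bseq[OF convergentI])
      then show "\<exists>B. \<forall>n. norm (T (\<tau> n) y) \<le> B" unfolding Bseq_def by blast
    qed
    have "\<exists>K. \<forall>n. \<forall>x\<in>Y. norm ((\<lambda>n. T (\<tau> n)) n x) \<le> K * norm x"
      by (rule uniform_boundedness_on[OF Y(2,1) lin(1)[OF \<tau>(1)] lin(2)[OF \<tau>(1)] bd[OF \<tau>(1)] pw])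
    then obtain K where K: "\<And>n x. x \<in> Y \<Longrightarrow> norm (T (\<tau> n) x) \<le> K * norm x" by blast
    obtain n :: nat where "real n > K" using reals_Archimedean2 by blast
    then have "K * norm (x n) \<le> real n * norm (x n)" by (intro mult_right_mono) auto
    then show False using K[OF x(1)[of n], of n] x(2)[of n] by linarith
  qed
  then obtain \<delta> K where \<delta>: "\<delta> > 0" and K: "\<And>t x. 0 \<le> t \<Longrightarrow> t \<le> \<delta> \<Longrightarrow> x \<in> Y \<Longrightarrow> norm (T t x) \<le> K * norm x" by blast
  have "\<exists>K\<ge>0. \<forall>t. 0 \<le> t \<and> t \<le> real n * \<delta> \<longrightarrow> (\<forall>x\<in>Y. norm (T t x) \<le> K * norm x)" for n :: nat
  proof (induction n)
    case 0
    show ?case using T0 by (intro exI[of _ 1]) auto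
  next
    case (Suc n)
    then obtain K' where K': "K' \<ge> 0" "\<And>t x. 0 \<le> t \<Longrightarrow> t \<le> real n * \<delta> \<Longrightarrow> x \<in> Y \<Longrightarrow> norm (T t x) \<le> K' * norm x" by blast
    have "norm (T t x) \<le> max K' (\<bar>K\<bar> * K') * norm x" if t: "0 \<le> t" "t \<le> real (Suc n) * \<delta>" and xY: "x \<in> Y" for t x
    proof (cases "t \<le> real n * \<delta>")
      case True
      then show ?thesis using K'(2)[OF t(1) True xY] mult_right_mono[of K' "max K' (\<bar>K\<bar> * K')" "norm x"] by simp
    next
      case False
      define s where "s = t - real n * \<delta>"
      have s: "0 \<le> s" "s \<le> \<delta>" "t = s + real n * \<delta>" using False t by (auto simp: s_def algebra_simps)
      have nd: "0 \<le> real n * \<delta>" using \<delta> by simp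
      have "norm (T t x) = norm (T s (T (real n * \<delta>) x))" unfolding s(3) by (simp only: sg[OF s(1) nd xY])
      also have "\<dots> \<le> K * norm (T (real n * \<delta>) x)" by (rule K[OF s(1,2) TY[OF nd xY]])
      also have "\<dots> \<le> \<bar>K\<bar> * norm (T (real n * \<delta>) x)" by (intro mult_right_mono) auto
      also have "\<dots> \<le> \<bar>K\<bar> * (K' * norm x)" by (intro mult_left_mono K'(2)[OF nd _ xY]) auto
      also have "\<dots> = (\<bar>K\<bar> * K') * norm x" by simp
      also have "\<dots> \<le> max K' (\<bar>K\<bar> * K') * norm x" by (intro mult_right_mono) auto
      finally show ?thesis .
    qed
    then show ?case using K'(1) by (intro exI[of _ "max K' (\<bar>K\<bar> * K')"]) auto
  qed
  moreover obtain n :: nat where "real n > b / \<delta>" using reals_Archimedean2 by blast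
  then have "b \<le> real n * \<delta>" using \<delta> by (simp add: field_simps)
  ultimately show ?thesis by (meson order_trans)
qed

context solution_family
begin

lemma semigroup_unique:
  assumes T: "C0_semigroup_on Y T" and gen: "generated_by_uminus Y (D \<inter> Y) A T" and Y: "closed Y" "subspace Y"
    and AY: "\<And>x. x \<in> D \<inter> Y \<Longrightarrow> A x \<in> Y" and dense_Y: "Y \<subseteq> closure (D \<inter> Y)" and t: "t \<ge> 0" and xY: "x \<in> Y"
  shows "T t x = S t x"
proof -
  have lin: "\<And>t x y. 0 \<le> t \<Longrightarrow> x \<in> Y \<Longrightarrow> y \<in> Y \<Longrightarrow> T t (x + y) = T t x + T t y"
    "\<And>t c x. 0 \<le> t \<Longrightarrow> x \<in> Y \<Longrightarrow> T t (c *\<^sub>R x) = c *\<^sub>R T t x"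
    and T0: "\<And>x. x \<in> Y \<Longrightarrow> T 0 x = x" and TY: "\<And>t x. 0 \<le> t \<Longrightarrow> x \<in> Y \<Longrightarrow> T t x \<in> Y"
    and sg: "\<And>s t x. 0 \<le> s \<Longrightarrow> 0 \<le> t \<Longrightarrow> x \<in> Y \<Longrightarrow> T (s + t) x = T s (T t x)"
    and lim: "\<And>x. x \<in> Y \<Longrightarrow> ((\<lambda>t. T t x) \<longlongrightarrow> x) (at_right 0)"
    using T unfolding C0_semigroup_on_def linear_on_subspace_def by blast+
  have Ydiff: "\<And>x y. x \<in> Y \<Longrightarrow> y \<in> Y \<Longrightarrow> x - y \<in> Y" and Yscale: "\<And>c x. x \<in> Y \<Longrightarrow> c *\<^sub>R x \<in> Y"
    using Y by (auto simp: subspace_diff subspace_scale)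
  have Tdiff: "T t (x - y) = T t x - T t y" if "0 \<le> t" "x \<in> Y" "y \<in> Y" for t x y
    using lin(1)[OF that(1), of "x - y" y] that Ydiff by simp
  obtain K where K: "K \<ge> 0" "\<And>s x. 0 \<le> s \<Longrightarrow> s \<le> t \<Longrightarrow> x \<in> Y \<Longrightarrow> norm (T s x) \<le> K * norm x"
    using C0_semigroup_locally_bounded[OF T Y, of t] by blast
  have small: "((\<lambda>h. norm (T h y - y)) \<longlongrightarrow> 0) (at_right 0)" if "y \<in> Y" for y
    using tendsto_norm_zero[OF LIM_zero[OF lim[OF that]]] .
  have quot: "((\<lambda>h. (T h y - y) /\<^sub>R h) \<longlongrightarrow> - A y) (at_right 0)" if "y \<in> D \<inter> Y" for y
    using gen that AY[OF that] Yscale[of "A y" "-1"] unfolding generated_by_uminus_def by auto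
  have left: "((\<lambda>h. T (s - h) y) \<longlongrightarrow> T s y) (at_right 0)" if s: "0 < s" "s \<le> t" and y: "y \<in> Y" for s y
  proof -
    have "((\<lambda>h. T (s - h) y - T s y) \<longlongrightarrow> 0) (at_right 0)"
    proof (rule Lim_null_comparison)
      have "\<forall>\<^sub>F h in at_right 0. 0 < h \<and> h < s" using eventually_at_right_less[of 0] eventually_at_right_real[OF s(1)] by eventually_elim auto
      then show "\<forall>\<^sub>F h in at_right 0. norm (T (s - h) y - T s y) \<le> K * norm (T h y - y)"
      proof eventually_elim
        case (elim h)
        have "T s y = T (s - h) (T h y)" using sg[of "s - h" h y] elim y by simp
        then have "norm (T (s - h) y - T s y) = norm (T (s - h) (T h y - y))"
          using Tdiff[of "s - h" "T h y" y] elim y TY by (simp add: norm_minus_commute)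
        also have "\<dots> \<le> K * norm (T h y - y)" using elim s y TY by (intro K Ydiff) auto
        finally show ?case .
      qed
      show "((\<lambda>h. K * norm (T h y - y)) \<longlongrightarrow> 0) (at_right 0)" using tendsto_mult_right_zero[OF small[OF y]] .
    qed
    then show ?thesis using Lim_null by blast
  qed
  have main: "T t y = S t y" if y: "y \<in> D \<inter> Y" for y
  proof -
    have right: "((\<lambda>h. (T (s + h) y - T s y) /\<^sub>R h) \<longlongrightarrow> T s (- A y)) (at_right 0)" if s: "0 \<le> s" "s \<le> t" for s
    proof -
      have "((\<lambda>h. T s ((T h y - y) /\<^sub>R h - (- A y))) \<longlongrightarrow> 0) (at_right 0)"
      proof (rule Lim_null_comparison)
        show "\<forall>\<^sub>F h in at_right 0. norm (T s ((T h y - y) /\<^sub>R h - (- A y))) \<le> K * norm ((T h y - y) /\<^sub>R h - (- A y))"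
          using eventually_at_right_less[of 0]
        proof eventually_elim
          case (elim h)
          have "- A y \<in> Y" using AY[OF y] Yscale[of "A y" "-1"] by simp
          then show ?case using elim s y TY by (intro K Ydiff Yscale) auto
        qed
        show "((\<lambda>h. K * norm ((T h y - y) /\<^sub>R h - (- A y))) \<longlongrightarrow> 0) (at_right 0)"
          using tendsto_mult_right_zero[OF tendsto_norm_zero[OF LIM_zero[OF quot[OF y]]]] .
      qed
      from tendsto_add[OF this tendsto_const[of "T s (- A y)"]]
      have "((\<lambda>h. T s ((T h y - y) /\<^sub>R h - (- A y)) + T s (- A y)) \<longlongrightarrow> T s (- A y)) (at_right 0)" by simp
      moreover have "\<forall>\<^sub>F h in at_right 0. T s ((T h y - y) /\<^sub>R h - (- A y)) + T s (- A y) = (T (s + h) y - T s y) /\<^sub>R h"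
        using eventually_at_right_less[of 0]
      proof eventually_elim
        case (elim h)
        have AyY: "- A y \<in> Y" using AY[OF y] Yscale[of "A y" "-1"] by simp
        have "(T h y - y) /\<^sub>R h \<in> Y" using elim y TY by (intro Ydiff Yscale) auto
        then have "T s ((T h y - y) /\<^sub>R h - (- A y)) + T s (- A y) = T s ((T h y - y) /\<^sub>R h)"
          using Tdiff[OF s(1) _ AyY] by simp
        also have "\<dots> = (T s (T h y) - T s y) /\<^sub>R h"
          using lin(2)[OF s(1), of "T h y - y"] Tdiff[OF s(1), of "T h y" y] Ydiff elim y TY by simp
        also have "T s (T h y) = T (s + h) y" using sg[OF s(1), of h y] elim y by simp
        finally show ?case .
      qed
      ultimately show ?thesis by (rule Lim_transform_eventually)
    qed
    have inD: "T s y \<in> D \<inter> Y \<and> T s (- A y) = - A (T s y)" if s: "0 \<le> s" "s \<le> t" for s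
    proof -
      have "((\<lambda>h. (T h (T s y) - T s y) /\<^sub>R h) \<longlongrightarrow> T s (- A y)) (at_right 0)"
        using right[OF s]
      proof (rule Lim_transform_eventually)
        show "\<forall>\<^sub>F h in at_right 0. (T (s + h) y - T s y) /\<^sub>R h = (T h (T s y) - T s y) /\<^sub>R h"
          using eventually_at_right_less[of 0]
        proof eventually_elim
          case (elim h)
          then show ?case using sg[of h s y] s y by (simp add: add.commute)
        qed
      qed
      moreover have "T s y \<in> Y" "T s (- A y) \<in> Y" using TY s y AY[OF y] Yscale[of "A y" "-1"] by auto
      ultimately show ?thesis using gen unfolding generated_by_uminus_def by blast
    qed
    have deriv: "((\<lambda>s. T s y) has_vector_derivative - A (T s y)) (at s)" if s: "0 < s" "s < t" for s
    proof -
      have AyY: "- A y \<in> Y" using AY[OF y] Yscale[of "A y" "-1"] by simp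
      have L: "((\<lambda>h. (T (s - h) y - T s y) /\<^sub>R (- h)) \<longlongrightarrow> T s (- A y)) (at_right 0)"
      proof -
        have ev: "\<forall>\<^sub>F h in at_right 0. 0 < h \<and> h < s" using eventually_at_right_less[of 0] eventually_at_right_real[OF s(1)] by eventually_elim auto
        have "((\<lambda>h. T (s - h) ((T h y - y) /\<^sub>R h - (- A y))) \<longlongrightarrow> 0) (at_right 0)"
        proof (rule Lim_null_comparison)
          show "\<forall>\<^sub>F h in at_right 0. norm (T (s - h) ((T h y - y) /\<^sub>R h - (- A y))) \<le> K * norm ((T h y - y) /\<^sub>R h - (- A y))"
            using ev by eventually_elim (use s y TY AyY in \<open>intro K Ydiff Yscale; auto\<close>)
          show "((\<lambda>h. K * norm ((T h y - y) /\<^sub>R h - (- A y))) \<longlongrightarrow> 0) (at_right 0)"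
            using tendsto_mult_right_zero[OF tendsto_norm_zero[OF LIM_zero[OF quot[OF y]]]] .
        qed
        from tendsto_add[OF this left[OF s(1) less_imp_le[OF s(2)] AyY]]
        have "((\<lambda>h. T (s - h) ((T h y - y) /\<^sub>R h - (- A y)) + T (s - h) (- A y)) \<longlongrightarrow> T s (- A y)) (at_right 0)" by simp
        moreover have "\<forall>\<^sub>F h in at_right 0. T (s - h) ((T h y - y) /\<^sub>R h - (- A y)) + T (s - h) (- A y) = (T (s - h) y - T s y) /\<^sub>R (- h)"
          using ev
        proof eventually_elim
          case (elim h)
          have sh: "0 \<le> s - h" using elim by simp
          have "(T h y - y) /\<^sub>R h \<in> Y" using elim y TY by (intro Ydiff Yscale) auto
          then have "T (s - h) ((T h y - y) /\<^sub>R h - (- A y)) + T (s - h) (- A y) = T (s - h) ((T h y - y) /\<^sub>R h)"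
            using Tdiff[OF sh _ AyY] by simp
          also have "\<dots> = (T (s - h) (T h y) - T (s - h) y) /\<^sub>R h"
            using lin(2)[OF sh, of "T h y - y"] Tdiff[OF sh, of "T h y" y] Ydiff elim y TY by simp
          also have "T (s - h) (T h y) = T s y" using sg[OF sh, of h y] elim y by simp
          finally show ?case by (simp add: scaleR_diff_right)
        qed
        ultimately show ?thesis by (rule Lim_transform_eventually)
      qed
      have "((\<lambda>h. (T (s + h) y - T s y) /\<^sub>R h) \<longlongrightarrow> T s (- A y)) (at_left 0)"
        unfolding at_left_minus filterlim_filtermap using L by simp
      with right[of s] s have "((\<lambda>h. (T (s + h) y - T s y) /\<^sub>R h) \<longlongrightarrow> T s (- A y)) (at 0)"
        by (simp add: filterlim_at_split)
      then show ?thesis using inD[of s] s by (simp add: has_vector_derivative_iff_quotient)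
    qed
    have "continuous_on {0..t} (\<lambda>s. T s y)"
      unfolding continuous_on
    proof
      fix s assume s: "s \<in> {0..t}"
      consider "t = 0" | "0 < s" "s < t" | "s = 0" "0 < t" | "s = t" "0 < t" using s by force
      then show "((\<lambda>s. T s y) \<longlongrightarrow> T s y) (at s within {0..t})"
      proof cases
        case 1
        then have "{0..t} = {s}" using s by auto
        then show ?thesis by (simp add: tendsto_def eventually_at_filter)
      next
        case 2
        then have "isCont (\<lambda>s. T s y) s" using deriv has_vector_derivative_continuous by blast
        then show ?thesis using tendsto_within_subset isCont_def by blast
      next
        case 3
        then show ?thesis using lim[of y] T0[of y] y by (simp add: at_within_Icc_at_right)
      next
        case 4
        have "((\<lambda>s. T s y) \<longlongrightarrow> T t y) (at_left t)"
          unfolding filterlim_at_left_to_right[of _ _ t] filterlim_at_right_to_0[of _ _ "-t"]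
          using left[of t y] 4 y by (simp add: add.commute[of _ t])
        then show ?thesis using 4 by (simp add: at_within_Icc_at_left)
      qed
    qed
    from cauchy_unique[OF t this] show ?thesis using inD deriv T0 y by auto
  qed
  have "x \<in> closure (D \<inter> Y)" using dense_Y xY by blast
  then obtain d where d: "\<And>n. d n \<in> D \<inter> Y" "d \<longlonglongrightarrow> x" unfolding closure_sequential by blast
  have "(\<lambda>n. T t (d n) - T t x) \<longlonglongrightarrow> 0"
  proof (rule Lim_null_comparison)
    show "\<forall>\<^sub>F n in sequentially. norm (T t (d n) - T t x) \<le> K * norm (d n - x)"
    proof (rule always_eventually, rule allI)
      fix n
      have "d n \<in> Y" using d(1) by blast
      then show "norm (T t (d n) - T t x) \<le> K * norm (d n - x)"
        using Tdiff[OF t, of "d n" x] K(2)[OF t order_refl Ydiff[of "d n" x]] xY by simp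
    qed
    show "(\<lambda>n. K * norm (d n - x)) \<longlonglongrightarrow> 0" using tendsto_mult_right_zero[OF tendsto_norm_zero[OF LIM_zero[OF d(2)]]] .
  qed
  then have "(\<lambda>n. S t (d n)) \<longlonglongrightarrow> T t x" using main[OF d(1)] Lim_null by fastforce
  moreover have "(\<lambda>n. S t (d n)) \<longlonglongrightarrow> S t x" by (rule bounded_linear.tendsto[OF bounded_linear_S[OF t] d(2)])
  ultimately show ?thesis by (rule LIMSEQ_unique)
qed

lemma exp_semigroup_on_eq:
  assumes Y: "closed Y" "subspace Y" and AY: "\<And>x. x \<in> D \<inter> Y \<Longrightarrow> A x \<in> Y" and dense_Y: "Y \<subseteq> closure (D \<inter> Y)"
    and SY: "\<And>t x. 0 \<le> t \<Longrightarrow> x \<in> Y \<Longrightarrow> S t x \<in> Y" and "t \<ge> 0" "x \<in> Y"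
  shows "exp_semigroup Y (D \<inter> Y) A t x = S t x"
proof -
  let ?P = "\<lambda>T. C0_semigroup_on Y T \<and> generated_by_uminus Y (D \<inter> Y) A T"
  have "?P S" using C0_semigroup[OF Y(2) SY] generated by (auto simp: generated_by_uminus_def)
  then have "?P (exp_semigroup Y (D \<inter> Y) A)" unfolding exp_semigroup_def by (rule someI[where P = ?P])
  then show ?thesis using semigroup_unique[OF _ _ Y AY dense_Y] assms by blast
qed

lemma exp_semigroup_eq: "t \<ge> 0 \<Longrightarrow> exp_semigroup UNIV D A t x = S t x"
  using exp_semigroup_on_eq[of UNIV t x] dense by simp

end

lemma closed_densely_defined_shift:
  assumes "closed_densely_defined D A"
  shows "closed_densely_defined D (\<lambda>x. A x + c *\<^sub>R x)"
proof -
  interpret closed_dense_operator D A by standard fact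
  have "closed ((\<lambda>p. (fst p, snd p - c *\<^sub>R fst p)) -` {(x, A x) |x. x \<in> D})"
    by (intro closed_vimage closed_graph continuous_intros)
  moreover have "(\<lambda>p. (fst p, snd p - c *\<^sub>R fst p)) -` {(x, A x) |x. x \<in> D} = {(x, A x + c *\<^sub>R x) |x. x \<in> D}"
    by (auto simp: diff_eq_eq)
  ultimately show ?thesis
    by (simp add: closed_densely_defined_def linear_on_subspace_def subspace_D dense B_add B_scale algebra_simps)
qed

lemma solution_family_shift:
  assumes "solution_family D A S C \<omega> r \<mu>"
  shows "solution_family D (\<lambda>x. A x + c *\<^sub>R x) (\<lambda>t x. exp (- c * t) *\<^sub>R S t x) C (\<omega> - c) r (\<mu> - c)"
proof -
  interpret solution_family D A S C \<omega> r \<mu> by fact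
  show ?thesis
  proof (rule solution_family.intro[OF closed_dense_operator.intro], goal_cases)
    case 1
    show ?case by (rule closed_densely_defined_shift[OF closed_dense])
  next
    case 2
    show ?case
  proof (rule solution_family_axioms.intro)
    fix t x assume "0 \<le> (t::real)"
    then have "norm (S t x) \<le> C * exp (\<omega> * t) * norm x" by (rule norm_le)
    from mult_left_mono[OF this, of "exp (- c * t)"]
    show "norm (exp (- c * t) *\<^sub>R S t x) \<le> C * exp ((\<omega> - c) * t) * norm x"
      by (simp add: algebra_simps mult_exp_exp)
  next
    fix t x assume t: "0 < (t::real)" and x: "x \<in> D"
    have "((\<lambda>t. exp (- c * t) *\<^sub>R S t x) has_vector_derivative (exp (- c * t) *\<^sub>R (- S t (A x)) + (- c * exp (- c * t)) *\<^sub>R S t x)) (at t)"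
      by (intro has_vector_derivative_scaleR S_derivative[OF t x]) (auto intro!: derivative_eq_intros)
    moreover have "exp (- c * t) *\<^sub>R (- S t (A x)) + (- c * exp (- c * t)) *\<^sub>R S t x = - (exp (- c * t) *\<^sub>R S t (A x + c *\<^sub>R x))"
      using t by (simp add: add scale algebra_simps)
    ultimately show "((\<lambda>t. exp (- c * t) *\<^sub>R S t x) has_vector_derivative - (exp (- c * t) *\<^sub>R S t (A x + c *\<^sub>R x))) (at t)" by simp
  next
    fix x assume x: "x \<in> D"
    have "((\<lambda>t. exp (- c * t) *\<^sub>R S t x) \<longlongrightarrow> exp (- c * 0) *\<^sub>R x) (at_right 0)"
      by (intro tendsto_intros S_at_0 x)
    then show "((\<lambda>t. exp (- c * t) *\<^sub>R S t x) \<longlongrightarrow> x) (at_right 0)" by simp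
  next
    fix x
    show "(\<mu> - c) *\<^sub>R r x + (A (r x) + c *\<^sub>R r x) = x"
      using r_eq[of x] by (simp add: scaleR_diff_left add.commute)
  qed (simp_all add: add scale S_0 S_in A_S S_r bounded_linear_r r_in D_scale B_scale scaleR_add_right
      linear_scale[OF bounded_linear.linear[OF bounded_linear_r]] mult.commute)
  qed
qed

lemma (in vertical_resolvent) solution_family_S: "solution_family D B S (max 1 (K\<^sup>2 * exp 1)) 0 r 1"
proof (rule solution_family.intro[OF closed_dense_operator_axioms], rule solution_family_axioms.intro)
  show "norm (S t x) \<le> max 1 (K\<^sup>2 * exp 1) * exp (0 * t) * norm x" if "0 \<le> t" for t x
    using norm_S_le[OF that] by simp
qed (simp_all add: S_add S_scaleR S_invariant S_derivative S_tendsto_0 bounded_linear_r r_in r_eq[simplified] S_r, simp add: S_def)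

subsection \<open>The spectrum of a sectorial operator\<close>

definition resolvent_bound :: "'x::banach set \<Rightarrow> ('x \<Rightarrow> 'x) \<Rightarrow> complex \<Rightarrow> real \<Rightarrow> bool" where
  "resolvent_bound D A z K \<longleftrightarrow> z \<in> resolvent_set UNIV D A \<and> (\<forall>w\<in>D \<times> D. norm w \<le> K * norm (cshift A z w))"

lemma cshift_shift: "cshift (\<lambda>x. A x + c *\<^sub>R x) z = cshift A (z - of_real c)"
  by (auto simp: cshift_def algebra_simps)

lemma resolvent_bound_shift:
  "resolvent_bound D (\<lambda>x. A x + c *\<^sub>R x) z K \<longleftrightarrow> resolvent_bound D A (z - of_real c) K"
  by (simp add: resolvent_bound_def resolvent_set_def cshift_shift)

lemma resolvent_bound_mono:
  assumes "resolvent_bound D A z K" "K \<le> K'"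
  shows "resolvent_bound D A z K'"
  unfolding resolvent_bound_def
proof (intro conjI ballI)
  show "z \<in> resolvent_set UNIV D A" using assms by (simp add: resolvent_bound_def)
  fix w assume "w \<in> D \<times> D"
  then have "norm w \<le> K * norm (cshift A z w)" using assms unfolding resolvent_bound_def by blast
  also have "\<dots> \<le> K' * norm (cshift A z w)" using assms(2) by (intro mult_right_mono) auto
  finally show "norm w \<le> K' * norm (cshift A z w)" .
qed

lemma resolvent_set_bound:
  assumes "z \<in> resolvent_set UNIV D A"
  obtains K where "K > 0" "resolvent_bound D A z K"
proof -
  obtain K where "resolvent_bound D A z K" using assms unfolding resolvent_bound_def resolvent_set_def by blast
  then have "resolvent_bound D A z (max K 1)" by (rule resolvent_bound_mono) simp
  then show ?thesis using that[of "max K 1"] by simp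
qed

lemma cshift_change: "cshift A z w = cshift A z0 w + cscale (z - z0) w"
  by (cases w) (simp add: cshift_def cscale_def algebra_simps)

lemma resolvent_bound_perturb:
  assumes "resolvent_bound D A z0 K" "K > 0" "cmod (z - z0) \<le> 1 / (4 * K)"
    and lin: "linear_on_subspace D A"
  shows "resolvent_bound D A z (2 * K)"
proof -
  have bij: "bij_betw (cshift A z0) (D \<times> D) UNIV" and le0: "\<And>w. w \<in> D \<times> D \<Longrightarrow> norm w \<le> K * norm (cshift A z0 w)"
    using assms(1) unfolding resolvent_bound_def resolvent_set_def UNIV_Times_UNIV by blast+
  have sub: "subspace D" using lin by (simp add: linear_on_subspace_def)
  have A_diff: "A (x - y) = A x - A y" if "x \<in> D" "y \<in> D" for x y
  proof -
    have "A (x - y + y) = A (x - y) + A y" using lin that subspace_diff[OF sub] unfolding linear_on_subspace_def by blast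
    then show ?thesis by simp
  qed
  have diff: "cshift A y (w - w') = cshift A y w - cshift A y w'" if "w \<in> D \<times> D" "w' \<in> D \<times> D" for w w' y
    using that by (auto simp: cshift_def A_diff algebra_simps)
  have DD: "w - w' \<in> D \<times> D" if "w \<in> D \<times> D" "w' \<in> D \<times> D" for w w'
    using that sub by (auto simp: subspace_diff)
  have half: "K * norm (cscale (z - z0) w) \<le> 1/2 * norm w" for w
  proof -
    have "K * norm (cscale (z - z0) w) \<le> K * (cmod (z - z0) * norm w * 2)"
      using assms(2) norm_cscale_le[of "z - z0" w] by (intro mult_left_mono) auto
    also have "\<dots> \<le> K * (1 / (4 * K) * norm w * 2)"
      using assms(2,3) by (intro mult_left_mono mult_right_mono) auto
    also have "\<dots> = 1/2 * norm w" using assms(2) by simp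
    finally show ?thesis .
  qed
  have le: "norm w \<le> 2 * K * norm (cshift A z w)" if "w \<in> D \<times> D" for w
  proof -
    have "norm (cshift A z0 w) = norm (cshift A z w - cscale (z - z0) w)" by (simp add: cshift_change[of A z w z0])
    also have "\<dots> \<le> norm (cshift A z w) + norm (cscale (z - z0) w)" by (rule norm_triangle_ineq4)
    finally have "K * norm (cshift A z0 w) \<le> K * norm (cshift A z w) + K * norm (cscale (z - z0) w)"
      using assms(2) by (simp add: distrib_left[symmetric])
    then show ?thesis using le0[OF that] half[of w] by simp
  qed
  define R where "R = inv_into (D \<times> D) (cshift A z0)"
  have R: "R v \<in> D \<times> D" "cshift A z0 (R v) = v" for v
    using bij unfolding R_def bij_betw_def by (auto intro: inv_into_into f_inv_into_f)
  have surj: "\<exists>w\<in>D \<times> D. cshift A z w = v" for v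
  proof -
    have "dist (R (v - cscale (z - z0) w)) (R (v - cscale (z - z0) w')) \<le> 1/2 * dist w w'" for w w'
    proof -
      let ?d = "R (v - cscale (z - z0) w) - R (v - cscale (z - z0) w')"
      have "?d \<in> D \<times> D" by (rule DD[OF R(1) R(1)])
      then have "norm ?d \<le> K * norm (cshift A z0 ?d)" by (rule le0)
      also have "cshift A z0 ?d = - cscale (z - z0) (w - w')"
        unfolding diff[OF R(1) R(1)] R(2) by (simp add: cscale_diff_right)
      also have "K * norm (- cscale (z - z0) (w - w')) \<le> 1/2 * norm (w - w')" using half[of "w - w'"] by simp
      finally show ?thesis by (simp add: dist_norm)
    qed
    then have "\<exists>!w. R (v - cscale (z - z0) w) = w" by (intro banach_fix_type[of "1/2"]) auto
    then obtain w where w: "R (v - cscale (z - z0) w) = w" by blast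
    then have "w \<in> D \<times> D" "cshift A z0 w = v - cscale (z - z0) w" using R[of "v - cscale (z - z0) w"] by simp_all
    then show ?thesis using cshift_change[of A z w z0] by auto
  qed
  have "inj_on (cshift A z) (D \<times> D)"
  proof (rule inj_onI)
    fix w w' assume w: "w \<in> D \<times> D" "w' \<in> D \<times> D" and eq: "cshift A z w = cshift A z w'"
    have "norm (w - w') \<le> 2 * K * norm (cshift A z (w - w'))" by (rule le[OF DD[OF w]])
    then show "w = w'" using eq by (simp add: diff[OF w])
  qed
  moreover have "cshift A z ` (D \<times> D) = UNIV" using surj by (metis UNIV_eq_I imageI)
  ultimately have "bij_betw (cshift A z) (D \<times> D) (UNIV \<times> UNIV)" by (simp add: bij_betw_def)
  then show ?thesis unfolding resolvent_bound_def resolvent_set_def using le by blast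
qed

lemma resolvent_bound_compact:
  assumes lin: "linear_on_subspace D A" and Q: "\<And>z. Re z \<le> 0 \<Longrightarrow> z \<in> resolvent_set UNIV D A"
  shows "\<exists>\<epsilon>>0. \<exists>K. \<forall>z. Re z < \<epsilon> \<and> cmod (z - b) \<le> \<rho> \<longrightarrow> resolvent_bound D A z K"
proof (rule ccontr)
  assume neg: "\<not> ?thesis"
  have "\<exists>z. Re z < 1 / real (Suc n) \<and> cmod (z - b) \<le> \<rho> \<and> \<not> resolvent_bound D A z (real n)" for n
  proof (rule ccontr)
    assume "\<not> ?thesis"
    then have "\<forall>z. Re z < 1 / real (Suc n) \<and> cmod (z - b) \<le> \<rho> \<longrightarrow> resolvent_bound D A z (real n)" by blast
    moreover have "1 / real (Suc n) > 0" by simp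
    ultimately show False using neg by blast
  qed
  then obtain z where z: "\<And>n. Re (z n) < 1 / real (Suc n)" "\<And>n. cmod (z n - b) \<le> \<rho>" "\<And>n. \<not> resolvent_bound D A (z n) (real n)"
    by metis
  have "\<forall>n. z n \<in> cball b \<rho>" using z(2) by (simp add: dist_norm norm_minus_commute)
  then obtain l q where q: "strict_mono (q :: nat \<Rightarrow> nat)" "(z \<circ> q) \<longlonglongrightarrow> l"
    using compact_cball[of b \<rho>] unfolding compact_def by meson
  have "Re l \<le> 0"
  proof (rule LIMSEQ_le)
    show "(\<lambda>n. Re ((z \<circ> q) n)) \<longlonglongrightarrow> Re l" by (intro tendsto_Re q)
    have "(\<lambda>n. 1 / real (Suc n)) \<longlonglongrightarrow> 0" using LIMSEQ_inverse_real_of_nat by (simp add: inverse_eq_divide)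
    then show "((\<lambda>n. 1 / real (Suc n)) \<circ> q) \<longlonglongrightarrow> 0" by (rule LIMSEQ_subseq_LIMSEQ[OF _ q(1)])
    show "\<exists>N. \<forall>n\<ge>N. Re ((z \<circ> q) n) \<le> ((\<lambda>n. 1 / real (Suc n)) \<circ> q) n" using z(1) by (auto intro: less_imp_le)
  qed
  then obtain K where K: "K > 0" "resolvent_bound D A l K" using resolvent_set_bound Q by blast
  have "\<forall>\<^sub>F n in sequentially. dist ((z \<circ> q) n) l < 1 / (4 * K)" by (rule tendstoD[OF q(2)]) (use K(1) in simp)
  moreover have "\<forall>\<^sub>F n in sequentially. 2 * K \<le> real n"
    using filterlim_real_sequentially by (auto simp: filterlim_at_top)
  ultimately have "\<forall>\<^sub>F n in sequentially. False"
  proof eventually_elim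
    case (elim n)
    have "resolvent_bound D A (z (q n)) (2 * K)"
      by (rule resolvent_bound_perturb[OF K(2,1) _ lin]) (use elim(1) in \<open>simp add: dist_norm\<close>)
    then have "resolvent_bound D A (z (q n)) (real (q n))"
      by (rule resolvent_bound_mono) (use elim(2) seq_suble[OF q(1), of n] in linarith)
    then show ?case using z(3) by blast
  qed
  then show False by simp
qed

lemma sectorial_vertical_resolvent:
  assumes sect: "sectorial D A" and pos: "\<forall>z\<in>spectrum UNIV D (\<lambda>x. A x + a *\<^sub>R x). Re z > 0"
  shows "\<exists>\<delta>>0. \<exists>K. vertical_resolvent D (\<lambda>x. (A x + a *\<^sub>R x) + (- \<delta>) *\<^sub>R x) K"
proof -
  let ?L = "\<lambda>x. A x + a *\<^sub>R x"
  have cdd: "closed_densely_defined D A" using sect by (simp add: sectorial_def)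
  have cddL: "closed_densely_defined D ?L" by (rule closed_densely_defined_shift[OF cdd])
  then have lin: "linear_on_subspace D ?L" by (simp add: closed_densely_defined_def)
  obtain b \<phi> K where \<phi>: "0 < \<phi>" "\<phi> < pi / 2" and K: "K \<ge> (1::real)"
    and sec: "\<And>z. z \<noteq> of_real b \<Longrightarrow> \<phi> \<le> \<bar>Arg (z - of_real b)\<bar> \<Longrightarrow> z \<in> resolvent_set UNIV D A \<and>
          (\<forall>w. norm (resolvent D A z w) \<le> K / cmod (z - of_real b) * norm w)"
    using sect unfolding sectorial_def by blast
  define b' where "b' = b + a"
  have sector: "resolvent_bound D ?L z (K / cmod (z - of_real b'))" if "z \<noteq> of_real b'" "\<phi> \<le> \<bar>Arg (z - of_real b')\<bar>" for z
  proof -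
    let ?z = "z - of_real a"
    have eq: "?z - of_real b = z - of_real b'" by (simp add: b'_def)
    have s: "?z \<in> resolvent_set UNIV D A" "\<And>w. norm (resolvent D A ?z w) \<le> K / cmod (?z - of_real b) * norm w"
      using sec[of ?z] that unfolding eq by (auto simp: b'_def algebra_simps)
    have "norm w \<le> K / cmod (?z - of_real b) * norm (cshift A ?z w)" if "w \<in> D \<times> D" for w
    proof -
      have "resolvent D A ?z (cshift A ?z w) = w"
        unfolding resolvent_def using s(1) that by (intro inv_into_f_f) (auto simp: resolvent_set_def bij_betw_def)
      then show ?thesis using s(2)[of "cshift A ?z w"] by simp
    qed
    then show ?thesis unfolding resolvent_bound_shift using s(1) by (simp add: resolvent_bound_def eq)
  qed
  have cosp: "cos \<phi> > 0" using \<phi> by (intro cos_gt_zero_pi) auto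
  define \<rho> where "\<rho> = (\<bar>b'\<bar> + 2) / cos \<phi>"
  have \<rho>: "\<rho> \<ge> \<bar>b'\<bar> + 2"
  proof -
    have "(\<bar>b'\<bar> + 2) * cos \<phi> \<le> (\<bar>b'\<bar> + 2) * 1" by (intro mult_left_mono) auto
    then show ?thesis using cosp by (simp add: \<rho>_def pos_le_divide_eq)
  qed
  have far: "\<phi> \<le> \<bar>Arg (z - of_real b')\<bar>" if "Re z < 1" "\<rho> < cmod (z - of_real b')" for z
  proof (rule ccontr)
    assume "\<not> ?thesis"
    then have less: "\<bar>Arg (z - of_real b')\<bar> < \<phi>" by simp
    let ?w = "z - complex_of_real b'"
    have nz: "?w \<noteq> 0" using that \<rho> by auto
    have "cos \<phi> \<le> cos \<bar>Arg ?w\<bar>" using less \<phi> by (intro cos_monotone_0_pi_le) auto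
    also have "\<dots> = Re ?w / cmod ?w" using cos_Arg[OF nz] by simp
    finally have "cos \<phi> * cmod ?w \<le> Re ?w" using nz by (simp add: pos_le_divide_eq)
    moreover have "cos \<phi> * \<rho> < cos \<phi> * cmod ?w" using that cosp by (intro mult_strict_left_mono) auto
    moreover have "cos \<phi> * \<rho> = \<bar>b'\<bar> + 2" using cosp by (simp add: \<rho>_def)
    ultimately show False using that(1) by simp
  qed
  have res0: "z \<in> resolvent_set UNIV D ?L" if "Re z \<le> 0" for z
  proof (rule ccontr)
    assume "z \<notin> resolvent_set UNIV D ?L"
    then have "z \<in> spectrum UNIV D ?L" by (simp add: spectrum_def)
    then show False using pos that by fastforce
  qed
  obtain \<epsilon> K1 where \<epsilon>: "\<epsilon> > 0" and K1: "\<And>z. Re z < \<epsilon> \<Longrightarrow> cmod (z - of_real b') \<le> \<rho> \<Longrightarrow> resolvent_bound D ?L z K1"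
    using resolvent_bound_compact[OF lin res0, of "of_real b'" \<rho>] by blast
  define \<delta> where "\<delta> = min \<epsilon> 1"
  have \<delta>: "0 < \<delta>" "\<delta> \<le> \<epsilon>" "\<delta> \<le> 1" using \<epsilon> by (auto simp: \<delta>_def)
  define K2 where "K2 = max (2 * K) (\<bar>K1\<bar> * (2 * \<rho>))"
  have main: "resolvent_bound D ?L z (K2 / cmod (z - of_real \<delta>))" if z: "Re z < \<delta>" for z
  proof -
    have dist: "cmod (z - of_real \<delta>) \<le> cmod (z - of_real b') + (\<bar>b'\<bar> + 1)"
    proof -
      have "cmod (z - of_real \<delta>) \<le> cmod (z - of_real b') + cmod (of_real b' - of_real \<delta>)"
        using norm_triangle_ineq[of "z - of_real b'" "of_real b' - of_real \<delta>"] by simp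
      also have "cmod (of_real b' - of_real \<delta>) \<le> \<bar>b'\<bar> + 1"
        unfolding of_real_diff[symmetric] norm_of_real using \<delta> by linarith
      finally show ?thesis by simp
    qed
    have pos: "cmod (z - of_real \<delta>) > 0" using z by auto
    show ?thesis
    proof (cases "cmod (z - of_real b') \<le> \<rho>")
      case True
      have "cmod (z - of_real \<delta>) \<le> 2 * \<rho>" using dist True \<rho> by linarith
      then have "\<bar>K1\<bar> * cmod (z - of_real \<delta>) \<le> \<bar>K1\<bar> * (2 * \<rho>)" by (intro mult_left_mono) auto
      then have "\<bar>K1\<bar> * cmod (z - of_real \<delta>) \<le> K2" by (simp add: K2_def)
      then have "\<bar>K1\<bar> \<le> K2 / cmod (z - of_real \<delta>)" using pos by (simp add: pos_le_divide_eq)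
      moreover have "resolvent_bound D ?L z K1" using K1 z \<delta> True by auto
      ultimately show ?thesis by (elim resolvent_bound_mono) linarith
    next
      case False
      then have far': "\<rho> < cmod (z - of_real b')" by simp
      have "cmod (z - of_real \<delta>) \<le> 2 * cmod (z - of_real b')" using dist far' \<rho> by linarith
      then have "K * cmod (z - of_real \<delta>) \<le> K * (2 * cmod (z - of_real b'))" using K by (intro mult_left_mono) auto
      also have "\<dots> \<le> K2 * cmod (z - of_real b')"
        using mult_right_mono[of "2 * K" K2 "cmod (z - of_real b')"] by (simp add: K2_def)
      finally have le: "K * cmod (z - of_real \<delta>) \<le> K2 * cmod (z - of_real b')" .
      have pos': "cmod (z - of_real b') > 0" using far' \<rho> by linarith
      have "K / cmod (z - of_real b') \<le> K2 / cmod (z - of_real \<delta>)"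
        by (subst pos_divide_le_eq[OF pos'], subst times_divide_eq_left, subst pos_le_divide_eq[OF pos]) (rule le)
      moreover have "z \<noteq> of_real b'" using far' \<rho> by auto
      moreover have "\<phi> \<le> \<bar>Arg (z - of_real b')\<bar>" by (rule far[OF _ far']) (use z \<delta> in linarith)
      ultimately show ?thesis using sector resolvent_bound_mono by blast
    qed
  qed
  have "vertical_resolvent D (\<lambda>x. ?L x + (- \<delta>) *\<^sub>R x) K2"
  proof (intro vertical_resolvent.intro closed_dense_operator.intro vertical_resolvent_axioms.intro)
    show "closed_densely_defined D (\<lambda>x. ?L x + (- \<delta>) *\<^sub>R x)" by (rule closed_densely_defined_shift[OF cddL])
    show "0 \<le> K2" using K by (simp add: K2_def)
    fix z :: complex assume z: "0 < Re z"
    have "resolvent_bound D ?L (of_real \<delta> - z) (K2 / cmod (of_real \<delta> - z - of_real \<delta>))"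
      by (rule main) (use z in simp)
    then have rb: "resolvent_bound D (\<lambda>x. ?L x + (- \<delta>) *\<^sub>R x) (- z) (K2 / cmod z)"
      unfolding resolvent_bound_shift by (simp add: add.commute)
    then show "- z \<in> resolvent_set UNIV D (\<lambda>x. ?L x + (- \<delta>) *\<^sub>R x)" by (simp only: resolvent_bound_def)
    fix w assume "w \<in> D \<times> D"
    then have "norm w \<le> K2 / cmod z * norm (cshift (\<lambda>x. ?L x + (- \<delta>) *\<^sub>R x) (- z) w)"
      using rb unfolding resolvent_bound_def by blast
    moreover have "cmod z > 0" using z by auto
    ultimately show "norm w * cmod z \<le> K2 * norm (cshift (\<lambda>x. ?L x + (- \<delta>) *\<^sub>R x) (- z) w)"
      by (simp add: field_simps)
  qed
  then show ?thesis using \<delta>(1) by blast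
qed

lemma sectorial_solution_families:
  assumes sect: "sectorial D A" and pos: "\<forall>z\<in>spectrum UNIV D (\<lambda>x. A x + a *\<^sub>R x). Re z > 0"
  obtains S C \<delta> r \<mu> where "\<delta> > 0" "solution_family D (\<lambda>x. A x + a *\<^sub>R x) S C (- \<delta>) r \<mu>"
    "solution_family D A (\<lambda>t x. exp (a * t) *\<^sub>R S t x) C (a - \<delta>) r (\<mu> + a)"
proof -
  obtain \<delta> K where \<delta>: "\<delta> > 0" and vr: "vertical_resolvent D (\<lambda>x. (A x + a *\<^sub>R x) + (- \<delta>) *\<^sub>R x) K"
    using sectorial_vertical_resolvent[OF assms] by blast
  obtain S C r \<mu> where "solution_family D (\<lambda>x. (A x + a *\<^sub>R x) + (- \<delta>) *\<^sub>R x) S C 0 r \<mu>"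
    using vertical_resolvent.solution_family_S[OF vr] by blast
  from solution_family_shift[OF this, of \<delta>]
  have L: "solution_family D (\<lambda>x. A x + a *\<^sub>R x) (\<lambda>t x. exp (- \<delta> * t) *\<^sub>R S t x) C (- \<delta>) r (\<mu> - \<delta>)" by simp
  from solution_family_shift[OF this, of "- a"]
  have "solution_family D A (\<lambda>t x. exp (a * t) *\<^sub>R (exp (- \<delta> * t) *\<^sub>R S t x)) C (a - \<delta>) r (\<mu> - \<delta> + a)" by simp
  then show ?thesis using that[OF \<delta> L] by simp
qed

subsection \<open>Fractional powers\<close>

definition kern :: "real \<Rightarrow> real \<Rightarrow> real \<Rightarrow> real" where
  "kern \<gamma> \<delta> t = (if 0 < t then t powr (- \<gamma>) * exp (- \<delta> * t) else 0)"

lemma kern_nonneg: "0 \<le> kern \<gamma> \<delta> t"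
  by (simp add: kern_def)

lemma integrable_kern:
  assumes "\<gamma> < 1" "\<delta> > 0"
  shows "kern \<gamma> \<delta> integrable_on UNIV"
proof -
  let ?f = "\<lambda>t. complex_of_real t powr (of_real (1 - \<gamma>) - 1) / of_real (exp (\<delta> * t))"
  have "?f absolutely_integrable_on {0<..}"
    by (rule absolutely_integrable_Gamma_integral) (use assms in auto)
  then have "(\<lambda>t. norm (?f t)) integrable_on {0<..}"
    by (rule absolutely_integrable_on_def[THEN iffD1, THEN conjunct2])
  then have "(\<lambda>t. t powr (- \<gamma>) * exp (- \<delta> * t)) integrable_on {0<..}"
    by (rule integrable_eq) (auto simp: norm_mult norm_inverse norm_powr_real_powr exp_minus divide_inverse)
  then have "(\<lambda>t. if t \<in> {0<..} then t powr (- \<gamma>) * exp (- \<delta> * t) else 0) integrable_on UNIV"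
    by (simp only: integrable_restrict_UNIV)
  then show ?thesis by (simp add: kern_def[abs_def])
qed

lemma integrable_lborel_if_nonneg:
  fixes f :: "real \<Rightarrow> real"
  assumes "f \<in> borel_measurable borel" "\<And>x. 0 \<le> f x" "f integrable_on UNIV"
  shows "integrable lborel f" "integral\<^sup>L lborel f = integral UNIV f"
proof -
  have "(f has_integral integral UNIV f) UNIV" using assms(3) by (rule integrable_integral)
  then have "integral\<^sup>N lborel f = integral UNIV f" using assms(1,2) by (intro nn_integral_has_integral_lborel) auto
  then show 1: "integrable lborel f" using assms(1,2) by (intro integrableI_nonneg) auto
  show "integral\<^sup>L lborel f = integral UNIV f" using integral_lborel[OF 1] by simp
qed

lemma has_integral_beta_kernel:
  fixes v :: real
  assumes "0 < \<alpha>" "\<alpha> < 1" "0 < v"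
  shows "((\<lambda>u. if 0 < u \<and> u < v then u powr (- \<alpha>) * (v - u) powr (\<alpha> - 1) else 0) has_integral Beta (1 - \<alpha>) \<alpha>) UNIV"
proof -
  let ?h = "\<lambda>t::real. t powr (1 - \<alpha> - 1) * (1 - t) powr (\<alpha> - 1)"
  let ?f = "\<lambda>u. u powr (- \<alpha>) * (v - u) powr (\<alpha> - 1)"
  have "(?h has_integral Beta (1 - \<alpha>) \<alpha>) (cbox 0 1)" using has_integral_Beta_real[of "1 - \<alpha>" \<alpha>] assms by simp
  from has_integral_affinity'[OF this, of "1 / v" 0] assms(3)
  have "((\<lambda>u. ?h (u / v)) has_integral Beta (1 - \<alpha>) \<alpha> * v) {0..v}" by (simp add: mult.commute)
  from has_integral_mult_right[OF this, of "1 / v"]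
  have I: "((\<lambda>u. 1 / v * ?h (u / v)) has_integral Beta (1 - \<alpha>) \<alpha>) {0..v}" using assms(3) by simp
  have pt: "?f u = 1 / v * ?h (u / v)" if "0 < u" "u < v" for u
  proof -
    have "1 - u / v = (v - u) / v" using assms(3) by (simp add: diff_divide_distrib)
    define a where "a = v powr (- \<alpha>)"
    define b where "b = v powr (\<alpha> - 1)"
    have ab: "a > 0" "b > 0" using assms(3) by (simp_all add: a_def b_def)
    have "a * b = v powr (- 1)" unfolding a_def b_def by (simp add: powr_add[symmetric])
    then have ab1: "1 / v = a * b" using assms(3) by (simp add: powr_minus_divide)
    have e1: "(u / v) powr (1 - \<alpha> - 1) = u powr (- \<alpha>) / a"
      unfolding a_def using that assms(3) by (simp add: powr_divide)
    have e2: "(1 - u / v) powr (\<alpha> - 1) = (v - u) powr (\<alpha> - 1) / b"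
      unfolding b_def \<open>1 - u / v = (v - u) / v\<close> using that assms(3) by (simp add: powr_divide)
    have "1 / v * ?h (u / v) = (a * b) * ((u powr (- \<alpha>) / a) * ((v - u) powr (\<alpha> - 1) / b))"
      by (simp only: ab1 e1 e2)
    then show ?thesis using ab by simp
  qed
  have "((\<lambda>u. if 0 < u \<and> u < v then ?f u else 0) has_integral Beta (1 - \<alpha>) \<alpha>) {0..v}"
    by (rule has_integral_spike_finite[OF _ _ I, of "{0, v}"]) (use pt in auto)
  then show ?thesis by (rule has_integral_on_superset) auto
qed

text \<open>Convolving the fractional integral of order \<open>\<alpha>\<close> with the kernel of order \<open>1 - \<alpha>\<close> gives the
  integral of \<open>g\<close> up to the factor \<open>Beta (1 - \<alpha>) \<alpha>\<close>.\<close>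

lemma fractional_integral_zero:
  fixes g :: "real \<Rightarrow> real"
  assumes \<alpha>: "0 < \<alpha>" "\<alpha> < 1" and \<delta>: "0 < \<delta>" and g: "continuous_on UNIV g"
    and le: "\<And>v. 0 \<le> v \<Longrightarrow> \<bar>g v\<bar> \<le> c * exp (- \<delta> * v)"
    and zero: "\<And>u. 0 \<le> u \<Longrightarrow> ((\<lambda>t. if 0 < t then t powr (\<alpha> - 1) * g (t + u) else 0) has_integral 0) UNIV"
  shows "((\<lambda>v. if 0 < v then g v else 0) has_integral 0) UNIV"
proof -
  define k where "k v u = (if 0 < u \<and> u < v then u powr (- \<alpha>) * (v - u) powr (\<alpha> - 1) else 0)" for u v :: real
  define F where "F = (\<lambda>v u. k v u * g v)"
  define \<beta> where "\<beta> = Beta (1 - \<alpha>) \<alpha>"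
  have gm[measurable]: "g \<in> borel_measurable borel" using g by (rule borel_measurable_continuous_onI)
  have km[measurable]: "(\<lambda>(v, u). k v u) \<in> borel_measurable (lborel \<Otimes>\<^sub>M lborel)" unfolding k_def by measurable
  have kI: "(k v has_integral \<beta>) UNIV" if "0 < v" for v
    using has_integral_beta_kernel[OF \<alpha> that] by (simp add: k_def[abs_def] \<beta>_def)
  have k0: "0 \<le> k v u" for v u by (simp add: k_def)
  have k_int: "integrable lborel (k v) \<and> integral\<^sup>L lborel (k v) = (if 0 < v then \<beta> else 0)" for v
  proof (cases "0 < v")
    case True
    have m: "k v \<in> borel_measurable borel" unfolding k_def[abs_def] by measurable
    have "k v integrable_on UNIV" using kI[OF True] by (rule has_integral_integrable)
    from integrable_lborel_if_nonneg[OF m k0 this] integral_unique[OF kI[OF True]] True show ?thesis by simp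
  next
    case False
    then have "k v = (\<lambda>u. 0)" by (auto simp: k_def)
    then show ?thesis using False by simp
  qed
  have \<beta>0: "0 < \<beta>" using \<alpha> by (simp add: \<beta>_def Beta_def Gamma_real_pos)
  have gint: "integrable lborel (\<lambda>v. if 0 < v then g v else 0)"
  proof (rule Bochner_Integration.integrable_bound[where f = "\<lambda>v. c * kern 0 \<delta> v"])
    have "kern 0 \<delta> \<in> borel_measurable borel" unfolding kern_def[abs_def] by measurable
    then have "integrable lborel (kern 0 \<delta>)"
      by (rule integrable_lborel_if_nonneg(1)[OF _ kern_nonneg integrable_kern]) (use \<delta> in auto)
    then show "integrable lborel (\<lambda>v. c * kern 0 \<delta> v)" by simp
    show "(\<lambda>v. if 0 < v then g v else 0) \<in> borel_measurable lborel" by measurable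
    show "AE v in lborel. norm (if 0 < v then g v else 0) \<le> norm (c * kern 0 \<delta> v)"
    proof (rule AE_I2)
      fix v :: real
      show "norm (if 0 < v then g v else 0) \<le> norm (c * kern 0 \<delta> v)"
        using le[of v] by (cases "0 < v") (simp_all add: kern_def)
    qed
  qed
  have "integrable (lborel \<Otimes>\<^sub>M lborel) (case_prod F)"
  proof (rule lborel_pair.Fubini_integrable[where f = "case_prod F"])
    show "case_prod F \<in> borel_measurable (lborel \<Otimes>\<^sub>M lborel)" unfolding F_def by measurable
    have "(\<lambda>v. \<integral>u. norm (case_prod F (v, u)) \<partial>lborel) = (\<lambda>v. \<bar>if 0 < v then g v else 0\<bar> * \<beta>)"
      using k_int by (auto simp: F_def abs_mult k0)
    then show "integrable lborel (\<lambda>v. \<integral>u. norm (case_prod F (v, u)) \<partial>lborel)" using gint by simp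
    show "AE v in lborel. integrable lborel (\<lambda>u. case_prod F (v, u))" using k_int by (auto simp: F_def)
  qed
  note Fint = this
  have swap: "(\<integral>u. (\<integral>v. F v u \<partial>lborel) \<partial>lborel) = (\<integral>v. (\<integral>u. F v u \<partial>lborel) \<partial>lborel)"
    by (rule lborel_pair.Fubini_integral[where f = F, OF Fint])
  have "(\<integral>v. F v u \<partial>lborel) = 0" for u
  proof (cases "0 < u \<and> integrable lborel (\<lambda>v. F v u)")
    case True
    then have u: "0 < u" by simp
    have "((\<lambda>t. if 0 < t then t powr (\<alpha> - 1) * g (t + u) else 0) has_integral 0) UNIV" using zero u by simp
    from has_integral_mult_right[OF has_integral_shift_UNIV[OF this, of "- u"], of "u powr (- \<alpha>)"]
    have "((\<lambda>v. u powr (- \<alpha>) * (if 0 < v - u then (v - u) powr (\<alpha> - 1) * g v else 0)) has_integral 0) UNIV" by (simp cong: if_cong)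
    moreover have "(\<lambda>v. u powr (- \<alpha>) * (if 0 < v - u then (v - u) powr (\<alpha> - 1) * g v else 0)) = (\<lambda>v. F v u)"
      using u by (auto simp: F_def k_def)
    ultimately have "((\<lambda>v. F v u) has_integral 0) UNIV" by simp
    with has_integral_integral_lborel[OF conjunct2[OF True]] show ?thesis by (rule has_integral_unique)
  next
    case False
    then consider "\<not> 0 < u" | "\<not> integrable lborel (\<lambda>v. F v u)" by blast
    then show ?thesis
    proof cases
      case 1
      then have "(\<lambda>v. F v u) = (\<lambda>v. 0)" by (auto simp: F_def k_def)
      then show ?thesis by simp
    next
      case 2
      then show ?thesis by (rule not_integrable_integral_eq)
    qed
  qed
  then have "(\<integral>v. (\<integral>u. F v u \<partial>lborel) \<partial>lborel) = 0" using swap by simp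
  moreover have "(\<lambda>v. \<integral>u. F v u \<partial>lborel) = (\<lambda>v. \<beta> * (if 0 < v then g v else 0))" using k_int by (auto simp: F_def)
  ultimately have "(\<integral>v. (if 0 < v then g v else 0) \<partial>lborel) = 0" using \<beta>0 by simp
  then show ?thesis using has_integral_integral_lborel[OF gint] by simp
qed

lemma fractional_integral_injective:
  fixes g :: "real \<Rightarrow> real"
  assumes \<alpha>: "0 < \<alpha>" "\<alpha> < 1" and \<delta>: "0 < \<delta>" and g: "continuous_on UNIV g" and "0 \<le> c"
    and le: "\<And>v. 0 \<le> v \<Longrightarrow> \<bar>g v\<bar> \<le> c * exp (- \<delta> * v)"
    and zero: "\<And>u. 0 \<le> u \<Longrightarrow> ((\<lambda>t. if 0 < t then t powr (\<alpha> - 1) * g (t + u) else 0) has_integral 0) UNIV"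
  shows "g 0 = 0"
proof -
  have tail: "((\<lambda>v. if w < v then g v else 0) has_integral 0) UNIV" if w: "0 \<le> w" for w
  proof -
    have "((\<lambda>v. if 0 < v then g (v + w) else 0) has_integral 0) UNIV"
    proof (rule fractional_integral_zero[where g = "\<lambda>v. g (v + w)" and c = c, OF \<alpha> \<delta>])
      show "continuous_on UNIV (\<lambda>v. g (v + w))"
        by (rule continuous_on_compose2[OF g]) (auto intro: continuous_intros)
      show "\<bar>g (v + w)\<bar> \<le> c * exp (- \<delta> * v)" if "0 \<le> v" for v
      proof -
        have "\<bar>g (v + w)\<bar> \<le> c * exp (- \<delta> * (v + w))" using that w by (intro le) auto
        also have "\<dots> \<le> c * exp (- \<delta> * v)" using w \<delta> \<open>0 \<le> c\<close> by (intro mult_left_mono) auto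
        finally show ?thesis .
      qed
      show "((\<lambda>t. if 0 < t then t powr (\<alpha> - 1) * g (t + u + w) else 0) has_integral 0) UNIV" if "0 \<le> u" for u
        using zero[of "u + w"] that w by (simp add: add.assoc cong: if_cong)
    qed
    from has_integral_shift_UNIV[OF this, of "- w"] show ?thesis by (simp cong: if_cong)
  qed
  have I: "integral {0..w} g = 0" if w: "0 \<le> w" for w
  proof -
    have d: "((\<lambda>v. (if 0 < v then g v else 0) - (if w < v then g v else 0)) has_integral 0) UNIV"
      using has_integral_diff[OF tail[of 0] tail[OF w]] by simp
    have "((\<lambda>v. if v \<in> {0..w} then g v else 0) has_integral 0) UNIV"
      by (rule has_integral_spike_finite[OF _ _ d, of "{0}"]) (use w in auto)
    then have "(g has_integral 0) {0..w}" by (simp only: has_integral_restrict_UNIV)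
    then show ?thesis by (rule integral_unique)
  qed
  have "((\<lambda>w. integral {0..w} g) has_vector_derivative g 0) (at 0 within {0..1})"
    by (rule integral_has_vector_derivative) (auto intro: continuous_on_subset[OF g])
  then have "((\<lambda>w. 0) has_vector_derivative g 0) (at 0 within {0..1})"
    by (rule has_vector_derivative_transform[of 0 "{0..1}" "\<lambda>w. 0", rotated 2]) (simp_all add: I)
  then show ?thesis
    using vector_derivative_unique_within_closed_interval[of 0 1 0 "\<lambda>w. 0" "g 0" 0] has_vector_derivative_const by auto
qed

locale frac_setting = solution_family D L S C "- \<delta>" r \<mu>
  for D :: "'x::banach set" and L :: "'x \<Rightarrow> 'x" and S :: "real \<Rightarrow> 'x \<Rightarrow> 'x" and C \<delta> r \<mu> +
  fixes \<alpha> :: real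
  assumes \<delta>: "0 < \<delta>" and \<alpha>: "0 \<le> \<alpha>" "\<alpha> < 1"
begin

definition J :: "'x \<Rightarrow> 'x" where "J = frac_neg D L \<alpha>"

definition fk :: "'x \<Rightarrow> real \<Rightarrow> 'x" where
  "fk x t = (if 0 < t then t powr (\<alpha> - 1) *\<^sub>R S t x else 0)"

lemma J_0: "\<alpha> = 0 \<Longrightarrow> J x = x"
  unfolding J_def frac_neg_def by simp

lemma J_eq:
  assumes "0 < \<alpha>"
  shows "J x = (1 / Gamma \<alpha>) *\<^sub>R integral UNIV (fk x)"
proof -
  have fk: "fk x = (\<lambda>t. if t \<in> {0..} then (t powr (\<alpha> - 1)) *\<^sub>R exp_semigroup UNIV D L t x else 0)"
    by (rule ext) (auto simp: fk_def exp_semigroup_eq)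
  have "integral {0..} (\<lambda>t. (t powr (\<alpha> - 1)) *\<^sub>R exp_semigroup UNIV D L t x) = integral UNIV (fk x)"
    unfolding fk by (rule integral_restrict_UNIV[symmetric])
  then show ?thesis using assms by (simp add: J_def frac_neg_def)
qed

lemma norm_fk_le: "norm (fk x t) \<le> (C * norm x) * kern (1 - \<alpha>) \<delta> t"
proof (cases "0 < t")
  case True
  then have "norm (S t x) \<le> C * exp (- \<delta> * t) * norm x" using norm_le[of t x] by simp
  from mult_left_mono[OF this, of "t powr (\<alpha> - 1)"] show ?thesis
    using True by (simp add: fk_def kern_def mult_ac)
qed (simp add: fk_def kern_def)

lemma integrable_Ckern: "0 < \<alpha> \<Longrightarrow> (\<lambda>t. K * kern (1 - \<alpha>) \<delta> t) integrable_on UNIV"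
  using integrable_kern[of "1 - \<alpha>" \<delta>] \<delta> by (intro integrable_on_mult_right) auto

lemma integrable_fk:
  assumes "0 < \<alpha>"
  shows "fk x integrable_on UNIV"
proof (rule dominated_integrable_UNIV[where k = "\<lambda>t. (C * norm x) * kern (1 - \<alpha>) \<delta> t", OF _ integrable_Ckern[OF assms] norm_fk_le])
  fix a b :: real assume "b < 0 \<or> 0 < a"
  then show "fk x integrable_on {a..b}"
  proof
    assume "b < 0"
    have "(\<lambda>t::real. 0::'x) integrable_on {a..b}" by (rule integrable_0)
    then show ?thesis by (rule integrable_eq) (use \<open>b < 0\<close> in \<open>auto simp: fk_def\<close>)
  next
    assume a: "0 < a"
    have "continuous_on {a..b} (\<lambda>t. t powr (\<alpha> - 1) *\<^sub>R S t x)"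
      using a by (intro continuous_intros continuous_on_subset[OF continuous_on_S[of b x]]) auto
    then have "(\<lambda>t. t powr (\<alpha> - 1) *\<^sub>R S t x) integrable_on {a..b}" by (rule integrable_continuous_real)
    then show ?thesis by (rule integrable_eq) (use a in \<open>auto simp: fk_def\<close>)
  qed
qed

lemma J_commute:
  assumes P: "bounded_linear P" and PS: "\<And>t x. 0 \<le> t \<Longrightarrow> P (S t x) = S t (P x)"
  shows "J (P x) = P (J x)"
proof (cases "\<alpha> = 0")
  case False
  then have a: "0 < \<alpha>" using \<alpha> by simp
  have "integral UNIV (P \<circ> fk x) = P (integral UNIV (fk x))" by (rule integral_linear[OF integrable_fk[OF a] P])
  moreover have "P \<circ> fk x = fk (P x)"
    using linear_scale[OF bounded_linear.linear[OF P]] linear_0[OF bounded_linear.linear[OF P]] by (auto simp: fk_def PS)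
  ultimately show ?thesis by (simp add: J_eq[OF a] linear_scale[OF bounded_linear.linear[OF P]])
next
  case True
  then have "J y = y" for y by (rule J_0)
  then show ?thesis by (simp only:)
qed

lemma bounded_linear_J: "bounded_linear J"
proof (cases "\<alpha> = 0")
  case True
  have "J = (\<lambda>x. x)" by (rule ext) (rule J_0[OF True])
  then show ?thesis by simp
next
  case False
  then have a: "0 < \<alpha>" using \<alpha> by simp
  have "fk (x + y) = (\<lambda>t. fk x t + fk y t)" for x y by (auto simp: fk_def add scaleR_add_right)
  then have 1: "J (x + y) = J x + J y" for x y
    by (simp add: J_eq[OF a] Henstock_Kurzweil_Integration.integral_add integrable_fk[OF a] scaleR_add_right)
  have "fk (c *\<^sub>R x) = (\<lambda>t. c *\<^sub>R fk x t)" for c x by (auto simp: fk_def scale)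
  then have 2: "J (c *\<^sub>R x) = c *\<^sub>R J x" for c x by (simp add: J_eq[OF a])
  have 3: "norm (J x) \<le> norm x * (\<bar>1 / Gamma \<alpha>\<bar> * (C * integral UNIV (kern (1 - \<alpha>) \<delta>)))" for x
  proof -
    have "norm (integral UNIV (fk x)) \<le> integral UNIV (\<lambda>t. (C * norm x) * kern (1 - \<alpha>) \<delta> t)"
      by (rule Henstock_Kurzweil_Integration.integral_norm_bound_integral[where g = "\<lambda>t. (C * norm x) * kern (1 - \<alpha>) \<delta> t", OF integrable_fk[OF a] integrable_Ckern[OF a] norm_fk_le])
    from mult_left_mono[OF this, of "\<bar>1 / Gamma \<alpha>\<bar>"] show ?thesis by (simp add: J_eq[OF a] mult_ac)
  qed
  show ?thesis using 1 2 3 by (rule bounded_linear_intro)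
qed

lemma J_eq_0:
  assumes "J x = 0"
  shows "x = 0"
proof (cases "\<alpha> = 0")
  case False
  then have a: "0 < \<alpha>" using \<alpha> by simp
  show ?thesis
  proof (rule ccontr)
    assume "x \<noteq> 0"
    then obtain f :: "'x \<Rightarrow> real" where f: "bounded_linear f" "f x \<noteq> 0" using exists_functional_nonzero by blast
    note lin = bounded_linear.linear[OF f(1)]
    obtain Kf where Kf: "Kf \<ge> 0" "\<And>y. \<bar>f y\<bar> \<le> Kf * norm y"
      using bounded_linear.nonneg_bounded[OF f(1)] by (metis mult.commute real_norm_def)
    define g where "g v = f (S (max 0 v) x)" for v
    have "continuous_on {- real n..real n} g" for n
    proof -
      have "continuous_on {- real n..real n} (\<lambda>v. S (max 0 v) x)"
        by (rule continuous_on_S_compose[where b = "real n"]) (auto intro!: continuous_intros)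
      then show ?thesis unfolding g_def by (rule bounded_linear.continuous_on[OF f(1)])
    qed
    then have "isCont g v" for v
    proof -
      obtain n :: nat where "real n > \<bar>v\<bar>" using reals_Archimedean2 by blast
      then show ?thesis using \<open>continuous_on {- real n..real n} g\<close>
        by (intro continuous_on_interior[of "{- real n..real n}"]) (auto simp: interior_atLeastAtMost_real)
    qed
    then have g: "continuous_on UNIV g" by (simp add: continuous_at_imp_continuous_on)
    have C0: "0 \<le> C" using norm_le[of 0 x] \<open>x \<noteq> 0\<close> by (simp add: S_0)
    have "g 0 = 0"
    proof (rule fractional_integral_injective[where g = g and c = "Kf * C * norm x", OF a \<alpha>(2) \<delta> g])
      show "0 \<le> Kf * C * norm x" using Kf(1) C0 by simp
      show "\<bar>g v\<bar> \<le> Kf * C * norm x * exp (- \<delta> * v)" if "0 \<le> v" for v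
      proof -
        have "\<bar>g v\<bar> \<le> Kf * norm (S v x)" using Kf(2)[of "S v x"] that by (simp add: g_def max_def)
        also have "\<dots> \<le> Kf * (C * exp (- \<delta> * v) * norm x)" using Kf(1) norm_le[OF that] by (intro mult_left_mono) auto
        finally show ?thesis by (simp add: mult_ac)
      qed
      show "((\<lambda>t. if 0 < t then t powr (\<alpha> - 1) * g (t + u) else 0) has_integral 0) UNIV" if u: "0 \<le> u" for u
      proof -
        have "J (S u x) = S u (J x)" using u semigroup[of u] semigroup[of _ u]
          by (intro J_commute bounded_linear_S) (metis add.commute)+
        then have "J (S u x) = 0" using assms S_zero[OF u] by simp
        then have "integral UNIV (fk (S u x)) = 0" using Gamma_real_pos[OF a] by (simp add: J_eq[OF a])
        then have "(fk (S u x) has_integral 0) UNIV" using integrable_integral[OF integrable_fk[OF a, of "S u x"]] by simp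
        from has_integral_linear[OF this f(1)] have "((f \<circ> fk (S u x)) has_integral 0) UNIV" by (simp add: linear_0[OF lin])
        moreover have "f \<circ> fk (S u x) = (\<lambda>t. if 0 < t then t powr (\<alpha> - 1) * g (t + u) else 0)"
          using u semigroup[of _ u x] by (auto simp: fk_def g_def linear_scale[OF lin] linear_0[OF lin] fun_eq_iff)
        ultimately show ?thesis by simp
      qed
    qed
    then show False using f(2) by (simp add: g_def S_0)
  qed
next
  case True
  then have "J y = y" for y by (rule J_0)
  then show ?thesis using assms by (simp only:)
qed

lemma inj_J: "inj J"
proof (rule injI)
  fix x y assume "J x = J y"
  then have "J (x - y) = 0" by (simp add: linear_diff[OF bounded_linear.linear[OF bounded_linear_J]])
  then show "x = y" using J_eq_0[of "x - y"] by simp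
qed

end

subsection \<open>The exponential of a bounded operator on an invariant subspace\<close>

lemma (in closed_dense_operator) exp_op_properties:
  assumes X1: "subspace X1" "closed X1" "X1 \<subseteq> D" "\<And>x. x \<in> X1 \<Longrightarrow> B x \<in> X1"
    and K: "\<And>x. x \<in> X1 \<Longrightarrow> norm (B x) \<le> K * norm x" and y: "y \<in> X1"
  shows "exp_op B 0 y = y" "exp_op B t y \<in> X1" "B (exp_op B t y) = exp_op B t (B y)"
    "((\<lambda>t. exp_op B t y) has_vector_derivative - exp_op B t (B y)) (at t)"
    "z \<in> X1 \<Longrightarrow> exp_op B t (y + z) = exp_op B t y + exp_op B t z" "exp_op B t (c *\<^sub>R y) = c *\<^sub>R exp_op B t y"
    "bounded_linear P \<Longrightarrow> (\<And>x. x \<in> X1 \<Longrightarrow> P x \<in> X1) \<Longrightarrow> (\<And>x. x \<in> X1 \<Longrightarrow> P (B x) = B (P x)) \<Longrightarrow>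
       P (exp_op B t y) = exp_op B t (P y)"
proof -
  define p where "p n t y = ((- t) ^ n / fact n) *\<^sub>R (B ^^ n) y" for n t y
  define s where "s N t y = (\<Sum>n<N. p n t y)" for N t y
  have pow: "(B ^^ n) x \<in> X1 \<and> norm ((B ^^ n) x) \<le> \<bar>K\<bar> ^ n * norm x" if "x \<in> X1" for n x
  proof (induction n)
    case (Suc n)
    have "norm (B ((B ^^ n) x)) \<le> K * norm ((B ^^ n) x)" using K Suc by blast
    also have "\<dots> \<le> \<bar>K\<bar> * norm ((B ^^ n) x)" by (intro mult_right_mono) auto
    also have "\<dots> \<le> \<bar>K\<bar> * (\<bar>K\<bar> ^ n * norm x)" using Suc by (intro mult_left_mono) auto
    finally show ?case using X1(4) Suc by (simp add: mult_ac)
  qed (use that in simp)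
  have ul: "uniform_limit {-b..b} (\<lambda>N t. s N t x) (\<lambda>t. exp_op B t x) sequentially" if "x \<in> X1" for x b
  proof -
    have "uniform_limit {-b..b} (\<lambda>N t. \<Sum>n<N. p n t x) (\<lambda>t. \<Sum>n. p n t x) sequentially"
    proof (rule Weierstrass_m_test)
      fix n t assume t: "t \<in> {-b..b}"
      have "norm (p n t x) = \<bar>t\<bar> ^ n / fact n * norm ((B ^^ n) x)" by (simp add: p_def power_abs)
      also have "\<dots> \<le> \<bar>b\<bar> ^ n / fact n * (\<bar>K\<bar> ^ n * norm x)"
        using t pow[OF that] by (intro mult_mono divide_right_mono power_mono) auto
      finally show "norm (p n t x) \<le> inverse (fact n) * (\<bar>b\<bar> * \<bar>K\<bar>) ^ n * norm x"
        by (simp add: power_mult_distrib divide_inverse mult_ac)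
    next
      show "summable (\<lambda>n. inverse (fact n) * (\<bar>b\<bar> * \<bar>K\<bar>) ^ n * norm x)"
        by (rule summable_mult2[OF summable_exp])
    qed
    then show ?thesis by (simp add: s_def[abs_def] exp_op_def[abs_def] p_def[abs_def])
  qed
  have lim: "(\<lambda>N. s N t x) \<longlonglongrightarrow> exp_op B t x" if "x \<in> X1" for x t
    by (rule tendsto_uniform_limitI[OF ul[OF that, of "\<bar>t\<bar>"]]) (simp, linarith)
  have sX: "s N t x \<in> X1" if "x \<in> X1" for N t x
    unfolding s_def p_def using pow[OF that] X1(1) by (intro subspace_sum subspace_scale) auto
  have Bs: "B (s N t x) = s N t (B x)" if x: "x \<in> X1" for N t x
  proof (induction N)
    case (Suc N)
    have "(B ^^ N) x \<in> D" "s N t x \<in> D" using pow[OF x] sX[OF x] X1(3) by blast+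
    moreover from this(1) have "p N t x \<in> D" unfolding p_def by (rule D_scale)
    ultimately have "B (s N t x + p N t x) = B (s N t x) + p N t (B x)"
      by (simp add: B_add p_def B_scale funpow_swap1)
    then show ?case using Suc by (simp add: s_def)
  qed (simp add: s_def B_0)
  have ds: "((\<lambda>t. s (Suc N) t x) has_vector_derivative - s N t (B x)) (at t within X)" for N t x X
  proof (induction N)
    case 0
    have "(\<lambda>t. s (Suc 0) t x) = (\<lambda>t. x)" by (simp add: s_def p_def)
    then show ?case by (simp add: s_def)
  next
    case (Suc N)
    have "((\<lambda>t. (- t) ^ Suc N / fact (Suc N)) has_real_derivative (real (Suc N) * (- 1) * (- t) ^ N) / fact (Suc N)) (at t within X)"
    proof (rule DERIV_cdivide)
      have "((\<lambda>t::real. (- t) ^ Suc N) has_real_derivative (1 + real N) * (- 1 * (- t) ^ N)) (at t within X)"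
        by (rule DERIV_power_Suc[OF DERIV_minus[OF DERIV_ident]])
      then show "((\<lambda>t. (- t) ^ Suc N) has_real_derivative real (Suc N) * (- 1) * (- t) ^ N) (at t within X)"
        by (simp only: of_nat_Suc mult.assoc)
    qed
    also have "(real (Suc N) * (- 1) * (- t) ^ N) / fact (Suc N) = - ((- t) ^ N / fact N)"
      by (simp del: of_nat_Suc add: fact_Suc)
    finally have "((\<lambda>t. p (Suc N) t x) has_vector_derivative (- ((- t) ^ N / fact N)) *\<^sub>R (B ^^ Suc N) x) (at t within X)"
      unfolding p_def by (rule has_vector_derivative_scaleR[OF _ has_vector_derivative_const, THEN has_vector_derivative_eq_rhs]) simp
    from has_vector_derivative_add[OF Suc this] show ?case
      by (simp add: s_def p_def funpow_swap1)
  qed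
  have powX: "(B ^^ n) x \<in> D" if "x \<in> X1" for n x using pow[OF that] X1(3) by blast
  show "exp_op B t (y + z) = exp_op B t y + exp_op B t z" if z: "z \<in> X1"
  proof -
    have "(B ^^ n) (y + z) = (B ^^ n) y + (B ^^ n) z" for n
      by (induction n) (simp_all add: B_add powX[OF y] powX[OF z])
    then have "s N t (y + z) = s N t y + s N t z" for N
      by (simp add: s_def p_def scaleR_add_right sum.distrib)
    then have "(\<lambda>N. s N t y + s N t z) \<longlonglongrightarrow> exp_op B t (y + z)"
      using lim[OF subspace_add[OF X1(1) y z], of t] by simp
    then show ?thesis by (rule LIMSEQ_unique[OF _ tendsto_add[OF lim[OF y] lim[OF z]]])
  qed
  show "exp_op B t (c *\<^sub>R y) = c *\<^sub>R exp_op B t y"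
  proof -
    have "(B ^^ n) (c *\<^sub>R y) = c *\<^sub>R (B ^^ n) y" for n
      by (induction n) (simp_all add: B_scale powX[OF y])
    then have "s N t (c *\<^sub>R y) = c *\<^sub>R s N t y" for N
      by (simp add: s_def p_def scaleR_sum_right mult.commute)
    then have "(\<lambda>N. c *\<^sub>R s N t y) \<longlonglongrightarrow> exp_op B t (c *\<^sub>R y)"
      using lim[OF subspace_scale[OF X1(1) y, of c], of t] by simp
    then show ?thesis by (rule LIMSEQ_unique[OF _ tendsto_scaleR[OF tendsto_const lim[OF y]]])
  qed
  show "P (exp_op B t y) = exp_op B t (P y)"
    if P: "bounded_linear P" "\<And>x. x \<in> X1 \<Longrightarrow> P x \<in> X1" "\<And>x. x \<in> X1 \<Longrightarrow> P (B x) = B (P x)"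
  proof -
    note linP = bounded_linear.linear[OF P(1)]
    have "P ((B ^^ n) y) = (B ^^ n) (P y)" for n
      by (induction n) (simp_all add: P(3) pow[OF y])
    then have "P (s N t y) = s N t (P y)" for N
      by (simp add: s_def p_def linear_sum[OF linP] linear_scale[OF linP])
    then have "(\<lambda>N. s N t (P y)) \<longlonglongrightarrow> P (exp_op B t y)"
      using bounded_linear.tendsto[OF P(1) lim[OF y, of t]] by simp
    then show ?thesis by (rule LIMSEQ_unique[OF _ lim[OF P(2)[OF y]]])
  qed
  have B0: "B y \<in> X1" using X1(4) y .
  show E0: "exp_op B 0 y = y"
  proof -
    have "(\<lambda>N. s (Suc N) 0 y) \<longlonglongrightarrow> exp_op B 0 y" using lim[OF y, of 0] by (rule LIMSEQ_Suc)
    moreover have "s (Suc N) 0 y = y" for N by (induction N) (simp_all add: s_def p_def)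
    ultimately have "(\<lambda>N::nat. y) \<longlonglongrightarrow> exp_op B 0 y" by (simp only:)
    then show ?thesis by (rule LIMSEQ_unique[OF _ tendsto_const])
  qed
  show "exp_op B t y \<in> X1"
    using closed_sequentially[OF X1(2) _ lim[OF y]] sX[OF y] by blast
  have "(\<lambda>N. B (s N t y)) \<longlonglongrightarrow> exp_op B t (B y)" using lim[OF B0] by (simp add: Bs[OF y])
  from closed_graph_tendsto[OF _ lim[OF y] this]
  show "B (exp_op B t y) = exp_op B t (B y)"
    using subsetD[OF X1(3) sX[OF y]] by simp
  define b where "b = \<bar>t\<bar> + 1"
  have b: "- b < t" "t < b" unfolding b_def by linarith+
  have cont_s: "continuous_on {-b..b} (\<lambda>t. s N t x)" for N x
    unfolding s_def p_def by (intro continuous_intros) auto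
  have cont: "continuous_on {-b..b} (\<lambda>t. exp_op B t (B y))"
    by (rule uniform_limit_theorem[OF _ ul[OF B0]]) (simp_all add: cont_s)
  have FTC: "integral {-b..\<tau>} (\<lambda>t. exp_op B t (B y)) = exp_op B (- b) y - exp_op B \<tau> y" if \<tau>: "\<tau> \<in> {-b..b}" for \<tau>
  proof -
    have ul': "uniform_limit {-b..\<tau>} (\<lambda>N t. s N t (B y)) (\<lambda>t. exp_op B t (B y)) sequentially"
      by (rule uniform_limit_on_subset[OF ul[OF B0, of b]]) (use \<tau> in auto)
    obtain I J where I: "\<And>N. ((\<lambda>t. s N t (B y)) has_integral I N) {-b..\<tau>}"
      and J: "((\<lambda>t. exp_op B t (B y)) has_integral J) {-b..\<tau>}" and IJ: "I \<longlonglongrightarrow> J"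
      by (rule uniform_limit_integral[OF ul'])
        (use \<tau> in \<open>auto intro: continuous_on_subset[OF cont_s]\<close>)
    have "I N = s (Suc N) (- b) y - s (Suc N) \<tau> y" for N
    proof -
      have "((\<lambda>t. - s N t (B y)) has_integral (s (Suc N) \<tau> y - s (Suc N) (- b) y)) {-b..\<tau>}"
        by (rule fundamental_theorem_of_calculus[OF _ ds]) (use \<tau> in auto)
      from has_integral_neg[OF this] have "((\<lambda>t. s N t (B y)) has_integral (s (Suc N) (- b) y - s (Suc N) \<tau> y)) {-b..\<tau>}" by simp
      then show ?thesis by (rule has_integral_unique[OF I])
    qed
    moreover have "(\<lambda>N. s (Suc N) (- b) y - s (Suc N) \<tau> y) \<longlonglongrightarrow> exp_op B (- b) y - exp_op B \<tau> y"
      by (intro tendsto_diff LIMSEQ_Suc lim[OF y])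
    ultimately have "I \<longlonglongrightarrow> exp_op B (- b) y - exp_op B \<tau> y" by presburger
    then have "J = exp_op B (- b) y - exp_op B \<tau> y" by (rule LIMSEQ_unique[OF IJ])
    then show ?thesis using integral_unique[OF J] by simp
  qed
  have "((\<lambda>\<tau>. integral {-b..\<tau>} (\<lambda>t. exp_op B t (B y))) has_vector_derivative exp_op B t (B y)) (at t within {-b..b})"
    by (rule integral_has_vector_derivative[OF cont]) (use b in simp)
  moreover have "at t within {-b..b} = at t"
    by (rule at_within_interior) (use b in \<open>simp add: interior_atLeastAtMost_real\<close>)
  ultimately have "((\<lambda>\<tau>. integral {-b..\<tau>} (\<lambda>t. exp_op B t (B y))) has_vector_derivative exp_op B t (B y)) (at t)" by simp
  from has_vector_derivative_diff[OF has_vector_derivative_const[of "exp_op B (- b) y"] this]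
  have "((\<lambda>\<tau>. exp_op B (- b) y - integral {-b..\<tau>} (\<lambda>t. exp_op B t (B y))) has_vector_derivative - exp_op B t (B y)) (at t)" by simp
  then show "((\<lambda>t. exp_op B t y) has_vector_derivative - exp_op B t (B y)) (at t)"
    by (rule has_vector_derivative_transform_within_open[where S = "{-b<..<b}"])
      (use b in \<open>simp_all add: FTC\<close>)
qed

subsection \<open>Exponential dichotomy\<close>

definition greenk :: "real \<Rightarrow> real \<Rightarrow> real \<Rightarrow> real" where
  "greenk \<alpha> \<beta> s = (if 0 < s then s powr (- \<alpha>) * exp (- \<beta> * s) else exp (\<beta> * s))"

lemma greenk_pos: "0 \<le> greenk \<alpha> \<beta> s"
  by (simp add: greenk_def)

lemma has_integral_greenk:
  assumes "\<alpha> < 1" "\<beta> > 0"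
  shows "(greenk \<alpha> \<beta> has_integral (integral UNIV (kern \<alpha> \<beta>) + integral UNIV (kern 0 \<beta>))) UNIV"
proof -
  have 1: "(kern \<alpha> \<beta> has_integral integral UNIV (kern \<alpha> \<beta>)) UNIV"
    by (rule integrable_integral[OF integrable_kern[OF assms]])
  have 2: "((\<lambda>s. kern 0 \<beta> (- s)) has_integral integral UNIV (kern 0 \<beta>)) UNIV"
    by (rule has_integral_uminus_UNIV[OF integrable_integral[OF integrable_kern]]) (use assms in auto)
  show ?thesis
    by (rule has_integral_spike_finite[OF _ _ has_integral_add[OF 1 2], of "{0}"]) (auto simp: greenk_def kern_def)
qed

lemma integrable_greenk: "\<alpha> < 1 \<Longrightarrow> \<beta> > 0 \<Longrightarrow> greenk \<alpha> \<beta> integrable_on UNIV"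
  using has_integral_greenk by (rule has_integral_integrable)

lemma integral_greenk_le_kappa0:
  assumes \<alpha>: "\<alpha> < 1" and \<beta>: "\<beta> > 0"
  shows "integral UNIV (greenk \<alpha> \<beta>) \<le> kappa0 \<alpha> \<beta>"
proof -
  define I1 where "I1 = integral UNIV (kern \<alpha> \<beta>)"
  define I2 where "I2 = integral UNIV (kern 0 \<beta>)"
  have ki: "kern \<alpha> \<beta> integrable_on {0..t}" for t
    by (rule integrable_on_subinterval[OF integrable_kern[OF assms]]) simp
  have first: "integral {0..t} (\<lambda>s. (t - s) powr (- \<alpha>) * exp (- \<beta> * (t - s))) = integral {0..t} (kern \<alpha> \<beta>)" for t
  proof -
    have "((\<lambda>x. if x \<in> {0..t} then kern \<alpha> \<beta> x else 0) has_integral integral {0..t} (kern \<alpha> \<beta>)) UNIV"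
      by (rule has_integral_restrict_UNIV[THEN iffD2, OF integrable_integral[OF ki]])
    from has_integral_shift_UNIV[OF has_integral_uminus_UNIV[OF this], of "- t"]
    have h: "((\<lambda>s. if - (s + - t) \<in> {0..t} then kern \<alpha> \<beta> (- (s + - t)) else 0) has_integral integral {0..t} (kern \<alpha> \<beta>)) UNIV" .
    have eq: "(\<lambda>s. if s \<in> {0..t} then (t - s) powr (- \<alpha>) * exp (- \<beta> * (t - s)) else 0)
        = (\<lambda>s. if - (s + - t) \<in> {0..t} then kern \<alpha> \<beta> (- (s + - t)) else 0)"
      by (rule ext) (auto simp: kern_def)
    have "((\<lambda>s. if s \<in> {0..t} then (t - s) powr (- \<alpha>) * exp (- \<beta> * (t - s)) else 0) has_integral integral {0..t} (kern \<alpha> \<beta>)) UNIV"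
      unfolding eq by (rule h)
    then show ?thesis by (rule integral_unique[OF has_integral_restrict_UNIV[THEN iffD1]])
  qed
  have second: "integral {t..} (\<lambda>s. exp (\<beta> * (t - s))) = I2" for t
  proof -
    have "(kern 0 \<beta> has_integral I2) UNIV" unfolding I2_def
      by (rule integrable_integral[OF integrable_kern]) (use \<beta> in auto)
    from has_integral_shift_UNIV[OF this, of "- t"]
    have h: "((\<lambda>s. kern 0 \<beta> (s + - t)) has_integral I2) UNIV" .
    have "((\<lambda>s. if s \<in> {t..} then exp (\<beta> * (t - s)) else 0) has_integral I2) UNIV"
    proof (rule has_integral_spike_finite[OF _ _ h, of "{t}"])
      fix x assume "x \<in> UNIV - {t}"
      then consider "t < x" | "x < t" by fastforce
      then show "(if x \<in> {t..} then exp (\<beta> * (t - x)) else 0) = kern 0 \<beta> (x + - t)"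
      proof cases
        case 1
        have "\<beta> * (t - x) = - \<beta> * (x + - t)" by (simp add: algebra_simps)
        with 1 show ?thesis by (simp add: kern_def)
      qed (simp add: kern_def)
    qed simp
    then show ?thesis by (rule integral_unique[OF has_integral_restrict_UNIV[THEN iffD1]])
  qed
  have le: "integral {0..t} (kern \<alpha> \<beta>) \<le> I1" for t
    unfolding I1_def by (rule integral_subset_le) (auto simp: ki integrable_kern[OF assms] kern_nonneg)
  have bdd: "bdd_above ((\<lambda>t. integral {0..t} (kern \<alpha> \<beta>) + I2) ` {0..})"
    using le by (intro bdd_aboveI2[where M = "I1 + I2"]) simp
  have "(\<lambda>n. integral {-real n..real n} (kern \<alpha> \<beta>)) \<longlonglongrightarrow> I1"
    unfolding I1_def by (rule tendsto_integral_UNIV[OF integrable_kern[OF assms]])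
  moreover have "integral {-real n..real n} (kern \<alpha> \<beta>) = integral {0..real n} (kern \<alpha> \<beta>)" for n
  proof -
    have "((\<lambda>x. if x \<in> {0..real n} then kern \<alpha> \<beta> x else 0) has_integral integral {0..real n} (kern \<alpha> \<beta>)) {-real n..real n}"
      by (subst has_integral_restrict) (auto intro: integrable_integral[OF ki])
    moreover have "(\<lambda>x. if x \<in> {0..real n} then kern \<alpha> \<beta> x else 0) x = kern \<alpha> \<beta> x" if "x \<in> {-real n..real n}" for x
      using that by (auto simp: kern_def)
    ultimately have "(kern \<alpha> \<beta> has_integral integral {0..real n} (kern \<alpha> \<beta>)) {-real n..real n}"
      by (rule has_integral_eq[rotated])
    then show ?thesis by (rule integral_unique)
  qed
  ultimately have lim: "(\<lambda>n. integral {0..real n} (kern \<alpha> \<beta>) + I2) \<longlonglongrightarrow> I1 + I2" by (intro tendsto_intros) simp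
  have "integral {0..real n} (kern \<alpha> \<beta>) + I2 \<le> kappa0 \<alpha> \<beta>" for n
    unfolding kappa0_def first second by (rule cSUP_upper[OF _ bdd]) simp
  then have "I1 + I2 \<le> kappa0 \<alpha> \<beta>" by (intro LIMSEQ_le_const2[OF lim]) auto
  then show ?thesis using integral_unique[OF has_integral_greenk[OF assms]] by (simp add: I1_def I2_def)
qed

locale dichotomy = frac_setting D L S C \<delta> r \<mu> \<alpha>
  for D :: "'x::banach set" and L :: "'x \<Rightarrow> 'x" and S :: "real \<Rightarrow> 'x \<Rightarrow> 'x" and C \<delta> r \<mu> \<alpha> +
  fixes A :: "'x \<Rightarrow> 'x" and T :: "real \<Rightarrow> 'x \<Rightarrow> 'x" and C' \<omega> \<mu>' a M \<beta> :: real and X1 X2 :: "'x set"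
  assumes T_fam: "solution_family D A T C' \<omega> r \<mu>'"
    and T_S: "\<And>t x. T t x = exp (a * t) *\<^sub>R S t x"
    and X1: "subspace X1" "closed X1" "X1 \<subseteq> D" "\<And>x. x \<in> X1 \<Longrightarrow> A x \<in> X1"
    and X2: "subspace X2" "closed X2" "\<And>x. x \<in> D \<inter> X2 \<Longrightarrow> A x \<in> X2"
    and X12: "X1 \<inter> X2 = {0}" "\<And>x. \<exists>y\<in>X1. \<exists>z\<in>X2. x = y + z"
    and A_bdd: "\<exists>K. \<forall>x\<in>X1. norm (A x) \<le> K * norm x"
    and M: "M \<ge> 1" and \<beta>: "\<beta> > 0"
    and h1: "\<And>t x. t \<le> 0 \<Longrightarrow> exp_op A t (direct_proj X1 X2 x) \<in> range J \<and>
           norm (inv J (exp_op A t (direct_proj X1 X2 x))) \<le> M * exp (\<beta> * t) * norm x"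
    and h2: "\<And>t x. t \<le> 0 \<Longrightarrow> norm (exp_op A t (direct_proj X1 X2 x)) \<le> M * exp (\<beta> * t) * norm x"
    and h3: "\<And>t x. t > 0 \<Longrightarrow> exp_semigroup X2 (D \<inter> X2) A t (direct_proj X2 X1 (J x)) \<in> range J \<and>
           norm (inv J (exp_semigroup X2 (D \<inter> X2) A t (direct_proj X2 X1 (J x)))) \<le> M * exp (- \<beta> * t) * norm x"
    and h4: "\<And>t x. t > 0 \<Longrightarrow> exp_semigroup X2 (D \<inter> X2) A t (direct_proj X2 X1 x) \<in> range J \<and>
           norm (inv J (exp_semigroup X2 (D \<inter> X2) A t (direct_proj X2 X1 x)))
             \<le> M * t powr (- \<alpha>) * exp (- \<beta> * t) * norm x"
begin

sublocale T: solution_family D A T C' \<omega> r \<mu>'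
  by (rule T_fam)

abbreviation P1 where "P1 \<equiv> direct_proj X1 X2"
abbreviation P2 where "P2 \<equiv> direct_proj X2 X1"
abbreviation E where "E \<equiv> exp_op A"

lemma P_unique:
  assumes "y \<in> X1" "z \<in> X2"
  shows "P1 (y + z) = y" "P2 (y + z) = z"
proof -
  have zero: "v = 0" if "v \<in> X1" "v \<in> X2" for v using that X12(1) by blast
  show "P1 (y + z) = y" unfolding direct_proj_def
  proof (rule the_equality)
    fix v assume v: "v \<in> X1 \<and> y + z - v \<in> X2"
    then have "y - v \<in> X1" using subspace_diff[OF X1(1) assms(1)] by blast
    moreover have "y - v \<in> X2" using subspace_diff[OF X2(1) _ assms(2), of "y + z - v"] v by (simp add: algebra_simps)
    ultimately have "y - v = 0" by (rule zero)
    then show "v = y" by simp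
  qed (use assms in simp)
  show "P2 (y + z) = z" unfolding direct_proj_def
  proof (rule the_equality)
    fix v assume v: "v \<in> X2 \<and> y + z - v \<in> X1"
    then have "z - v \<in> X2" using subspace_diff[OF X2(1) assms(2)] by blast
    moreover have "z - v \<in> X1" using subspace_diff[OF X1(1) _ assms(1), of "y + z - v"] v by (simp add: algebra_simps)
    ultimately have "z - v = 0" using zero by blast
    then show "v = z" by simp
  qed (use assms in simp)
qed

lemma P1_in: "P1 x \<in> X1" and P2_in: "P2 x \<in> X2" and P_sum: "P1 x + P2 x = x"
proof -
  obtain y z where "y \<in> X1" "z \<in> X2" "x = y + z" using X12(2) by blast
  then show "P1 x \<in> X1" "P2 x \<in> X2" "P1 x + P2 x = x" using P_unique by auto
qed

lemma P1_X1: "x \<in> X1 \<Longrightarrow> P1 x = x" and P2_X1: "x \<in> X1 \<Longrightarrow> P2 x = 0"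
  and P1_X2: "x \<in> X2 \<Longrightarrow> P1 x = 0" and P2_X2: "x \<in> X2 \<Longrightarrow> P2 x = x"
  using P_unique[of x 0] P_unique[of 0 x] X1(1) X2(1) by (simp_all add: subspace_0)

lemma P_add: "P1 (x + y) = P1 x + P1 y" "P2 (x + y) = P2 x + P2 y"
proof -
  have eq: "x + y = (P1 x + P1 y) + (P2 x + P2 y)" using P_sum[of x] P_sum[of y] by (metis add.assoc add.left_commute)
  show "P1 (x + y) = P1 x + P1 y" "P2 (x + y) = P2 x + P2 y"
    by (subst eq, rule P_unique; intro subspace_add X1(1) X2(1) P1_in P2_in)+
qed

lemma P_scale: "P1 (c *\<^sub>R x) = c *\<^sub>R P1 x" "P2 (c *\<^sub>R x) = c *\<^sub>R P2 x"
proof -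
  have eq: "c *\<^sub>R x = c *\<^sub>R P1 x + c *\<^sub>R P2 x" using P_sum[of x] by (metis scaleR_add_right)
  show "P1 (c *\<^sub>R x) = c *\<^sub>R P1 x" "P2 (c *\<^sub>R x) = c *\<^sub>R P2 x"
    by (subst eq, rule P_unique; intro subspace_scale X1(1) X2(1) P1_in P2_in)+
qed

lemma E_props:
  assumes "y \<in> X1"
  shows "E 0 y = y" "E t y \<in> X1" "A (E t y) = E t (A y)"
    "((\<lambda>t. E t y) has_vector_derivative - E t (A y)) (at t)"
    "z \<in> X1 \<Longrightarrow> E t (y + z) = E t y + E t z" "E t (c *\<^sub>R y) = c *\<^sub>R E t y"
    "bounded_linear P \<Longrightarrow> (\<And>x. x \<in> X1 \<Longrightarrow> P x \<in> X1) \<Longrightarrow> (\<And>x. x \<in> X1 \<Longrightarrow> P (A x) = A (P x)) \<Longrightarrow>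
       P (E t y) = E t (P y)"
proof -
  obtain K where K: "\<And>x. x \<in> X1 \<Longrightarrow> norm (A x) \<le> K * norm x" using A_bdd by blast
  note * = T.exp_op_properties[OF X1 K assms]
  show "E 0 y = y" "E t y \<in> X1" "A (E t y) = E t (A y)" "((\<lambda>t. E t y) has_vector_derivative - E t (A y)) (at t)"
    "z \<in> X1 \<Longrightarrow> E t (y + z) = E t y + E t z" "E t (c *\<^sub>R y) = c *\<^sub>R E t y"
    "bounded_linear P \<Longrightarrow> (\<And>x. x \<in> X1 \<Longrightarrow> P x \<in> X1) \<Longrightarrow> (\<And>x. x \<in> X1 \<Longrightarrow> P (A x) = A (P x)) \<Longrightarrow>
       P (E t y) = E t (P y)"
    by (rule *; assumption)+
qed

lemma bounded_linear_P1: "bounded_linear P1"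
proof (rule bounded_linear_intro[OF P_add(1) P_scale(1)])
  show "norm (P1 x) \<le> norm x * M" for x
    using h2[of 0 x] E_props(1)[OF P1_in] by (simp add: mult.commute)
qed

lemma bounded_linear_P2: "bounded_linear P2"
proof -
  have "P2 = (\<lambda>x. x - P1 x)" using P_sum by (metis add_diff_cancel_left')
  then show ?thesis using bounded_linear_sub[OF bounded_linear_ident bounded_linear_P1] by simp
qed

lemma T_E:
  assumes "y \<in> X1" "0 \<le> h"
  shows "T h (E \<sigma> y) = E (\<sigma> + h) y"
proof -
  have D: "((\<lambda>\<tau>. E (\<sigma> + \<tau>) y) has_vector_derivative - A (E (\<sigma> + \<tau>) y)) (at \<tau>)" for \<tau>
  proof -
    have "((\<lambda>\<tau>. \<sigma> + \<tau>) has_vector_derivative 1) (at \<tau>)" by (auto intro!: derivative_eq_intros)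
    from vector_diff_chain_at[OF this, of "\<lambda>t. E t y" "- E (\<sigma> + \<tau>) (A y)"] E_props(4)[OF assms(1), of "\<sigma> + \<tau>"] E_props(3)[OF assms(1), of "\<sigma> + \<tau>"]
    show ?thesis by (simp add: o_def)
  qed
  have "(\<lambda>\<tau>. E (\<sigma> + \<tau>) y) h = T h ((\<lambda>\<tau>. E (\<sigma> + \<tau>) y) 0)"
  proof (rule T.cauchy_unique[OF assms(2)])
    show "continuous_on {0..h} (\<lambda>\<tau>. E (\<sigma> + \<tau>) y)"
      using D by (intro continuous_at_imp_continuous_on ballI has_vector_derivative_continuous) blast
    show "E (\<sigma> + s) y \<in> D" for s using E_props(2)[OF assms(1)] X1(3) by blast
  qed (rule D)
  then show ?thesis by simp
qed

lemma A_P: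
  assumes "x \<in> D"
  shows "P1 x \<in> D" "P2 x \<in> D" "A (P1 x) = P1 (A x)"
proof -
  show 1: "P1 x \<in> D" using P1_in X1(3) by blast
  have "P2 x = x - P1 x" using P_sum[of x] by (metis add_diff_cancel_left')
  then show 2: "P2 x \<in> D" using D_diff[OF assms 1] by simp
  have "A x = A (P1 x) + A (P2 x)" using T.B_add[OF 1 2] by (simp add: P_sum)
  then show "A (P1 x) = P1 (A x)" using P_unique(1)[OF X1(4)[OF P1_in] X2(3)[of "P2 x"]] 2 P2_in by simp
qed

lemma dense_X2: "X2 \<subseteq> closure (D \<inter> X2)"
proof
  fix x assume x: "x \<in> X2"
  have "x \<in> closure D" using dense by simp
  then obtain d where d: "\<And>n. d n \<in> D" "d \<longlonglongrightarrow> x" unfolding closure_sequential by blast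
  have "(\<lambda>n. P2 (d n)) \<longlonglongrightarrow> P2 x" by (rule bounded_linear.tendsto[OF bounded_linear_P2 d(2)])
  then show "x \<in> closure (D \<inter> X2)"
    unfolding closure_sequential using A_P(2)[OF d(1)] P2_in P2_X2[OF x] by (intro exI[of _ "\<lambda>n. P2 (d n)"]) auto
qed

lemma T_X2:
  assumes "0 \<le> t" "x \<in> X2"
  shows "T t x \<in> X2"
proof -
  have *: "P1 (T t y) = 0" if y: "y \<in> D \<inter> X2" for y
  proof -
    have "(\<lambda>\<tau>. P1 (T \<tau> y)) t = T t ((\<lambda>\<tau>. P1 (T \<tau> y)) 0)"
    proof (rule T.cauchy_unique[OF assms(1)])
      show "continuous_on {0..t} (\<lambda>\<tau>. P1 (T \<tau> y))"
        by (rule bounded_linear.continuous_on[OF bounded_linear_P1 T.continuous_on_S])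
      show "P1 (T s y) \<in> D" for s using P1_in X1(3) by blast
      show "((\<lambda>\<tau>. P1 (T \<tau> y)) has_vector_derivative - A (P1 (T s y))) (at s)" if s: "0 < s" for s
      proof -
        have "((\<lambda>\<tau>. T \<tau> y) has_vector_derivative - T s (A y)) (at s)" using T.S_derivative s y by blast
        from bounded_linear.has_vector_derivative[OF bounded_linear_P1 this]
        have "((\<lambda>\<tau>. P1 (T \<tau> y)) has_vector_derivative P1 (- T s (A y))) (at s)" .
        moreover have "P1 (- T s (A y)) = - A (P1 (T s y))"
          using A_P(3)[OF T.S_in[of s y]] T.A_S[of s y] s y linear_neg[OF bounded_linear.linear[OF bounded_linear_P1], of "T s (A y)"] by simp
        ultimately show ?thesis by simp
      qed
    qed
    then show ?thesis using P1_X2[of y] y T.S_0[of y] T.S_zero[OF assms(1)] by simp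
  qed
  have "x \<in> closure (D \<inter> X2)" using dense_X2 assms(2) by blast
  then obtain d where d: "\<And>n. d n \<in> D \<inter> X2" "d \<longlonglongrightarrow> x" unfolding closure_sequential by blast
  have "T t (d n) \<in> X2" for n using *[OF d(1)] P_sum[of "T t (d n)"] P2_in[of "T t (d n)"] by simp
  moreover have "(\<lambda>n. T t (d n)) \<longlonglongrightarrow> T t x" by (rule bounded_linear.tendsto[OF T.bounded_linear_S[OF assms(1)] d(2)])
  ultimately show ?thesis by (rule closed_sequentially[OF X2(2), where f = "\<lambda>n. T t (d n)"])
qed

lemma T_P:
  assumes "0 \<le> t"
  shows "P1 (T t x) = T t (P1 x)" "P2 (T t x) = T t (P2 x)"
proof -
  have "T t (P1 x) \<in> X1" using T_E[OF P1_in assms, of 0 x] E_props(1)[OF P1_in] E_props(2)[OF P1_in] by simp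
  moreover have "T t x = T t (P1 x) + T t (P2 x)" using T.add[OF assms, of "P1 x" "P2 x"] by (simp add: P_sum)
  ultimately show "P1 (T t x) = T t (P1 x)" "P2 (T t x) = T t (P2 x)"
    using P_unique T_X2[OF assms P2_in] by auto
qed

lemma exp_semigroup_X2: "0 \<le> t \<Longrightarrow> x \<in> X2 \<Longrightarrow> exp_semigroup X2 (D \<inter> X2) A t x = T t x"
  by (rule T.exp_semigroup_on_eq[OF X2(2,1) X2(3) dense_X2 T_X2])

abbreviation fp where "fp \<equiv> inv J"

lemma fp_J: "fp (J x) = x"
  by (rule inv_f_f[OF inj_J])

lemma J_fp: "u \<in> range J \<Longrightarrow> J (fp u) = u"
  by (rule f_inv_into_f)

lemma J_eqD: "J x = J y \<Longrightarrow> x = y"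
  using inj_J by (auto dest: injD)

lemma J_add: "J (x + y) = J x + J y" and J_scale: "J (c *\<^sub>R x) = c *\<^sub>R J x" and J_diff: "J (x - y) = J x - J y"
  and J_minus: "J (- x) = - J x" and J_zero: "J 0 = 0"
  using bounded_linear.linear[OF bounded_linear_J] by (simp_all add: linear_add linear_scale linear_diff linear_neg linear_0)

definition G :: "real \<Rightarrow> 'x \<Rightarrow> 'x" where
  "G s x = (if 0 < s then fp (T s (P2 x)) else - fp (E s (P1 x)))"

definition Q :: "real \<Rightarrow> 'x \<Rightarrow> 'x" where "Q t x = fp (T t (P2 (J x)))"

lemma J_G_pos: "0 < s \<Longrightarrow> J (G s x) = T s (P2 x)"
  using h4[of s x] exp_semigroup_X2[OF _ P2_in, of s x] by (simp add: G_def J_fp)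

lemma J_G_neg: "s \<le> 0 \<Longrightarrow> J (G s x) = - E s (P1 x)"
  using h1[of s x] by (simp add: G_def J_minus J_fp)

lemma norm_G_le: "norm (G s x) \<le> M * greenk \<alpha> \<beta> s * norm x"
  using h4[of s x] exp_semigroup_X2[OF _ P2_in, of s x] h1[of s x] by (simp add: G_def greenk_def mult_ac)

lemma J_Q: "0 < t \<Longrightarrow> J (Q t x) = T t (P2 (J x))"
  using h3[of t x] exp_semigroup_X2[OF _ P2_in, of t "J x"] by (simp add: Q_def J_fp)

lemma norm_Q_le: "0 < t \<Longrightarrow> norm (Q t x) \<le> M * exp (- \<beta> * t) * norm x"
  using h3[of t x] exp_semigroup_X2[OF _ P2_in, of t "J x"] by (simp add: Q_def)

lemma T_X1: "0 \<le> t \<Longrightarrow> y \<in> X1 \<Longrightarrow> T t y = E t y"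
  using T_E[of y t 0] E_props(1)[of y] by simp

lemma E_inverse:
  assumes "y \<in> X1" "0 \<le> t"
  shows "E (- t) (E t y) = y"
proof -
  have "T t (E (- t) y) = E (- t) (T t y)"
  proof (rule E_props(7)[OF assms(1) T.bounded_linear_S[OF assms(2)]])
    show "T t x \<in> X1" if "x \<in> X1" for x using T_X1[OF assms(2) that] E_props(2)[OF that] by simp
    show "T t (A x) = A (T t x)" if "x \<in> X1" for x using T.A_S[OF assms(2)] that X1(3) by auto
  qed
  then show ?thesis using T_E[OF assms, of "- t"] T_X1[OF assms(2,1)] E_props(1)[OF assms(1)] by simp
qed

lemma bounded_imp_P2:
  assumes bd: "\<And>t. 0 \<le> t \<Longrightarrow> norm (T t y) \<le> K"
  shows "P2 y = y"
proof -
  have le: "norm (P1 y) \<le> M * K * exp (- \<beta> * t)" if t: "0 \<le> t" for t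
  proof -
    have "E (- t) (P1 (T t y)) = P1 y"
      using T_P(1)[OF t, of y] T_X1[OF t P1_in] E_inverse[OF P1_in t] by simp
    then have "norm (P1 y) \<le> M * exp (\<beta> * (- t)) * norm (T t y)" using h2[of "- t" "T t y"] t by simp
    also have "\<dots> \<le> M * exp (\<beta> * (- t)) * K" using M bd[OF t] by (intro mult_left_mono) auto
    finally show ?thesis by (simp add: mult_ac)
  qed
  have "filterlim (\<lambda>t. - \<beta> * t) at_bot at_top"
    by (rule filterlim_tendsto_neg_mult_at_bot[OF tendsto_const _ filterlim_ident]) (use \<beta> in simp)
  then have "((\<lambda>t. exp (- \<beta> * t)) \<longlongrightarrow> 0) at_top" by (rule filterlim_compose[OF exp_at_bot])
  then have "((\<lambda>t. M * K * exp (- \<beta> * t)) \<longlongrightarrow> 0) at_top" by (rule tendsto_mult_right_zero)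
  moreover have "\<forall>\<^sub>F t in at_top. norm (P1 y) \<le> M * K * exp (- \<beta> * t)"
    using eventually_ge_at_top[of 0] by (rule eventually_mono) (rule le)
  ultimately have "norm (P1 y) \<le> 0" by (rule tendsto_lowerbound) simp
  then show ?thesis using P_sum[of y] by simp
qed

lemma bounded_linear_G: "bounded_linear (G s)"
proof (rule bounded_linear_intro)
  show "G s (x + y) = G s x + G s y" for x y
    by (rule J_eqD, cases "0 < s")
      (simp_all add: J_add J_G_pos J_G_neg P_add T.add E_props(5)[OF P1_in P1_in])
  show "G s (c *\<^sub>R x) = c *\<^sub>R G s x" for c x
    by (rule J_eqD, cases "0 < s")
      (simp_all add: J_scale J_G_pos J_G_neg P_scale T.scale E_props(6)[OF P1_in])
  show "norm (G s x) \<le> norm x * (M * greenk \<alpha> \<beta> s)" for x using norm_G_le[of s x] by (simp add: mult_ac)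
qed

lemma T_J_G:
  assumes "0 \<le> h"
  shows "T h (J (G s x)) = J (G (s + h) x) - (if - h < s \<and> s \<le> 0 then T (s + h) x else 0)"
proof -
  consider "0 < s" | "s \<le> - h" | "- h < s" "s \<le> 0" by linarith
  then show ?thesis
  proof cases
    case 1
    then show ?thesis using assms T.semigroup[of h s "P2 x"] by (simp add: J_G_pos add.commute)
  next
    case 2
    then have "s \<le> 0" "s + h \<le> 0" using assms by auto
    then show ?thesis using 2 T_E[OF P1_in assms, of s] by (simp add: J_G_neg T.S_minus[OF assms])
  next
    case 3
    then have "T h (J (G s x)) = - T (s + h) (P1 x)"
      using T_E[OF P1_in assms, of s x] T_X1[of "s + h" "P1 x"] P1_in by (simp add: J_G_neg T.S_minus[OF assms])
    moreover have "T (s + h) x = T (s + h) (P1 x) + T (s + h) (P2 x)"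
      using T.add[of "s + h" "P1 x" "P2 x"] 3 by (simp add: P_sum)
    ultimately show ?thesis using 3 by (simp add: J_G_pos)
  qed
qed

lemma continuous_on_G_pos:
  assumes "0 < l" and f: "continuous_on {l..u} f"
  shows "continuous_on {l..u} (\<lambda>s. G s (f s))"
proof -
  have "continuous_on {l..u} (\<lambda>s. T (s - l) (f s))"
    by (rule T.continuous_on_S_compose[OF _ f, of _ "u - l"]) (auto intro: continuous_intros)
  then have "continuous_on {l..u} (\<lambda>s. G l (T (s - l) (f s)))" by (rule bounded_linear.continuous_on[OF bounded_linear_G])
  moreover have "G l (T (s - l) (f s)) = G s (f s)" if s: "s \<in> {l..u}" for s
  proof (rule J_eqD)
    have "T l (T (s - l) (P2 (f s))) = T s (P2 (f s))" using T.semigroup[of l "s - l" "P2 (f s)"] assms(1) s by simp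
    then show "J (G l (T (s - l) (f s))) = J (G s (f s))" using assms(1) s by (simp add: J_G_pos T_P(2))
  qed
  ultimately show ?thesis by (rule continuous_on_eq)
qed

lemma continuous_on_G_neg:
  assumes "u \<le> 0" and f: "continuous_on {l..u} f"
  shows "continuous_on {l..u} (\<lambda>s. G s (f s))"
proof (cases "l \<le> u")
  case True
  have l: "l \<le> 0" using True assms by simp
  have "bounded_linear (\<lambda>x. E l (P1 x))"
    by (rule bounded_linear_intro[where K = "M * exp (\<beta> * l)"])
      (use h2[OF l] in \<open>simp_all add: P_add P_scale E_props(5)[OF P1_in P1_in] E_props(6)[OF P1_in] mult_ac\<close>)
  then have "continuous_on {l..u} (\<lambda>s. E l (P1 (f s)))" using f by (rule bounded_linear.continuous_on)
  then have "continuous_on {l..u} (\<lambda>s. T (s - l) (E l (P1 (f s))))"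
    by (rule T.continuous_on_S_compose[where b = "u - l", rotated]) (auto intro!: continuous_intros)
  then have "continuous_on {l..u} (\<lambda>s. G 0 (T (s - l) (E l (P1 (f s)))))" by (rule bounded_linear.continuous_on[OF bounded_linear_G])
  moreover have "G 0 (T (s - l) (E l (P1 (f s)))) = G s (f s)" if s: "s \<in> {l..u}" for s
  proof (rule J_eqD)
    have "T (s - l) (E l (P1 (f s))) = E s (P1 (f s))" using T_E[OF P1_in, of "s - l" l "f s"] s by simp
    then show "J (G 0 (T (s - l) (E l (P1 (f s))))) = J (G s (f s))"
      using s assms(1) E_props(1)[OF E_props(2)[OF P1_in]] by (simp add: J_G_neg P1_X1[OF E_props(2)[OF P1_in]])
  qed
  ultimately show ?thesis by (rule continuous_on_eq)
qed simp

text \<open>The forcing is allowed to jump at time \<open>0\<close>, so that forcings on the half line are included.\<close>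

definition forcing :: "real \<Rightarrow> (real \<Rightarrow> 'x) \<Rightarrow> bool" where
  "forcing K f \<longleftrightarrow> (\<exists>f1. continuous_on {..0} f1 \<and> (\<forall>s<0. f s = f1 s)) \<and> continuous_on {0..} f \<and> (\<forall>s. norm (f s) \<le> K)"

definition GI :: "(real \<Rightarrow> 'x) \<Rightarrow> real \<Rightarrow> 'x" where
  "GI f t = integral UNIV (\<lambda>s. G s (f (t - s)))"

lemma norm_G_forcing: "norm (f (t - s)) \<le> K \<Longrightarrow> norm (G s (f (t - s))) \<le> (M * K) * greenk \<alpha> \<beta> s"
  using order_trans[OF norm_G_le mult_left_mono[of "norm (f (t - s))" K "M * greenk \<alpha> \<beta> s"]] M greenk_pos[of \<alpha> \<beta> s]
  by (simp add: mult_ac)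

lemma integrable_Mgreenk: "(\<lambda>s. K * greenk \<alpha> \<beta> s) integrable_on UNIV"
  by (rule integrable_on_mult_right[OF integrable_greenk[OF \<alpha>(2) \<beta>]])

lemma continuous_on_G:
  assumes "u < 0 \<or> 0 < l" "continuous_on {l..u} f"
  shows "continuous_on {l..u} (\<lambda>s. G s (f s))"
  using assms continuous_on_G_pos continuous_on_G_neg by (cases "0 < l") auto

lemma integrable_G:
  assumes f: "forcing K f"
  shows "(\<lambda>s. G s (f (t - s))) integrable_on UNIV"
proof (rule dominated_integrable_UNIV[where k = "\<lambda>s. (M * K) * greenk \<alpha> \<beta> s", OF _ integrable_Mgreenk])
  show "norm (G s (f (t - s))) \<le> (M * K) * greenk \<alpha> \<beta> s" for s
    using norm_G_forcing f unfolding forcing_def by blast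
  obtain f1 where f1: "continuous_on {..0} f1" "\<And>s. s < 0 \<Longrightarrow> f s = f1 s" and f2: "continuous_on {0..} f"
    using f unfolding forcing_def by blast
  fix a b :: real assume ab: "b < 0 \<or> 0 < a"
  have left: "(\<lambda>s. G s (f (t - s))) integrable_on {a'..b'}" if "b' \<le> t" "b' < 0 \<or> 0 < a'" for a' b'
  proof (rule integrable_continuous_real, rule continuous_on_G[OF that(2)])
    show "continuous_on {a'..b'} (\<lambda>s. f (t - s))"
      by (rule continuous_on_compose2[OF f2]) (use that in \<open>auto intro: continuous_intros\<close>)
  qed
  have right: "(\<lambda>s. G s (f (t - s))) integrable_on {a'..b'}" if "t \<le> a'" "b' < 0 \<or> 0 < a'" for a' b'
  proof -
    have "continuous_on {a'..b'} (\<lambda>s. f1 (t - s))"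
      by (rule continuous_on_compose2[OF f1(1)]) (use that in \<open>auto intro: continuous_intros\<close>)
    then have "(\<lambda>s. G s (f1 (t - s))) integrable_on {a'..b'}"
      by (rule integrable_continuous_real[OF continuous_on_G[OF that(2)]])
    then show ?thesis
      by (rule integrable_spike_finite[of "{t}", rotated 2]) (use f1(2) that in auto)
  qed
  show "(\<lambda>s. G s (f (t - s))) integrable_on {a..b}"
  proof (cases "a \<le> t \<and> t \<le> b")
    case True
    then show ?thesis
      using Henstock_Kurzweil_Integration.integrable_combine[of a t b "\<lambda>s. G s (f (t - s))"] left[of t a] right[of t b] ab by auto
  next
    case False
    then show ?thesis using left[of b a] right[of a b] ab by force
  qed
qed

lemma norm_GI_le:
  assumes f: "forcing K f"
  shows "norm (GI f t) \<le> M * K * integral UNIV (greenk \<alpha> \<beta>)"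
proof -
  have "norm (GI f t) \<le> integral UNIV (\<lambda>s. (M * K) * greenk \<alpha> \<beta> s)"
    unfolding GI_def
    by (rule Henstock_Kurzweil_Integration.integral_norm_bound_integral[OF integrable_G[OF f] integrable_Mgreenk])
      (use norm_G_forcing f in \<open>auto simp: forcing_def\<close>)
  then show ?thesis by simp
qed

lemma GI_variation:
  assumes f: "forcing K f" and "\<tau> \<le> t"
  shows "((\<lambda>\<sigma>. T (t - \<sigma>) (f \<sigma>)) has_integral (J (GI f t) - T (t - \<tau>) (J (GI f \<tau>)))) {\<tau>..t}"
proof -
  define h where "h = t - \<tau>"
  have h: "0 \<le> h" using assms by (simp add: h_def)
  have 0: "((\<lambda>s. J (G s (f (t - s)))) has_integral J (GI f t)) UNIV"
    using has_integral_linear[OF integrable_integral[OF integrable_G[OF f, of t]] bounded_linear_J]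
    by (simp add: GI_def o_def)
  have 1: "((\<lambda>s. J (G (s + h) (f (\<tau> - s)))) has_integral J (GI f t)) UNIV"
    using has_integral_shift_UNIV[OF 0, of h] by (simp add: h_def algebra_simps)
  have "bounded_linear (\<lambda>x. T h (J x))" by (rule bounded_linear_compose[OF T.bounded_linear_S[OF h] bounded_linear_J])
  from has_integral_linear[OF integrable_integral[OF integrable_G[OF f, of \<tau>]] this]
  have 2: "((\<lambda>s. T h (J (G s (f (\<tau> - s))))) has_integral T h (J (GI f \<tau>))) UNIV" by (simp add: GI_def o_def)
  have eq: "(\<lambda>s. J (G (s + h) (f (\<tau> - s))) - T h (J (G s (f (\<tau> - s))))) = (\<lambda>s. if - h < s \<and> s \<le> 0 then T (s + h) (f (\<tau> - s)) else 0)"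
    by (rule ext) (simp add: T_J_G[OF h])
  have 3: "((\<lambda>s. if - h < s \<and> s \<le> 0 then T (s + h) (f (\<tau> - s)) else 0) has_integral (J (GI f t) - T h (J (GI f \<tau>)))) UNIV"
    using has_integral_diff[OF 1 2] unfolding eq .
  from has_integral_shift_UNIV[OF has_integral_uminus_UNIV[OF 3], of "- \<tau>"]
  have 4: "((\<lambda>\<sigma>. if - h < - (\<sigma> + - \<tau>) \<and> - (\<sigma> + - \<tau>) \<le> 0 then T (- (\<sigma> + - \<tau>) + h) (f (\<tau> - - (\<sigma> + - \<tau>))) else 0)
     has_integral (J (GI f t) - T h (J (GI f \<tau>)))) UNIV" .
  have "((\<lambda>\<sigma>. if \<sigma> \<in> {\<tau>..t} then T (t - \<sigma>) (f \<sigma>) else 0) has_integral (J (GI f t) - T h (J (GI f \<tau>)))) UNIV"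
    by (rule has_integral_spike_finite[OF _ _ 4, of "{t}"]) (auto simp: h_def)
  then have "((\<lambda>\<sigma>. T (t - \<sigma>) (f \<sigma>)) has_integral (J (GI f t) - T h (J (GI f \<tau>)))) {\<tau>..t}"
    by (rule has_integral_restrict_UNIV[THEN iffD1])
  then show ?thesis by (simp add: h_def)
qed

lemma P2_GI_0:
  assumes f: "forcing K f" and f0: "\<And>s. s < 0 \<Longrightarrow> f s = 0"
  shows "P2 (J (GI f 0)) = 0"
proof -
  have "bounded_linear (\<lambda>x. P2 (J x))" by (rule bounded_linear_compose[OF bounded_linear_P2 bounded_linear_J])
  from has_integral_linear[OF integrable_integral[OF integrable_G[OF f, of 0]] this]
  have "((\<lambda>s. P2 (J (G s (f (0 - s))))) has_integral P2 (J (GI f 0))) UNIV" by (simp add: GI_def o_def)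
  moreover have "(\<lambda>s. P2 (J (G s (f (0 - s))))) = (\<lambda>s. 0)"
  proof
    fix s
    show "P2 (J (G s (f (0 - s)))) = 0"
    proof (cases "0 < s")
    case True
    then show ?thesis using f0[of "- s"] linear_0[OF bounded_linear.linear[OF bounded_linear_G]]
      by (simp add: J_zero P2_X1 subspace_0[OF X1(1)])
  next
    case False
    have "- E s (P1 (f (0 - s))) \<in> X1" by (rule subspace_neg[OF X1(1) E_props(2)[OF P1_in]])
    then show ?thesis using False by (simp add: J_G_neg P2_X1)
    qed
  qed
  ultimately have "((\<lambda>s::real. 0::'x) has_integral P2 (J (GI f 0))) UNIV" by (simp only:)
  then show ?thesis by (rule has_integral_unique[OF _ has_integral_0])
qed

text \<open>A bounded mild solution on the half line is the Green integral of its forcing, up to the decaying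
  contribution of the stable part of its initial value.\<close>

lemma half_line_representation:
  assumes f: "forcing K f" and f0: "\<And>s. s < 0 \<Longrightarrow> f s = 0"
    and w: "\<And>t. 0 \<le> t \<Longrightarrow> J (w t) = T t (J (w 0)) + integral {0..t} (\<lambda>s. T (t - s) (f s))"
    and bd: "\<And>t. 0 \<le> t \<Longrightarrow> norm (w t) \<le> K'" and t: "0 < t"
  shows "w t = Q t (w 0) + GI f t"
proof -
  define z where "z = J (w 0) - J (GI f 0)"
  have z: "J (w t) - J (GI f t) = T t z" if "0 \<le> t" for t
    using w[OF that] integral_unique[OF GI_variation[OF f that]] T.S_diff[OF that] by (simp add: z_def)
  obtain KJ where KJ: "KJ \<ge> 0" "\<And>x. norm (J x) \<le> KJ * norm x"
    using bounded_linear.nonneg_bounded[OF bounded_linear_J] by (metis mult.commute)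
  have "P2 z = z"
  proof (rule bounded_imp_P2)
    fix t :: real assume t: "0 \<le> t"
    have "norm (T t z) = norm (J (w t - GI f t))" using z[OF t] by (simp add: J_diff)
    also have "\<dots> \<le> KJ * norm (w t - GI f t)" by (rule KJ)
    also have "\<dots> \<le> KJ * (K' + M * K * integral UNIV (greenk \<alpha> \<beta>))"
      using KJ(1) norm_triangle_ineq4[of "w t" "GI f t"] bd[OF t] norm_GI_le[OF f, of t] by (intro mult_left_mono) auto
    finally show "norm (T t z) \<le> KJ * (K' + M * K * integral UNIV (greenk \<alpha> \<beta>))" .
  qed
  moreover have "P2 z = P2 (J (w 0))"
    unfolding z_def linear_diff[OF bounded_linear.linear[OF bounded_linear_P2]] using P2_GI_0[OF f] f0 by simp
  ultimately have "T t z = J (Q t (w 0))" using J_Q[OF t] by simp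
  then have "J (w t) = J (Q t (w 0) + GI f t)" using z[of t] t by (simp add: J_add diff_eq_eq)
  then show ?thesis by (rule J_eqD)
qed

end

section \<open>The retarded equation\<close>

locale retarded_equation = dichotomy D L S C \<delta> r \<mu> \<alpha> A T C' \<omega> \<mu>' a M \<beta> X1 X2
  for D :: "'x::banach set" and L :: "'x \<Rightarrow> 'x" and S :: "real \<Rightarrow> 'x \<Rightarrow> 'x" and C \<delta> r \<mu> \<alpha>
    and A :: "'x \<Rightarrow> 'x" and T :: "real \<Rightarrow> 'x \<Rightarrow> 'x" and C' \<omega> \<mu>' a M \<beta> :: real and X1 X2 :: "'x set" +
  fixes \<theta> :: "real \<Rightarrow> 'h::metric_space \<Rightarrow> 'h" and F :: "'h \<Rightarrow> (real \<Rightarrow> 'x) \<Rightarrow> 'x" and \<rho> \<eta> :: real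
  assumes cpt: "compact (UNIV :: 'h set)" and ds: "dynamical_system \<theta>" and \<rho>: "0 \<le> \<rho>"
    and F_cont: "continuous_nonlinearity D L \<alpha> \<rho> F" and \<eta>: "0 < \<eta>"
    and F_lip: "\<And>p \<phi> \<phi>'. \<phi> \<in> C_space D L \<alpha> \<rho> \<Longrightarrow> \<phi>' \<in> C_space D L \<alpha> \<rho> \<Longrightarrow>
           norm (F p \<phi> - F p \<phi>') \<le> \<eta> * C_norm D L \<alpha> \<rho> (\<lambda>s. \<phi> s - \<phi>' s)"
    and small: "\<eta> * M * integral UNIV (greenk \<alpha> \<beta>) < 1"
begin

abbreviation Ik where "Ik \<equiv> integral UNIV (greenk \<alpha> \<beta>)"

lemma Ik_nonneg: "0 \<le> Ik"
  by (rule integral_nonneg[OF integrable_greenk[OF \<alpha>(2) \<beta>]]) (simp add: greenk_pos)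

lemma flow_0: "\<theta> 0 p = p" and flow_add: "\<theta> (s + t) p = \<theta> s (\<theta> t p)"
  and flow_cont: "continuous_on X (\<lambda>(t, p). \<theta> t p)"
  using ds continuous_on_subset[of UNIV "\<lambda>(t, p). \<theta> t p" X] unfolding dynamical_system_def by auto

lemma continuous_on_flow [continuous_intros]:
  assumes "continuous_on X f" "continuous_on X g"
  shows "continuous_on X (\<lambda>x. \<theta> (f x) (g x))"
  using continuous_on_compose2[OF flow_cont[of UNIV] continuous_on_Pair[OF assms]] by simp

lemma frac_norm_fp: "frac_norm D L \<alpha> u = norm (fp u)"
  by (simp add: frac_norm_def frac_pow_def J_def)

lemma frac_continuous_fp:
  "frac_continuous_on D L \<alpha> X f \<longleftrightarrow> (\<forall>t\<in>X. f t \<in> range J) \<and> continuous_on X (\<lambda>t. fp (f t))"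
  by (simp add: frac_continuous_on_def frac_space_def frac_pow_def J_def)

lemma C_space_J: "continuous_on {-\<rho>..0} \<psi> \<Longrightarrow> (\<lambda>s. J (\<psi> s)) \<in> C_space D L \<alpha> \<rho>"
  by (simp add: C_space_def frac_continuous_fp fp_J)

lemma C_norm_le:
  assumes "\<And>s. s \<in> {-\<rho>..0} \<Longrightarrow> norm (fp (\<phi> s)) \<le> b"
  shows "C_norm D L \<alpha> \<rho> \<phi> \<le> b"
  unfolding C_norm_def by (rule cSUP_least) (use assms \<rho> in \<open>auto simp: frac_norm_fp\<close>)

lemma C_norm_upper:
  assumes "\<phi> \<in> C_space D L \<alpha> \<rho>" "s \<in> {-\<rho>..0}"
  shows "norm (fp (\<phi> s)) \<le> C_norm D L \<alpha> \<rho> \<phi>"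
proof -
  have "continuous_on {-\<rho>..0} (\<lambda>s. norm (fp (\<phi> s)))"
    using assms(1) by (auto simp: C_space_def frac_continuous_fp intro: continuous_on_norm)
  then have "compact ((\<lambda>s. norm (fp (\<phi> s))) ` {-\<rho>..0})" by (rule compact_continuous_image) simp
  then have "bdd_above ((\<lambda>s. norm (fp (\<phi> s))) ` {-\<rho>..0})" by (intro bounded_imp_bdd_above compact_imp_bounded)
  then show ?thesis unfolding C_norm_def frac_norm_fp by (rule cSUP_upper[OF assms(2)])
qed

definition nl :: "'h \<Rightarrow> (real \<Rightarrow> 'x) \<Rightarrow> 'x" where "nl p \<psi> = F p (\<lambda>s. J (\<psi> s))"

lemma nl_lipschitz:
  assumes "continuous_on {-\<rho>..0} \<psi>" "continuous_on {-\<rho>..0} \<psi>'"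
    and "\<And>s. s \<in> {-\<rho>..0} \<Longrightarrow> norm (\<psi> s - \<psi>' s) \<le> b"
  shows "norm (nl p \<psi> - nl p \<psi>') \<le> \<eta> * b"
proof -
  have "C_norm D L \<alpha> \<rho> (\<lambda>s. J (\<psi> s) - J (\<psi>' s)) \<le> b"
    by (rule C_norm_le) (use assms(3) in \<open>simp add: J_diff[symmetric] fp_J\<close>)
  from mult_left_mono[OF this less_imp_le[OF \<eta>]] show ?thesis
    using F_lip[OF C_space_J[OF assms(1)] C_space_J[OF assms(2)], of p] unfolding nl_def by linarith
qed

lemma nl_fp:
  assumes "\<phi> \<in> C_space D L \<alpha> \<rho>"
  shows "nl p (\<lambda>s. fp (\<phi> s)) = F p \<phi>"
proof -
  have c: "continuous_on {-\<rho>..0} (\<lambda>s. fp (\<phi> s))" "\<And>s. s \<in> {-\<rho>..0} \<Longrightarrow> \<phi> s \<in> range J"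
    using assms by (auto simp: C_space_def frac_continuous_fp)
  have "C_norm D L \<alpha> \<rho> (\<lambda>s. J (fp (\<phi> s)) - \<phi> s) \<le> 0"
    using c(2) fp_J[of 0] by (intro C_norm_le) (simp add: J_fp J_zero)
  from mult_left_mono[OF this less_imp_le[OF \<eta>]]
  have "norm (F p (\<lambda>s. J (fp (\<phi> s))) - F p \<phi>) \<le> 0"
    using F_lip[OF C_space_J[OF c(1)] assms, of p] by linarith
  then show ?thesis by (simp add: nl_def)
qed

lemma continuous_on_nl:
  fixes p :: "'t::topological_space \<Rightarrow> 'h"
  assumes p: "continuous_on X p" and \<psi>: "continuous_on (X \<times> {-\<rho>..0}) (\<lambda>(t, s). \<psi> t s)"
  shows "continuous_on X (\<lambda>t. nl (p t) (\<psi> t))"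
  unfolding continuous_on_def tendsto_iff
proof (intro ballI allI impI)
  fix x :: 't and e :: real assume x: "x \<in> X" and e: "0 < e"
  have \<psi>c: "continuous_on {-\<rho>..0} (\<psi> t)" if "t \<in> X" for t
  proof -
    have "continuous_on {-\<rho>..0} (\<lambda>s. (\<lambda>(t, s). \<psi> t s) (t, s))"
      by (rule continuous_on_compose2[OF \<psi>]) (use that in \<open>auto intro: continuous_intros\<close>)
    then show ?thesis by simp
  qed
  obtain d where d: "0 < d" and dF: "\<And>p' \<phi>'. \<phi>' \<in> C_space D L \<alpha> \<rho> \<Longrightarrow> dist p' (p x) < d \<Longrightarrow>
      C_norm D L \<alpha> \<rho> (\<lambda>s. \<phi>' s - J (\<psi> x s)) < d \<Longrightarrow> norm (F p' \<phi>' - F (p x) (\<lambda>s. J (\<psi> x s))) < e"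
    using F_cont C_space_J[OF \<psi>c[OF x]] e unfolding continuous_nonlinearity_def by meson
  obtain X0 where X0: "x \<in> X0" "open X0"
    "\<forall>t\<in>X0 \<inter> X. \<forall>s\<in>{-\<rho>..0}. dist ((\<lambda>(t, s). \<psi> t s) (t, s)) ((\<lambda>(t, s). \<psi> t s) (x, s)) \<le> d / 2"
    by (rule continuous_on_prod_compactE[OF \<psi> _ x, of "d / 2"]) (use d in auto)
  have "\<forall>\<^sub>F t in at x within X. t \<in> X0 \<and> t \<in> X"
    unfolding eventually_at_topological using X0(1,2) by blast
  moreover have "\<forall>\<^sub>F t in at x within X. dist (p t) (p x) < d"
    using p x d by (simp add: continuous_on_def tendsto_iff)
  ultimately show "\<forall>\<^sub>F t in at x within X. dist (nl (p t) (\<psi> t)) (nl (p x) (\<psi> x)) < e"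
  proof eventually_elim
    case (elim t)
    then have "C_norm D L \<alpha> \<rho> (\<lambda>s. J (\<psi> t s) - J (\<psi> x s)) \<le> d / 2"
      using X0(3) by (intro C_norm_le) (auto simp: J_diff[symmetric] fp_J dist_norm)
    then show ?case using dF[OF C_space_J[OF \<psi>c]] elim d by (simp add: nl_def dist_norm)
  qed
qed

lemma forcing_mono: "forcing K f \<Longrightarrow> (\<And>s. norm (f s) \<le> K') \<Longrightarrow> forcing K' f"
  by (simp add: forcing_def)

lemma forcing_continuous: "continuous_on UNIV f \<Longrightarrow> (\<And>s. norm (f s) \<le> K) \<Longrightarrow> forcing K f"
  unfolding forcing_def by (auto intro: continuous_on_subset)

lemma GI_diff:
  assumes "forcing K f" "forcing K' f'"
  shows "GI (\<lambda>s. f s - f' s) t = GI f t - GI f' t"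
proof -
  have "(\<lambda>s. G s (f (t - s) - f' (t - s))) = (\<lambda>s. G s (f (t - s)) - G s (f' (t - s)))"
    by (rule ext) (rule linear_diff[OF bounded_linear.linear[OF bounded_linear_G]])
  then show ?thesis
    unfolding GI_def using Henstock_Kurzweil_Integration.integral_diff[OF integrable_G[OF assms(1)] integrable_G[OF assms(2)]]
    by simp
qed

lemma norm_GI_split:
  assumes f: "forcing K f" and d: "\<And>s. s \<in> {-m..m} \<Longrightarrow> norm (f (t - s)) \<le> d" and "0 \<le> d"
  shows "norm (GI f t) \<le> M * d * Ik + M * K * (Ik - integral {-m..m} (greenk \<alpha> \<beta>))"
proof -
  have gi: "greenk \<alpha> \<beta> integrable_on {-m..m}"
    by (rule integrable_on_subinterval[OF integrable_greenk[OF \<alpha>(2) \<beta>]]) simp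
  have "norm (integral UNIV (\<lambda>s. G s (f (t - s))) - integral {-m..m} (\<lambda>s. G s (f (t - s))))
      \<le> integral UNIV (\<lambda>s. (M * K) * greenk \<alpha> \<beta> s) - integral {-m..m} (\<lambda>s. (M * K) * greenk \<alpha> \<beta> s)"
    by (rule integral_UNIV_tail[OF integrable_G[OF f] integrable_Mgreenk])
      (use norm_G_forcing f in \<open>auto simp: forcing_def\<close>)
  also have "\<dots> = M * K * (Ik - integral {-m..m} (greenk \<alpha> \<beta>))" by (simp add: algebra_simps)
  finally have 1: "norm (GI f t - integral {-m..m} (\<lambda>s. G s (f (t - s)))) \<le> M * K * (Ik - integral {-m..m} (greenk \<alpha> \<beta>))"
    by (simp only: GI_def)
  have "norm (integral {-m..m} (\<lambda>s. G s (f (t - s)))) \<le> integral {-m..m} (\<lambda>s. (M * d) * greenk \<alpha> \<beta> s)"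
  proof (rule Henstock_Kurzweil_Integration.integral_norm_bound_integral)
    show "(\<lambda>s. G s (f (t - s))) integrable_on {-m..m}"
      by (rule integrable_on_subinterval[OF integrable_G[OF f]]) simp
    show "(\<lambda>s. (M * d) * greenk \<alpha> \<beta> s) integrable_on {-m..m}" using gi by (rule integrable_on_mult_right)
    show "norm (G s (f (t - s))) \<le> (M * d) * greenk \<alpha> \<beta> s" if "s \<in> {-m..m}" for s
      using d[OF that] by (rule norm_G_forcing)
  qed
  also have "\<dots> = M * d * integral {-m..m} (greenk \<alpha> \<beta>)" by simp
  also have "\<dots> \<le> M * d * Ik"
    using integral_subset_le[OF _ gi integrable_greenk[OF \<alpha>(2) \<beta>]] M \<open>0 \<le> d\<close> greenk_pos
    by (intro mult_left_mono) auto
  finally show ?thesis using 1 norm_triangle_sub[of "GI f t" "integral {-m..m} (\<lambda>s. G s (f (t - s)))"] by linarith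
qed

lemma greenk_tail_small:
  assumes "0 < e"
  obtains m where "0 < m" "Ik - integral {-m..m} (greenk \<alpha> \<beta>) < e"
proof -
  have "(\<lambda>n. Ik - integral {-real n..real n} (greenk \<alpha> \<beta>)) \<longlonglongrightarrow> Ik - Ik"
    by (intro tendsto_diff tendsto_const tendsto_integral_UNIV integrable_greenk[OF \<alpha>(2) \<beta>])
  then have "\<forall>\<^sub>F n in sequentially. Ik - integral {-real n..real n} (greenk \<alpha> \<beta>) < e"
    using assms by (intro order_tendstoD(2)) auto
  moreover have "\<forall>\<^sub>F n in sequentially. 0 < n" by (rule eventually_gt_at_top)
  ultimately have "\<forall>\<^sub>F n in sequentially. 0 < n \<and> Ik - integral {-real n..real n} (greenk \<alpha> \<beta>) < e"
    by eventually_elim simp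
  then obtain n where "0 < n" "Ik - integral {-real n..real n} (greenk \<alpha> \<beta>) < e"
    using eventually_happens'[OF sequentially_bot] by blast
  then show ?thesis using that[of "real n"] by simp
qed

lemma bounded_of_continuous:
  fixes g :: "'h \<Rightarrow> 'x"
  assumes "continuous_on UNIV g"
  obtains K where "0 \<le> K" "\<And>p. norm (g p) \<le> K"
proof -
  have "bounded (range g)" using compact_continuous_image[OF assms cpt] by (rule compact_imp_bounded)
  then obtain K where "\<forall>x\<in>range g. norm x \<le> K" unfolding bounded_iff by blast
  then have "norm (g p) \<le> max K 0" for p by (simp add: le_max_iff_disj)
  then show ?thesis using that[of "max K 0"] by simp
qed

definition nle :: "('h \<Rightarrow> 'x) \<Rightarrow> 'h \<Rightarrow> 'x" where
  "nle g p = nl p (\<lambda>\<sigma>. g (\<theta> \<sigma> p))"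

lemma continuous_on_orbit: "continuous_on UNIV g \<Longrightarrow> continuous_on X (\<lambda>\<sigma>. g (\<theta> \<sigma> p))"
  by (rule continuous_on_compose2[of UNIV g]) (auto intro!: continuous_intros)

lemma continuous_on_nle:
  assumes "continuous_on UNIV g"
  shows "continuous_on UNIV (nle g)"
  unfolding nle_def
proof (rule continuous_on_nl[OF continuous_on_id])
  have "continuous_on (UNIV \<times> {-\<rho>..0}) (\<lambda>x. g (\<theta> (snd x) (fst x)))"
    by (rule continuous_on_compose2[OF assms]) (auto intro!: continuous_intros)
  then show "continuous_on (UNIV \<times> {-\<rho>..0}) (\<lambda>(t, s). g (\<theta> s t))" by (simp add: case_prod_unfold)
qed

lemma forcing_nle:
  assumes "continuous_on UNIV g" "\<And>p. norm (nle g p) \<le> K"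
  shows "forcing K (\<lambda>s. nle g (\<theta> s p))"
  by (rule forcing_continuous[OF continuous_on_orbit[OF continuous_on_nle[OF assms(1)]] assms(2)])

lemma GI_flow: "GI (\<lambda>s. f (\<theta> s p)) t = GI (\<lambda>s. f (\<theta> s (\<theta> t p))) 0"
  unfolding GI_def by (simp add: flow_add[symmetric])

lemma continuous_on_GI:
  assumes f: "continuous_on UNIV f"
  shows "continuous_on UNIV (\<lambda>p. GI (\<lambda>s. f (\<theta> s p)) 0)"
  unfolding continuous_on_def tendsto_iff
proof (intro ballI allI impI)
  fix p and e :: real assume e: "0 < e"
  obtain K where K: "0 \<le> K" "\<And>p. norm (f p) \<le> K" using bounded_of_continuous[OF f] by blast
  have fc: "forcing K (\<lambda>s. f (\<theta> s q))" for q
    by (rule forcing_continuous[OF continuous_on_orbit[OF f] K(2)])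
  have MK: "0 < M * (2 * K) + 1" using M K(1) by (intro add_nonneg_pos) auto
  obtain m where m: "0 < m" "Ik - integral {-m..m} (greenk \<alpha> \<beta>) < e / 2 / (M * (2 * K) + 1)"
    by (rule greenk_tail_small[of "e / 2 / (M * (2 * K) + 1)"]) (use e MK in simp)
  define t where "t = Ik - integral {-m..m} (greenk \<alpha> \<beta>)"
  have "M * (2 * K) * t \<le> M * (2 * K) * (e / 2 / (M * (2 * K) + 1))"
    using m(2) M K(1) by (intro mult_left_mono) (auto simp: t_def)
  also have "\<dots> < e / 2" using e MK by (simp add: field_simps)
  finally have tail: "M * (2 * K) * t < e / 2" .
  define d where "d = e / 2 / (M * Ik + 1)"
  have MI: "0 < M * Ik + 1" using M Ik_nonneg by (intro add_nonneg_pos) auto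
  have d: "0 < d" using e MI by (simp add: d_def)
  have dd: "M * d * Ik \<le> e / 2" using e MI by (simp add: d_def field_simps)
  have "continuous_on (UNIV \<times> {-m..m}) (\<lambda>x. f (\<theta> (- snd x) (fst x)))"
    by (rule continuous_on_compose2[OF f]) (auto intro!: continuous_intros)
  from continuous_on_prod_compactE[OF this compact_Icc UNIV_I[of p] d]
  obtain X0 where X0: "p \<in> X0" "open X0" "\<forall>q\<in>X0 \<inter> UNIV. \<forall>s\<in>{-m..m}.
      dist (f (\<theta> (- snd (q, s)) (fst (q, s)))) (f (\<theta> (- snd (p, s)) (fst (p, s)))) \<le> d" by blast
  have "\<forall>\<^sub>F q in at p within UNIV. q \<in> X0"
    unfolding eventually_at_topological using X0(1,2) by blast
  then show "\<forall>\<^sub>F q in at p within UNIV. dist (GI (\<lambda>s. f (\<theta> s q)) 0) (GI (\<lambda>s. f (\<theta> s p)) 0) < e"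
  proof eventually_elim
    case (elim q)
    have bd: "norm (f (\<theta> s q) - f (\<theta> s p)) \<le> 2 * K" for s
      using norm_triangle_ineq4[of "f (\<theta> s q)" "f (\<theta> s p)"] K(2)[of "\<theta> s q"] K(2)[of "\<theta> s p"] by linarith
    have "forcing (2 * K) (\<lambda>s. f (\<theta> s q) - f (\<theta> s p))"
      by (rule forcing_continuous[OF continuous_on_diff bd]) (rule continuous_on_orbit[OF f])+
    then have "norm (GI (\<lambda>s. f (\<theta> s q) - f (\<theta> s p)) 0) \<le> M * d * Ik + M * (2 * K) * t"
      unfolding t_def by (rule norm_GI_split) (use X0(3) elim d in \<open>auto simp: dist_norm\<close>)
    then show ?case using dd tail GI_diff[OF fc fc] by (simp add: dist_norm)
  qed
qed

lemma equilibrium_exists: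
  obtains g where "continuous_on UNIV g" "\<And>p. g p = GI (\<lambda>s. nle g (\<theta> s p)) 0"
proof -
  define \<Phi> :: "('h \<Rightarrow>\<^sub>C 'x) \<Rightarrow> ('h \<Rightarrow>\<^sub>C 'x)" where
    "\<Phi> g = Bcontfun (\<lambda>p. GI (\<lambda>s. nle (apply_bcontfun g) (\<theta> s p)) 0)" for g
  have cont: "continuous_on UNIV (apply_bcontfun g)" for g :: "'h \<Rightarrow>\<^sub>C 'x" by (rule continuous_on_apply_bcontfun)
  have \<Phi>: "apply_bcontfun (\<Phi> g) p = GI (\<lambda>s. nle (apply_bcontfun g) (\<theta> s p)) 0" for g p
  proof -
    have "continuous_on UNIV (\<lambda>p. GI (\<lambda>s. nle (apply_bcontfun g) (\<theta> s p)) 0)"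
      by (rule continuous_on_GI[OF continuous_on_nle[OF cont]])
    moreover from this obtain K where "\<And>p. norm (GI (\<lambda>s. nle (apply_bcontfun g) (\<theta> s p)) 0) \<le> K"
      by (rule bounded_of_continuous) blast
    ultimately have "(\<lambda>p. GI (\<lambda>s. nle (apply_bcontfun g) (\<theta> s p)) 0) \<in> bcontfun" by (rule bcontfun_normI)
    then show ?thesis by (simp add: \<Phi>_def Bcontfun_inverse)
  qed
  have "\<exists>!g. \<Phi> g = g"
  proof (rule banach_fix_type[where c = "\<eta> * M * Ik"])
    show "0 \<le> \<eta> * M * Ik" using \<eta> M Ik_nonneg by simp
    show "\<eta> * M * Ik < 1" by (rule small)
    show "\<forall>g g'. dist (\<Phi> g) (\<Phi> g') \<le> \<eta> * M * Ik * dist g g'"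
    proof (intro allI dist_bound)
      fix g g' :: "'h \<Rightarrow>\<^sub>C 'x" and p
      have bd: "norm (nle g q - nle g' q) \<le> \<eta> * dist g g'" for q
        unfolding nle_def
        by (rule nl_lipschitz[OF continuous_on_orbit[OF cont] continuous_on_orbit[OF cont]])
          (simp add: dist_norm[symmetric] dist_bounded)
      obtain K where K: "\<And>q. norm (nle g q) \<le> K" using bounded_of_continuous[OF continuous_on_nle[OF cont]] by blast
      obtain K' where K': "\<And>q. norm (nle g' q) \<le> K'" using bounded_of_continuous[OF continuous_on_nle[OF cont]] by blast
      have "forcing (\<eta> * dist g g') (\<lambda>s. nle g (\<theta> s p) - nle g' (\<theta> s p))"
        by (rule forcing_continuous[OF continuous_on_diff bd]) (rule continuous_on_orbit[OF continuous_on_nle[OF cont]])+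
      from norm_GI_le[OF this, of 0]
      show "dist (apply_bcontfun (\<Phi> g) p) (apply_bcontfun (\<Phi> g') p) \<le> \<eta> * M * Ik * dist g g'"
        unfolding \<Phi> dist_norm GI_diff[OF forcing_nle[OF cont K] forcing_nle[OF cont K']] by (simp add: mult_ac)
    qed
  qed
  then obtain g where g: "\<Phi> g = g" by blast
  have "apply_bcontfun g p = GI (\<lambda>s. nle (apply_bcontfun g) (\<theta> s p)) 0" for p using \<Phi>[of g p] g by simp
  then show ?thesis using that[OF cont] by blast
qed

subsection \<open>Bounded solutions relative to the equilibrium\<close>

text \<open>\<open>w\<close> is the difference of two bounded solutions and \<open>f\<close> that of the nonlinear terms along them.\<close>

definition perturbation :: "(real \<Rightarrow> 'x) \<Rightarrow> (real \<Rightarrow> 'x) \<Rightarrow> bool" where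
  "perturbation w f \<longleftrightarrow> (\<forall>s<0. f s = 0) \<and> (\<exists>K. forcing K f) \<and> (\<exists>K. \<forall>s\<ge>-\<rho>. norm (w s) \<le> K) \<and>
     (\<forall>s\<ge>0. \<forall>b. (\<forall>\<sigma>\<in>{s-\<rho>..s}. norm (w \<sigma>) \<le> b) \<longrightarrow> norm (f s) \<le> \<eta> * b) \<and>
     (\<forall>t>0. w t = Q t (w 0) + GI f t)"

lemma perturbation_forcing:
  assumes w: "perturbation w f" and b: "\<And>s. - \<rho> \<le> s \<Longrightarrow> norm (w s) \<le> b"
  shows "forcing (\<eta> * b) f"
proof -
  obtain K where K: "forcing K f" using w unfolding perturbation_def by blast
  have "0 \<le> b" using order_trans[OF norm_ge_zero b[of 0]] \<rho> by simp
  then have "norm (f s) \<le> \<eta> * b" for s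
    using w b \<eta> by (cases "s < 0") (auto simp: perturbation_def)
  with K show ?thesis by (rule forcing_mono)
qed

lemma perturbation_bound:
  assumes w: "perturbation w f" and m0: "\<And>s. s \<in> {-\<rho>..0} \<Longrightarrow> norm (w s) \<le> m0" and t: "- \<rho> \<le> t"
  shows "norm (w t) \<le> M / (1 - \<eta> * M * Ik) * m0"
proof -
  define B where "B = (SUP s\<in>{-\<rho>..}. norm (w s))"
  have bdd: "bdd_above ((\<lambda>s. norm (w s)) ` {-\<rho>..})" using w unfolding perturbation_def bdd_above_def by blast
  have B: "norm (w s) \<le> B" if "- \<rho> \<le> s" for s
    unfolding B_def by (rule cSUP_upper[OF _ bdd]) (use that in simp)
  have m0': "0 \<le> m0" using order_trans[OF norm_ge_zero m0[of 0]] \<rho> by simp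
  have "norm (w s) \<le> M * m0 + \<eta> * M * Ik * B" if s: "- \<rho> \<le> s" for s
  proof (cases "0 < s")
    case True
    have "norm (Q s (w 0)) \<le> M * exp (- \<beta> * s) * norm (w 0)" by (rule norm_Q_le[OF True])
    also have "\<dots> \<le> M * 1 * m0" using M True \<beta> m0[of 0] \<rho> by (intro mult_mono) auto
    finally have "norm (Q s (w 0)) \<le> M * m0" by simp
    moreover have "norm (GI f s) \<le> M * (\<eta> * B) * Ik" by (rule norm_GI_le[OF perturbation_forcing[OF w B]])
    moreover have "w s = Q s (w 0) + GI f s" using w True unfolding perturbation_def by blast
    ultimately show ?thesis using norm_triangle_ineq[of "Q s (w 0)" "GI f s"] by (simp add: mult_ac)
  next
    case False
    then have "norm (w s) \<le> m0" using m0 s by simp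
    also have "\<dots> \<le> M * m0" using M m0' mult_right_mono[of 1 M m0] by simp
    also have "\<dots> \<le> M * m0 + \<eta> * M * Ik * B"
      using \<eta> M Ik_nonneg order_trans[OF norm_ge_zero B[OF s]] by simp
    finally show ?thesis .
  qed
  then have "B \<le> M * m0 + \<eta> * M * Ik * B" unfolding B_def by (intro cSUP_least) auto
  then have "B * (1 - \<eta> * M * Ik) \<le> M * m0" by (simp add: algebra_simps)
  then have "B \<le> M * m0 / (1 - \<eta> * M * Ik)" using small by (simp add: pos_le_divide_eq)
  then show ?thesis using B[OF t] by simp
qed

text \<open>Each time step of fixed length replaces a bound \<open>q^n m + \<epsilon>/2\<close> by \<open>q^(n+1) m + \<epsilon>/2\<close>.\<close>

lemma perturbation_decay:
  assumes m0: "0 < m0" and \<epsilon>: "0 < \<epsilon>"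
  shows "\<exists>t0>0. \<forall>w f t. perturbation w f \<longrightarrow> (\<forall>s\<in>{-\<rho>..0}. norm (w s) \<le> m0) \<longrightarrow> t0 < t \<longrightarrow> norm (w t) < \<epsilon>"
proof -
  define q where "q = \<eta> * M * Ik"
  have q: "0 \<le> q" "q < 1" using \<eta> M Ik_nonneg small by (auto simp: q_def)
  define m where "m = M / (1 - q) * m0"
  have m: "0 < m" using M q m0 by (simp add: m_def)
  define e where "e = \<epsilon> / 2 * (1 - q)"
  have e: "0 < e" using \<epsilon> q by (simp add: e_def)
  have k0: "0 < M * (\<eta> * m)" using M \<eta> m by simp
  obtain k where k: "0 < k" "Ik - integral {-k..k} (greenk \<alpha> \<beta>) < e / 2 / (M * (\<eta> * m))"
    by (rule greenk_tail_small[of "e / 2 / (M * (\<eta> * m))"]) (use e k0 in simp)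
  have tail: "M * (\<eta> * m) * (Ik - integral {-k..k} (greenk \<alpha> \<beta>)) < e / 2"
    using iffD1[OF pos_less_divide_eq[OF k0] k(2)] by (simp only: mult.commute)
  have "filterlim (\<lambda>t. - \<beta> * t) at_bot at_top"
    by (rule filterlim_tendsto_neg_mult_at_bot[OF tendsto_const _ filterlim_ident]) (use \<beta> in simp)
  then have "((\<lambda>t. exp (- \<beta> * t)) \<longlongrightarrow> 0) at_top" by (rule filterlim_compose[OF exp_at_bot])
  then have "((\<lambda>t. M * exp (- \<beta> * t) * m0) \<longlongrightarrow> M * 0 * m0) at_top" by (intro tendsto_intros)
  then have "\<forall>\<^sub>F t in at_top. M * exp (- \<beta> * t) * m0 < e / 2" using e by (intro order_tendstoD(2)) auto
  then obtain k' where k': "\<And>t. k' \<le> t \<Longrightarrow> M * exp (- \<beta> * t) * m0 < e / 2"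
    unfolding eventually_at_top_linorder by blast
  define h where "h = \<rho> + k + \<bar>k'\<bar>"
  have h: "0 < h" using \<rho> k(1) by (simp add: h_def)
  have "(\<lambda>n. q ^ n * m) \<longlonglongrightarrow> 0 * m" by (intro tendsto_intros LIMSEQ_realpow_zero q)
  then have "\<forall>\<^sub>F n in sequentially. q ^ n * m < \<epsilon> / 2" using \<epsilon> by (intro order_tendstoD(2)) auto
  then obtain n where n: "q ^ n * m < \<epsilon> / 2" using eventually_happens'[OF sequentially_bot] by blast
  show ?thesis
  proof (intro exI[of _ "real n * h + 1"] conjI allI impI)
    show "0 < real n * h + 1" using h by (intro add_nonneg_pos) auto
    fix w f t assume w: "perturbation w f" and w0: "\<forall>s\<in>{-\<rho>..0}. norm (w s) \<le> m0" and t: "real n * h + 1 < t"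
    have wm: "norm (w s) \<le> m" if "- \<rho> \<le> s" for s
      using perturbation_bound[OF w bspec[OF w0] that] by (simp add: m_def q_def)
    have step: "norm (w s) \<le> q * b + e"
      if b: "\<And>s. \<tau> \<le> s \<Longrightarrow> norm (w s) \<le> b" and "0 \<le> \<tau>" and s: "\<tau> + h \<le> s" for \<tau> b s
    proof -
      have s0: "0 < s" "k' \<le> s" using s h \<open>0 \<le> \<tau>\<close> \<rho> k(1) by (auto simp: h_def)
      have b0: "0 \<le> b" using b[of \<tau>] norm_ge_zero order_trans by blast
      have "norm (GI f s) \<le> M * (\<eta> * b) * Ik + M * (\<eta> * m) * (Ik - integral {-k..k} (greenk \<alpha> \<beta>))"
      proof (rule norm_GI_split[OF perturbation_forcing[OF w wm]])
        fix \<sigma> assume \<sigma>: "\<sigma> \<in> {-k..k}"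
        have "\<tau> + \<rho> \<le> s - \<sigma>" using \<sigma> s by (auto simp: h_def)
        then have "0 \<le> s - \<sigma>" "\<forall>x\<in>{s - \<sigma> - \<rho>..s - \<sigma>}. norm (w x) \<le> b" using \<open>0 \<le> \<tau>\<close> \<rho> b by auto
        then show "norm (f (s - \<sigma>)) \<le> \<eta> * b" using w unfolding perturbation_def by blast
      qed (use \<eta> b0 in auto)
      moreover have "norm (Q s (w 0)) \<le> e / 2"
      proof -
        have "norm (Q s (w 0)) \<le> M * exp (- \<beta> * s) * norm (w 0)" by (rule norm_Q_le[OF s0(1)])
        also have "\<dots> \<le> M * exp (- \<beta> * s) * m0" using bspec[OF w0, of 0] \<rho> M by (intro mult_left_mono) auto
        finally show ?thesis using k'[OF s0(2)] by linarith
      qed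
      moreover have "w s = Q s (w 0) + GI f s" using w s0 unfolding perturbation_def by blast
      moreover have "q * b = M * (\<eta> * b) * Ik" by (simp add: q_def)
      ultimately show ?thesis
        using norm_triangle_ineq[of "Q s (w 0)" "GI f s"] tail by (simp only:)
    qed
    have iter: "\<forall>s\<ge>real j * h. norm (w s) \<le> q ^ j * m + \<epsilon> / 2" for j
    proof (induction j)
      case 0
      show ?case
      proof (intro allI impI)
        fix s assume "real 0 * h \<le> s"
        then have "norm (w s) \<le> m" using wm \<rho> by simp
        then show "norm (w s) \<le> q ^ 0 * m + \<epsilon> / 2" using \<epsilon> by simp
      qed
    next
      case (Suc j)
      show ?case
      proof (intro allI impI)
        fix s assume "real (Suc j) * h \<le> s"
        then have "real j * h + h \<le> s" by (simp add: algebra_simps)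
        then have "norm (w s) \<le> q * (q ^ j * m + \<epsilon> / 2) + e"
          by (rule step[rotated 2]) (use Suc h in auto)
        also have "\<dots> = q ^ Suc j * m + \<epsilon> / 2" by (simp add: e_def field_simps)
        finally show "norm (w s) \<le> q ^ Suc j * m + \<epsilon> / 2" .
      qed
    qed
    have "real n * h \<le> t" using t by simp
    then show "norm (w t) < \<epsilon>" using iter[of n] n by fastforce
  qed
qed

context
  fixes g :: "'h \<Rightarrow> 'x"
  assumes g_cont: "continuous_on UNIV g" and g_fix: "\<And>p. g p = GI (\<lambda>s. nle g (\<theta> s p)) 0"
begin

lemma equilibrium_GI: "g (\<theta> t p) = GI (\<lambda>s. nle g (\<theta> s p)) t"
  by (subst GI_flow) (rule g_fix)

lemma equilibrium_variation:
  assumes "\<tau> \<le> t"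
  shows "((\<lambda>s. T (t - s) (nle g (\<theta> s p))) has_integral (J (g (\<theta> t p)) - T (t - \<tau>) (J (g (\<theta> \<tau> p))))) {\<tau>..t}"
proof -
  obtain K where K: "\<And>q. norm (nle g q) \<le> K" using bounded_of_continuous[OF continuous_on_nle[OF g_cont]] by blast
  show ?thesis unfolding equilibrium_GI by (rule GI_variation[OF forcing_nle[OF g_cont K] assms])
qed

lemma F_equilibrium: "F (\<theta> s p) (lift_at (\<lambda>t. J (g (\<theta> t p))) s) = nle g (\<theta> s p)"
  by (simp add: nle_def nl_def lift_at_def flow_add[symmetric] add.commute)

lemma nonautonomous_equilibrium_J: "nonautonomous_equilibrium D A L \<alpha> \<theta> F (\<lambda>p. J (g p))"
  unfolding nonautonomous_equilibrium_def complete_solution_def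
proof (intro conjI allI impI)
  obtain K where K: "\<And>p. norm (g p) \<le> K" using bounded_of_continuous[OF g_cont] by blast
  show "frac_continuous_on D L \<alpha> UNIV (\<lambda>p. J (g p))" using g_cont by (simp add: frac_continuous_fp fp_J)
  fix p
  show "frac_continuous_on D L \<alpha> UNIV (\<lambda>t. J (g (\<theta> t p)))"
    using continuous_on_orbit[OF g_cont] by (simp add: frac_continuous_fp fp_J)
  show "frac_bounded_on D L \<alpha> UNIV (\<lambda>t. J (g (\<theta> t p)))"
    unfolding frac_bounded_on_def frac_norm_fp fp_J by (rule bdd_aboveI2[where M = K]) (rule K)
  fix \<tau> t :: real assume t: "\<tau> \<le> t"
  have "integral {\<tau>..t} (\<lambda>s. exp_semigroup UNIV D A (t - s) (F (\<theta> s p) (lift_at (\<lambda>t. J (g (\<theta> t p))) s)))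
      = integral {\<tau>..t} (\<lambda>s. T (t - s) (nle g (\<theta> s p)))"
    by (rule Henstock_Kurzweil_Integration.integral_cong) (simp add: F_equilibrium T.exp_semigroup_eq)
  then show "J (g (\<theta> t p)) = exp_semigroup UNIV D A (t - \<tau>) (J (g (\<theta> \<tau> p))) +
      integral {\<tau>..t} (\<lambda>s. exp_semigroup UNIV D A (t - s) (F (\<theta> s p) (lift_at (\<lambda>t. J (g (\<theta> t p))) s)))"
    using integral_unique[OF equilibrium_variation[OF t]] t by (simp add: T.exp_semigroup_eq)
qed

lemma bounded_solution_perturbation:
  assumes u: "mild_solution D A L \<alpha> \<rho> \<theta> F p \<phi> u" and bd: "frac_bounded_on D L \<alpha> {-\<rho>..} u"
  obtains f where "perturbation (\<lambda>t. fp (u t) - g (\<theta> t p)) f"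
proof -
  define w where "w t = fp (u t) - g (\<theta> t p)" for t
  define f where "f s = (if s < 0 then 0 else nl (\<theta> s p) (\<lambda>\<sigma>. fp (u (s + \<sigma>))) - nle g (\<theta> s p))" for s
  have ur: "u t \<in> range J" if "- \<rho> \<le> t" for t
    using u that unfolding mild_solution_def frac_continuous_fp by auto
  have uc: "continuous_on {-\<rho>..} (\<lambda>t. fp (u t))"
    using u unfolding mild_solution_def frac_continuous_fp by auto
  have uc': "continuous_on {-\<rho>..0} (\<lambda>\<sigma>. fp (u (s + \<sigma>)))" if "0 \<le> s" for s
    by (rule continuous_on_compose2[OF uc]) (use that in \<open>auto intro!: continuous_intros\<close>)
  have "continuous_on ({0..} \<times> {-\<rho>..0}) (\<lambda>x. fp (u (fst x + snd x)))"
    by (rule continuous_on_compose2[OF uc]) (auto intro!: continuous_intros)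
  then have "continuous_on {0..} (\<lambda>s. nl (\<theta> s p) (\<lambda>\<sigma>. fp (u (s + \<sigma>))))"
    by (intro continuous_on_nl) (auto simp: case_prod_unfold intro!: continuous_intros)
  then have "continuous_on {0..} (\<lambda>s. nl (\<theta> s p) (\<lambda>\<sigma>. fp (u (s + \<sigma>))) - nle g (\<theta> s p))"
    by (rule continuous_on_diff[OF _ continuous_on_orbit[OF continuous_on_nle[OF g_cont]]])
  then have fcont: "continuous_on {0..} f" by (rule continuous_on_eq) (simp add: f_def)
  obtain Kg where Kg: "\<And>q. norm (g q) \<le> Kg" using bounded_of_continuous[OF g_cont] by blast
  obtain Ku where Ku: "\<And>t. - \<rho> \<le> t \<Longrightarrow> norm (fp (u t)) \<le> Ku"
    using bd unfolding frac_bounded_on_def frac_norm_fp bdd_above_def by auto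
  have wK: "norm (w t) \<le> Ku + Kg" if "- \<rho> \<le> t" for t
    using Ku[OF that] Kg[of "\<theta> t p"] norm_triangle_ineq4[of "fp (u t)" "g (\<theta> t p)"] by (simp add: w_def)
  have f0: "f s = 0" if "s < 0" for s using that by (simp add: f_def)
  have flip: "norm (f s) \<le> \<eta> * b" if s: "0 \<le> s" and b: "\<forall>\<sigma>\<in>{s-\<rho>..s}. norm (w \<sigma>) \<le> b" for s b
  proof -
    have "norm (nl (\<theta> s p) (\<lambda>\<sigma>. fp (u (s + \<sigma>))) - nl (\<theta> s p) (\<lambda>\<sigma>. g (\<theta> \<sigma> (\<theta> s p)))) \<le> \<eta> * b"
    proof (rule nl_lipschitz[OF uc'[OF s] continuous_on_orbit[OF g_cont]])
      fix \<sigma> assume "\<sigma> \<in> {-\<rho>..0}"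
      then have "s + \<sigma> \<in> {s-\<rho>..s}" by simp
      then have "norm (w (s + \<sigma>)) \<le> b" using b by blast
      then show "norm (fp (u (s + \<sigma>)) - g (\<theta> \<sigma> (\<theta> s p))) \<le> b"
        by (simp add: w_def flow_add[symmetric] add.commute)
    qed
    then show ?thesis using s by (simp add: f_def nle_def)
  qed
  have fK: "norm (f s) \<le> \<eta> * (Ku + Kg)" for s
  proof (cases "s < 0")
    case True
    have "0 \<le> Ku + Kg" using order_trans[OF norm_ge_zero wK[of 0]] \<rho> by simp
    then show ?thesis using True \<eta> by (simp add: f0)
  next
    case False
    then show ?thesis using wK by (intro flip) auto
  qed
  have force: "forcing (\<eta> * (Ku + Kg)) f"
    unfolding forcing_def using fcont fK f0 by (auto intro!: exI[of _ "\<lambda>_. 0"] continuous_intros)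
  have Jw: "J (w t) = u t - J (g (\<theta> t p))" if "- \<rho> \<le> t" for t
    using J_fp[OF ur[OF that]] by (simp add: w_def J_diff)
  have mild: "J (w t) = T t (J (w 0)) + integral {0..t} (\<lambda>s. T (t - s) (f s))" if t: "0 \<le> t" for t
  proof -
    have Tf: "(\<lambda>s. T (t - s) (f s)) integrable_on {0..t}"
      using GI_variation[OF force t] by (rule has_integral_integrable)
    note Tg = equilibrium_variation[OF t, of p]
    have "integral {0..t} (\<lambda>s. exp_semigroup UNIV D A (t - s) (F (\<theta> s p) (lift_at u s)))
       = integral {0..t} (\<lambda>s. T (t - s) (f s) + T (t - s) (nle g (\<theta> s p)))"
    proof (rule Henstock_Kurzweil_Integration.integral_cong)
      fix s assume s: "s \<in> {0..t}"
      have "lift_at u s \<in> C_space D L \<alpha> \<rho>"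
        using uc'[of s] ur s by (auto simp: C_space_def frac_continuous_fp lift_at_def)
      from nl_fp[OF this, of "\<theta> s p"]
      have "F (\<theta> s p) (lift_at u s) = f s + nle g (\<theta> s p)" using s by (simp add: f_def lift_at_def)
      then show "exp_semigroup UNIV D A (t - s) (F (\<theta> s p) (lift_at u s)) = T (t - s) (f s) + T (t - s) (nle g (\<theta> s p))"
        using s by (simp add: T.exp_semigroup_eq T.add)
    qed
    also have "\<dots> = integral {0..t} (\<lambda>s. T (t - s) (f s)) + (J (g (\<theta> t p)) - T t (J (g p)))"
      using Henstock_Kurzweil_Integration.integral_add[OF Tf has_integral_integrable[OF Tg]] integral_unique[OF Tg]
      by (simp add: flow_0)
    finally have I: "integral {0..t} (\<lambda>s. exp_semigroup UNIV D A (t - s) (F (\<theta> s p) (lift_at u s))) = \<dots>" .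
    have "u t = exp_semigroup UNIV D A t (\<phi> 0) + integral {0..t} (\<lambda>s. exp_semigroup UNIV D A (t - s) (F (\<theta> s p) (lift_at u s)))"
      and "u 0 = \<phi> 0" using u t \<rho> unfolding mild_solution_def by auto
    then have "u t = T t (u 0) + (integral {0..t} (\<lambda>s. T (t - s) (f s)) + (J (g (\<theta> t p)) - T t (J (g p))))"
      using I T.exp_semigroup_eq[OF t] by simp
    moreover have "T t (J (w 0)) = T t (u 0) - T t (J (g p))" using Jw[of 0] \<rho> T.S_diff[OF t] by (simp add: flow_0)
    ultimately show ?thesis using Jw[of t] t \<rho> by simp
  qed
  have "w t = Q t (w 0) + GI f t" if "0 < t" for t
  proof (rule half_line_representation[OF force _ _ _ that])
    show "norm (w s) \<le> Ku + Kg" if "0 \<le> s" for s using wK[of s] that \<rho> by simp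
  qed (fact f0 mild)+
  then have "perturbation w f"
    unfolding perturbation_def using f0 force wK flip by blast
  then show ?thesis using that unfolding w_def[abs_def] by blast
qed

end

theorem equilibrium_attracts:
  "\<exists>\<Gamma>. nonautonomous_equilibrium D A L \<alpha> \<theta> F \<Gamma> \<and>
    (\<forall>R>0. \<forall>\<epsilon>>0. \<exists>t0>0. \<forall>p. \<forall>\<phi>\<in>C_space D L \<alpha> \<rho>. \<forall>u.
        mild_solution D A L \<alpha> \<rho> \<theta> F p \<phi> u \<and> frac_bounded_on D L \<alpha> {-\<rho>..} u \<and>
        C_norm D L \<alpha> \<rho> \<phi> \<le> R \<longrightarrow>
        (\<forall>t>t0. frac_norm D L \<alpha> (u t - \<Gamma> (\<theta> t p)) < \<epsilon>)) \<and>
    (\<exists>c>0. \<forall>p. \<forall>\<phi>\<in>C_space D L \<alpha> \<rho>. \<forall>u.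
        mild_solution D A L \<alpha> \<rho> \<theta> F p \<phi> u \<and> frac_bounded_on D L \<alpha> {-\<rho>..} u \<longrightarrow>
        (\<forall>t\<ge>0. frac_norm D L \<alpha> (u t - \<Gamma> (\<theta> t p))
                \<le> c * C_norm D L \<alpha> \<rho> (\<lambda>s. \<phi> s - \<Gamma> (\<theta> s p))))"
proof -
  obtain g where g: "continuous_on UNIV g" "\<And>p. g p = GI (\<lambda>s. nle g (\<theta> s p)) 0" using equilibrium_exists by blast
  obtain Kg where Kg: "0 \<le> Kg" "\<And>p. norm (g p) \<le> Kg" using bounded_of_continuous[OF g(1)] by blast
  have diff: "frac_norm D L \<alpha> (u t - J (g (\<theta> t p))) = norm (fp (u t) - g (\<theta> t p))" if "u t \<in> range J" for u t p
    using that by (auto simp: frac_norm_fp J_diff[symmetric] fp_J)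
  have ur: "u t \<in> range J" if "mild_solution D A L \<alpha> \<rho> \<theta> F p \<phi> u" "- \<rho> \<le> t" for p \<phi> u t
    using that unfolding mild_solution_def frac_continuous_fp by auto
  have init: "u s = \<phi> s" if "mild_solution D A L \<alpha> \<rho> \<theta> F p \<phi> u" "s \<in> {-\<rho>..0}" for p \<phi> u s
    using that unfolding mild_solution_def by auto
  show ?thesis
  proof (intro exI[of _ "\<lambda>p. J (g p)"] conjI)
    show "nonautonomous_equilibrium D A L \<alpha> \<theta> F (\<lambda>p. J (g p))" by (rule nonautonomous_equilibrium_J[OF g])
    show "\<forall>R>0. \<forall>\<epsilon>>0. \<exists>t0>0. \<forall>p. \<forall>\<phi>\<in>C_space D L \<alpha> \<rho>. \<forall>u.
        mild_solution D A L \<alpha> \<rho> \<theta> F p \<phi> u \<and> frac_bounded_on D L \<alpha> {-\<rho>..} u \<and>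
        C_norm D L \<alpha> \<rho> \<phi> \<le> R \<longrightarrow> (\<forall>t>t0. frac_norm D L \<alpha> (u t - J (g (\<theta> t p))) < \<epsilon>)"
    proof (intro allI impI)
      fix R \<epsilon> :: real assume "0 < R" "0 < \<epsilon>"
      then have "0 < R + Kg" using Kg(1) by simp
      obtain t0 where t0: "0 < t0" "\<And>w f t. perturbation w f \<Longrightarrow> \<forall>s\<in>{-\<rho>..0}. norm (w s) \<le> R + Kg
          \<Longrightarrow> t0 < t \<Longrightarrow> norm (w t) < \<epsilon>"
        using perturbation_decay[OF \<open>0 < R + Kg\<close> \<open>0 < \<epsilon>\<close>] by blast
      have "frac_norm D L \<alpha> (u t - J (g (\<theta> t p))) < \<epsilon>"
        if \<phi>: "\<phi> \<in> C_space D L \<alpha> \<rho>" and u: "mild_solution D A L \<alpha> \<rho> \<theta> F p \<phi> u" "frac_bounded_on D L \<alpha> {-\<rho>..} u"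
          and R: "C_norm D L \<alpha> \<rho> \<phi> \<le> R" and t: "t0 < t" for p \<phi> u t
      proof -
        obtain f where f: "perturbation (\<lambda>t. fp (u t) - g (\<theta> t p)) f"
          by (rule bounded_solution_perturbation[OF g u])
        have "norm (fp (u t) - g (\<theta> t p)) < \<epsilon>"
        proof (rule t0(2)[OF f _ t], rule ballI)
          fix s assume s: "s \<in> {-\<rho>..0}"
          have "norm (fp (u s)) \<le> R" using C_norm_upper[OF \<phi> s] R init[OF u(1) s] by simp
          then show "norm (fp (u s) - g (\<theta> s p)) \<le> R + Kg"
            using Kg(2)[of "\<theta> s p"] norm_triangle_ineq4[of "fp (u s)" "g (\<theta> s p)"] by simp
        qed
        moreover have "u t \<in> range J" by (rule ur[OF u(1)]) (use t t0(1) \<rho> in simp)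
        ultimately show ?thesis by (simp add: diff)
      qed
      then show "\<exists>t0>0. \<forall>p. \<forall>\<phi>\<in>C_space D L \<alpha> \<rho>. \<forall>u.
        mild_solution D A L \<alpha> \<rho> \<theta> F p \<phi> u \<and> frac_bounded_on D L \<alpha> {-\<rho>..} u \<and>
        C_norm D L \<alpha> \<rho> \<phi> \<le> R \<longrightarrow> (\<forall>t>t0. frac_norm D L \<alpha> (u t - J (g (\<theta> t p))) < \<epsilon>)"
        using t0(1) by blast
    qed
    have c: "0 < M / (1 - \<eta> * M * Ik)" using M small by simp
    have "frac_norm D L \<alpha> (u t - J (g (\<theta> t p))) \<le> M / (1 - \<eta> * M * Ik) * C_norm D L \<alpha> \<rho> (\<lambda>s. \<phi> s - J (g (\<theta> s p)))"
      if \<phi>: "\<phi> \<in> C_space D L \<alpha> \<rho>" and u: "mild_solution D A L \<alpha> \<rho> \<theta> F p \<phi> u" "frac_bounded_on D L \<alpha> {-\<rho>..} u"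
        and t: "0 \<le> t" for p \<phi> u t
    proof -
      obtain f where f: "perturbation (\<lambda>t. fp (u t) - g (\<theta> t p)) f"
        by (rule bounded_solution_perturbation[OF g u])
      have \<phi>': "\<phi> s \<in> range J" if "s \<in> {-\<rho>..0}" for s using \<phi> that by (simp add: C_space_def frac_continuous_fp)
      have fpd: "fp (\<phi> s - J (g (\<theta> s p))) = fp (\<phi> s) - g (\<theta> s p) \<and> \<phi> s - J (g (\<theta> s p)) \<in> range J"
        if s: "s \<in> {-\<rho>..0}" for s
        using \<phi>'[OF s] by (auto simp: J_diff[symmetric] fp_J)
      have "continuous_on {-\<rho>..0} (\<lambda>s. fp (\<phi> s) - g (\<theta> s p))"
        using \<phi> by (intro continuous_on_diff continuous_on_orbit[OF g(1)]) (simp add: C_space_def frac_continuous_fp)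
      then have "continuous_on {-\<rho>..0} (\<lambda>s. fp (\<phi> s - J (g (\<theta> s p))))" by (rule continuous_on_eq) (use fpd in simp)
      then have C: "(\<lambda>s. \<phi> s - J (g (\<theta> s p))) \<in> C_space D L \<alpha> \<rho>" using fpd by (simp add: C_space_def frac_continuous_fp)
      have "norm (fp (u t) - g (\<theta> t p)) \<le> M / (1 - \<eta> * M * Ik) * C_norm D L \<alpha> \<rho> (\<lambda>s. \<phi> s - J (g (\<theta> s p)))"
      proof (rule perturbation_bound[OF f])
        show "norm (fp (u s) - g (\<theta> s p)) \<le> C_norm D L \<alpha> \<rho> (\<lambda>s. \<phi> s - J (g (\<theta> s p)))" if s: "s \<in> {-\<rho>..0}" for s
          using C_norm_upper[OF C s] fpd[OF s] init[OF u(1) s] by simp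
      qed (use t \<rho> in simp)
      moreover have "u t \<in> range J" by (rule ur[OF u(1)]) (use t \<rho> in simp)
      ultimately show ?thesis by (simp add: diff)
    qed
    then show "\<exists>c>0. \<forall>p. \<forall>\<phi>\<in>C_space D L \<alpha> \<rho>. \<forall>u.
        mild_solution D A L \<alpha> \<rho> \<theta> F p \<phi> u \<and> frac_bounded_on D L \<alpha> {-\<rho>..} u \<longrightarrow>
        (\<forall>t\<ge>0. frac_norm D L \<alpha> (u t - J (g (\<theta> t p))) \<le> c * C_norm D L \<alpha> \<rho> (\<lambda>s. \<phi> s - J (g (\<theta> s p))))"
      using c by blast
  qed
qed

end

theorem theorem4p5:
  fixes \<theta> :: "real \<Rightarrow> 'h::metric_space \<Rightarrow> 'h"
    and D :: "'x::banach set" and A \<Lambda> P1 P2 :: "'x \<Rightarrow> 'x"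
    and X1 X2 :: "'x set"
    and \<sigma>m \<sigma>p :: "complex set"
    and a \<alpha> r \<beta> L M :: real
    and F :: "'h \<Rightarrow> (real \<Rightarrow> 'x) \<Rightarrow> 'x"
  assumes "compact (UNIV :: 'h set)" and "dynamical_system \<theta>" and "minimal_system \<theta>"
    and "sectorial D A" and "compact_resolvent D A"
    and "0 \<le> r" and "0 \<le> \<alpha>" and "\<alpha> < 1"
    and \<Lambda>: "\<Lambda> = (\<lambda>x. A x + a *\<^sub>R x)" and "\<forall>z\<in>spectrum UNIV D \<Lambda>. Re z > 0"
    and "continuous_nonlinearity D \<Lambda> \<alpha> r F"
    and "L > 0"
    and "\<forall>p. \<forall>\<phi>\<in>C_space D \<Lambda> \<alpha> r. \<forall>\<phi>'\<in>C_space D \<Lambda> \<alpha> r.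
           norm (F p \<phi> - F p \<phi>') \<le> L * C_norm D \<Lambda> \<alpha> r (\<lambda>s. \<phi> s - \<phi>' s)"
    and "\<beta> > 0"
    and "spectrum UNIV D A = \<sigma>m \<union> \<sigma>p"
    and "\<forall>z\<in>\<sigma>m. Re z \<le> - \<beta>" and "\<forall>z\<in>\<sigma>p. Re z \<ge> \<beta>"
    and "spectral_splitting D A \<sigma>m \<sigma>p X1 X2"
    and P1: "P1 = direct_proj X1 X2" and P2: "P2 = direct_proj X2 X1"
    and "M \<ge> 1"
    and "\<forall>t\<le>0. \<forall>x. exp_op A t (P1 x) \<in> frac_space D \<Lambda> \<alpha> \<and>
           norm (frac_pow D \<Lambda> \<alpha> (exp_op A t (P1 x))) \<le> M * exp (\<beta> * t) * norm x"
    and "\<forall>t\<le>0. \<forall>x. norm (exp_op A t (P1 x)) \<le> M * exp (\<beta> * t) * norm x"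
    and "\<forall>t>0. \<forall>x. exp_semigroup X2 (D \<inter> X2) A t (P2 (frac_neg D \<Lambda> \<alpha> x)) \<in> frac_space D \<Lambda> \<alpha> \<and>
           norm (frac_pow D \<Lambda> \<alpha> (exp_semigroup X2 (D \<inter> X2) A t (P2 (frac_neg D \<Lambda> \<alpha> x))))
             \<le> M * exp (- \<beta> * t) * norm x"
    and "\<forall>t>0. \<forall>x. exp_semigroup X2 (D \<inter> X2) A t (P2 x) \<in> frac_space D \<Lambda> \<alpha> \<and>
           norm (frac_pow D \<Lambda> \<alpha> (exp_semigroup X2 (D \<inter> X2) A t (P2 x)))
             \<le> M * t powr (- \<alpha>) * exp (- \<beta> * t) * norm x"
    and "L < 1 / (kappa0 \<alpha> \<beta> * M)"
  shows "\<exists>\<Gamma>. nonautonomous_equilibrium D A \<Lambda> \<alpha> \<theta> F \<Gamma> \<and>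
    (\<forall>R>0. \<forall>\<epsilon>>0. \<exists>T>0. \<forall>p. \<forall>\<phi>\<in>C_space D \<Lambda> \<alpha> r. \<forall>u.
        mild_solution D A \<Lambda> \<alpha> r \<theta> F p \<phi> u \<and> frac_bounded_on D \<Lambda> \<alpha> {-r..} u \<and>
        C_norm D \<Lambda> \<alpha> r \<phi> \<le> R \<longrightarrow>
        (\<forall>t>T. frac_norm D \<Lambda> \<alpha> (u t - \<Gamma> (\<theta> t p)) < \<epsilon>)) \<and>
    (\<exists>c>0. \<forall>p. \<forall>\<phi>\<in>C_space D \<Lambda> \<alpha> r. \<forall>u.
        mild_solution D A \<Lambda> \<alpha> r \<theta> F p \<phi> u \<and> frac_bounded_on D \<Lambda> \<alpha> {-r..} u \<longrightarrow>
        (\<forall>t\<ge>0. frac_norm D \<Lambda> \<alpha> (u t - \<Gamma> (\<theta> t p))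
                \<le> c * C_norm D \<Lambda> \<alpha> r (\<lambda>s. \<phi> s - \<Gamma> (\<theta> s p))))"
proof -
  obtain S C \<delta> r0 \<mu> where \<delta>: "\<delta> > 0" and S': "solution_family D (\<lambda>x. A x + a *\<^sub>R x) S C (- \<delta>) r0 \<mu>"
    and T: "solution_family D A (\<lambda>t x. exp (a * t) *\<^sub>R S t x) C (a - \<delta>) r0 (\<mu> + a)"
    by (rule sectorial_solution_families[OF assms(4) assms(10)[unfolded \<Lambda>]])
  from S' have S: "solution_family D \<Lambda> S C (- \<delta>) r0 \<mu>" by (simp only: \<Lambda>)
  have fs: "frac_setting D \<Lambda> S C \<delta> r0 \<mu> \<alpha>"
    by (rule frac_setting.intro[OF S frac_setting_axioms.intro[OF \<delta> assms(7,8)]])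
  have J: "frac_setting.J D \<Lambda> \<alpha> = frac_neg D \<Lambda> \<alpha>" by (rule frac_setting.J_def[OF fs])
  note defs = frac_space_def frac_pow_def P1 P2
  have split: "subspace X1" "closed X1" "subspace X2" "closed X2" "X1 \<inter> X2 = {0}"
    "{x + y | x y. x \<in> X1 \<and> y \<in> X2} = UNIV" "X1 \<subseteq> D" "A ` X1 \<subseteq> X1" "A ` (D \<inter> X2) \<subseteq> X2"
    "\<exists>K. \<forall>x\<in>X1. norm (A x) \<le> K * norm x"
    using assms(18) unfolding spectral_splitting_def by blast+
  have dich: "dichotomy D \<Lambda> S C \<delta> r0 \<mu> \<alpha> A (\<lambda>t x. exp (a * t) *\<^sub>R S t x) C (a - \<delta>) (\<mu> + a) a M \<beta> X1 X2"
  proof (rule dichotomy.intro[OF fs], rule dichotomy_axioms.intro)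
    show "\<exists>y\<in>X1. \<exists>z\<in>X2. x = y + z" for x using split(6) by blast
    show "A x \<in> X1" if "x \<in> X1" for x using split(8) that by blast
    show "A x \<in> X2" if "x \<in> D \<inter> X2" for x using split(9) that by blast
    fix t :: real and x
    show "exp_op A t (direct_proj X1 X2 x) \<in> range (frac_setting.J D \<Lambda> \<alpha>) \<and>
        norm (inv (frac_setting.J D \<Lambda> \<alpha>) (exp_op A t (direct_proj X1 X2 x))) \<le> M * exp (\<beta> * t) * norm x" if "t \<le> 0"
      using assms(22) that unfolding J defs by blast
    show "norm (exp_op A t (direct_proj X1 X2 x)) \<le> M * exp (\<beta> * t) * norm x" if "t \<le> 0"
      using assms(23) that unfolding defs by blast
    show "exp_semigroup X2 (D \<inter> X2) A t (direct_proj X2 X1 (frac_setting.J D \<Lambda> \<alpha> x)) \<in> range (frac_setting.J D \<Lambda> \<alpha>) \<and>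
        norm (inv (frac_setting.J D \<Lambda> \<alpha>) (exp_semigroup X2 (D \<inter> X2) A t (direct_proj X2 X1 (frac_setting.J D \<Lambda> \<alpha> x))))
          \<le> M * exp (- \<beta> * t) * norm x" if "0 < t"
      using assms(24) that unfolding J defs by blast
    show "exp_semigroup X2 (D \<inter> X2) A t (direct_proj X2 X1 x) \<in> range (frac_setting.J D \<Lambda> \<alpha>) \<and>
        norm (inv (frac_setting.J D \<Lambda> \<alpha>) (exp_semigroup X2 (D \<inter> X2) A t (direct_proj X2 X1 x)))
          \<le> M * t powr (- \<alpha>) * exp (- \<beta> * t) * norm x" if "0 < t"
      using assms(25) that unfolding J defs by blast
  qed (fact T refl split assms)+
  have "0 < 1 / (kappa0 \<alpha> \<beta> * M)" using assms(12,26) by linarith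
  then have \<kappa>: "0 < kappa0 \<alpha> \<beta> * M" by (simp add: zero_less_divide_iff)
  have "L * M * integral UNIV (greenk \<alpha> \<beta>) \<le> L * M * kappa0 \<alpha> \<beta>"
    using assms(12,21) integral_greenk_le_kappa0[OF assms(8,14)] by (intro mult_left_mono) auto
  also have "\<dots> < 1" using assms(26) \<kappa> by (simp add: pos_less_divide_eq mult_ac)
  finally have small: "L * M * integral UNIV (greenk \<alpha> \<beta>) < 1" .
  have "retarded_equation D \<Lambda> S C \<delta> r0 \<mu> \<alpha> A (\<lambda>t x. exp (a * t) *\<^sub>R S t x) C (a - \<delta>) (\<mu> + a) a M \<beta> X1 X2 \<theta> F r L"
    by (rule retarded_equation.intro[OF dich], rule retarded_equation_axioms.intro) (use assms(1,2,6,11,12,13) small in blast)+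
  then show ?thesis by (rule retarded_equation.equilibrium_attracts)
qed

end
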